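(* Let $n>1$ and let $\phi\colon X\to\mathfrak{u}(n)\oplus\mathfrak{gl}(n,\mathbb{C})$, where $X=\operatorname{Hom}_{\mathbb{C}}(\mathbb{C}^n,\mathbb{C}^n)\oplus\operatorname{Hom}_{\mathbb{C}}(\mathbb{C}^n,\mathbb{C}^n)$, be the map $$\phi(A,B)=\left(\tfrac{i}{2}(A^*A-BB^* ),\,BA\right).$$ A point $(A,B)\in X$ with $A,B$ invertible is a critical point of $\phi$ if and only if $L=B^{-1}A^*$ has a pair of eigenvalues of the form $\lambda,\,-1/\overline{\lambda}$ for some complex number $\lambda\neq 0$. The set of critical points of $\phi$ has real codimension two in $X$, and the regular points of $\phi$ form an open dense set in $X$.
   Context: $A^*$ denotes the conjugate transpose. $X\cong\mathbb{H}^{n^2}$ is regarded as a real vector space of dimension $4n^2$, and $\mathfrak{u}(n)\oplus\mathfrak{gl}(n,\mathbb{C})$ as a real vector space of dimension $3n^2$. A critical point of $\phi$ is a point where the real differential $d\phi$ is not surjective (equivalently, where $\dim_{\mathbb{R}}\ker d\phi>n^2$); a regular point is a point that is not critical. The set of critical points is a real algebraic subset of $X$, and its codimension is understood in the sense of dimension of real algebraic sets. *)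

theory Defs
  imports "HOL-Analysis.Analysis" "HOL-Algebra.Ideal"
begin

text \<open>
  Complex \<open>n \<times> n\<close> matrices are \<^typ>\<open>complex^'n^'n\<close>, with \<open>n = CARD('n)\<close>. This is a Euclidean
  space over the reals, of dimension \<open>2 n\<^sup>2\<close>, so derivatives on it are real derivatives.
\<close>

type_synonym 'n cmat = "complex^'n^'n"

definition ctranspose :: "'n::finite cmat \<Rightarrow> 'n cmat"
  where "ctranspose A = transpose (map_matrix cnj A)"

definition skew_hermitian :: "('n::finite cmat) set"
  where "skew_hermitian = {M. ctranspose M = - M}"

definition has_eigenvalue :: "'n::finite cmat \<Rightarrow> complex \<Rightarrow> bool"
  where "has_eigenvalue M c \<longleftrightarrow> (\<exists>v. v \<noteq> 0 \<and> M *v v = c *s v)"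

definition phi :: "'n::finite cmat \<times> 'n cmat \<Rightarrow> 'n cmat \<times> 'n cmat"
  where "phi = (\<lambda>(A, B).
    (map_matrix (\<lambda>z. \<i> / 2 * z) (ctranspose A ** A - B ** ctranspose B), B ** A))"

text \<open>
  The target of \<^const>\<open>phi\<close> is the real subspace \<^term>\<open>skew_hermitian \<times> UNIV\<close> of the type of its
  values, so surjectivity of the differential means that its range is this subspace.
\<close>

definition critical_points :: "('n::finite cmat \<times> 'n cmat) set"
  where "critical_points =
    {p. range (frechet_derivative phi (at p)) \<noteq> skew_hermitian \<times> UNIV}"

definition regular_points :: "('n::finite cmat \<times> 'n cmat) set"
  where "regular_points = - critical_points"

text \<open>
  The dimension of a real algebraic set is the Krull dimension of its ring of (real) polynomial
  functions, that is, of \<open>\<real>[x\<^sub>1, \<dots>, x\<^sub>N] / I(V)\<close>. The zero ring, and hence the empty set, gets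
  dimension \<open>0\<close> here.
\<close>

definition polynomial_function_ring :: "'a::euclidean_space set \<Rightarrow> ('a \<Rightarrow> real) ring"
  where "polynomial_function_ring V =
    \<lparr>carrier = {restrict f V | f. real_polynomial_function f},
     monoid.mult = (\<lambda>f g. \<lambda>x\<in>V. f x * g x),
     one = (\<lambda>x\<in>V. 1),
     zero = (\<lambda>x\<in>V. 0),
     add = (\<lambda>f g. \<lambda>x\<in>V. f x + g x)\<rparr>"

definition krull_dim :: "('a, 'b) ring_scheme \<Rightarrow> enat"
  where "krull_dim R =
    Sup {enat k | k. \<exists>P. (\<forall>i\<le>k. primeideal (P i) R) \<and> (\<forall>i<k. P i \<subset> P (Suc i))}"

definition real_algebraic_dim :: "'a::euclidean_space set \<Rightarrow> enat"
  where "real_algebraic_dim V = krull_dim (polynomial_function_ring V)"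

lemma cring_polynomial_function_ring: "cring (polynomial_function_ring V)"
proof (rule cringI)
  let ?R = "polynomial_function_ring V"
  have add: "\<exists>h. (\<lambda>x\<in>V. restrict f V x + restrict g V x) = restrict h V \<and> real_polynomial_function h"
    if "real_polynomial_function f" "real_polynomial_function g" for f g :: "'a \<Rightarrow> real"
    using that by (intro exI[of _ "\<lambda>x. f x + g x"]) auto
  have mult: "\<exists>h. (\<lambda>x\<in>V. restrict f V x * restrict g V x) = restrict h V \<and> real_polynomial_function h"
    if "real_polynomial_function f" "real_polynomial_function g" for f g :: "'a \<Rightarrow> real"
    using that by (intro exI[of _ "\<lambda>x. f x * g x"]) auto
  have const: "\<exists>h. (\<lambda>x\<in>V. c) = restrict h V \<and> real_polynomial_function h" for c
    by (intro exI[of _ "\<lambda>x. c"]) auto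
  have neg: "\<exists>y. (\<exists>h. y = restrict h V \<and> real_polynomial_function h) \<and>
      (\<lambda>x\<in>V. y x + restrict f V x) = (\<lambda>x\<in>V. 0)"
    if "real_polynomial_function f" for f :: "'a \<Rightarrow> real"
    using that real_polynomial_function_minus[OF that]
    by (intro exI[of _ "restrict (\<lambda>x. - f x) V"]) auto
  show "abelian_group ?R"
  proof (rule abelian_groupI)
    fix x assume "x \<in> carrier ?R"
    then show "\<exists>y\<in>carrier ?R. y \<oplus>\<^bsub>?R\<^esub> x = \<zero>\<^bsub>?R\<^esub>"
      using neg by (fastforce simp: polynomial_function_ring_def)
  qed (auto simp: polynomial_function_ring_def add const fun_eq_iff restrict_def)
  show "Group.comm_monoid ?R"
    by (rule comm_monoidI) (auto simp: polynomial_function_ring_def mult const fun_eq_iff restrict_def)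
qed (auto simp: polynomial_function_ring_def fun_eq_iff restrict_def algebra_simps)

end

theory Submission
  imports Defs "HOL-Computational_Algebra.Fundamental_Theorem_Algebra"
begin

text \<open>
  The orthogonal complement of the range of \<open>d\<phi>\<close> at \<open>(A, B)\<close> consists of the pairs \<open>(i H, E)\<close> with \<open>H\<close>
  Hermitian, \<open>A H = - B\<^sup>* E\<close> and \<open>H B = E A\<^sup>*\<close>. If \<open>A\<close> and \<open>B\<close> are invertible and \<open>M = B\<^sup>*\<^sup>-\<^sup>1 A\<close>, this becomes
  \<open>M H M\<^sup>* = - H\<close>, which has a nonzero solution iff \<open>M\<close> has a pair of eigenvalues \<open>\<alpha>\<close>, \<open>- 1 / cnj \<alpha>\<close>. Normalising
  \<open>(H, E)\<close> to norm one shows that the critical set is closed.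

  Upper bound for the dimension: a chain of \<open>k + 1\<close> prime ideals yields \<open>k\<close> polynomials which are algebraically
  independent on the set. The critical set is covered by finitely many images of rational maps in
  \<open>2 n\<^sup>2 - 1\<close> complex parameters and their conjugates (\<open>A\<close> singular, \<open>B\<close> singular, or two eigenvectors given),
  and counting monomials gives \<open>k \<le> 4 n\<^sup>2 - 2\<close>. Lower bound: the vanishing ideals of the images of a flag of
  coordinate subspaces under a rational parametrisation of the eigenvalue locus form a strict chain of primes.
  The same flag inside a ball would give dimension \<open>4 n\<^sup>2\<close>, so the critical set has empty interior.
\<close>

subsection \<open>Counting monomials\<close>

text \<open>Codimension two is one complex condition: the second eigenvalue
  \<open>- 1 / cnj \<alpha>\<close> is determined by the first. This condition and the adjoint of
  \<open>B\<close> involve conjugation, so the locus is not complex algebraic and cannot be measured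
  by complex dimension; instead a complex parameter and its conjugate are counted as two separate
  coordinates. The defining equations of the critical set are never computed. The ring of polynomial
  functions only knows which polynomials vanish on the set, so any cover by images serves for the
  upper bound, and for the lower bound any subsets with prime vanishing ideals, algebraic or not.
  For the same reason the pairs with \<open>A\<close> or \<open>B\<close> singular need no analysis:
  singular matrices already have complex codimension one, and they are covered without deciding
  which of them are critical. The link between \<open>M\<close> and \<open>L\<close> in the
  statement is that the adjoint of \<open>M\<close> equals \<open>B L\<close> times the inverse of
  \<open>B\<close>, and that the set of pairs \<open>\<alpha>\<close>,
  \<open>- 1 / cnj \<alpha>\<close> is stable under conjugation.\<close>

lemma homogeneous_system_nontrivial:
  fixes c :: "'i \<Rightarrow> 'j \<Rightarrow> 'f::field"
  assumes "finite J" "finite I" "card J < card I"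
  shows "\<exists>x. (\<exists>i\<in>I. x i \<noteq> 0) \<and> (\<forall>j\<in>J. (\<Sum>i\<in>I. x i * c i j) = 0)"
  using assms
proof (induction J arbitrary: I c rule: finite_induct)
  case empty
  then have "I \<noteq> {}" by auto
  then show ?case by (intro exI[of _ "\<lambda>_. 1"]) auto
next
  case (insert j J)
  show ?case
  proof (cases "\<forall>i\<in>I. c i j = 0")
    case True
    have "card J < card I" using insert by auto
    from insert.IH[OF insert.prems(1) this, of c] True show ?thesis by auto
  next
    case False
    then obtain i0 where i0: "i0 \<in> I" "c i0 j \<noteq> 0" by auto
    define I' where "I' = I - {i0}"
    have I': "finite I'" "I = insert i0 I'" "i0 \<notin> I'" using i0 insert.prems by (auto simp: I'_def)
    have "card J < card I'" using insert.hyps insert.prems I' by auto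
    \<comment> \<open>Equation \<open>j\<close> is solved for the pivot unknown \<open>i0\<close>
      and substituted into the other equations; \<open>y\<close> below restores the value of the
      pivot unknown.\<close>
    from insert.IH[OF I'(1) this, of "\<lambda>i j'. c i j' - c i j / c i0 j * c i0 j'"]
    obtain x where x: "\<exists>i\<in>I'. x i \<noteq> 0"
      "\<And>j'. j' \<in> J \<Longrightarrow> (\<Sum>i\<in>I'. x i * (c i j' - c i j / c i0 j * c i0 j')) = 0" by blast
    define s where "s = (\<Sum>i\<in>I'. x i * c i j)"
    define y where "y = (\<lambda>i. if i = i0 then - s / c i0 j else x i)"
    have sum: "(\<Sum>i\<in>I. y i * c i j') = - s / c i0 j * c i0 j' + (\<Sum>i\<in>I'. x i * c i j')" for j'
    proof -
      have "(\<Sum>i\<in>I'. y i * c i j') = (\<Sum>i\<in>I'. x i * c i j')"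
        by (rule sum.cong) (use I' in \<open>auto simp: y_def\<close>)
      then show ?thesis using I' by (simp add: y_def)
    qed
    have "(\<Sum>i\<in>I. y i * c i j') = 0" if "j' \<in> insert j J" for j'
    proof (cases "j' = j")
      case True
      then show ?thesis using i0 by (simp add: sum s_def)
    next
      case False
      then have "j' \<in> J" using that by simp
      then have "(\<Sum>i\<in>I'. x i * c i j') - (\<Sum>i\<in>I'. x i * c i j) / c i0 j * c i0 j' = 0"
        using x(2)[of j']
        by (simp add: right_diff_distrib sum_subtractf sum_distrib_left sum_distrib_right sum_divide_distrib ac_simps)
      then show ?thesis by (simp add: sum s_def algebra_simps)
    qed
    moreover have "\<exists>i\<in>I. y i \<noteq> 0" using x(1) I' by (auto simp: y_def)
    ultimately show ?thesis by blast
  qed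
qed

section \<open>Polynomials of bounded degree in each coordinate\<close>

text \<open>Bounding the degree in each coordinate separately leaves \<open>(d + 1) ^ card X\<close>
  exponent vectors. Coordinates are functions on an arbitrary parameter set, so that a conjugated
  coordinate is just another element of \<open>X\<close>; they may be algebraically dependent, since
  only an upper count is needed.\<close>

inductive box_poly :: "('p \<Rightarrow> complex) set \<Rightarrow> nat \<Rightarrow> ('p \<Rightarrow> complex) \<Rightarrow> bool" for X d where
  monom: "(\<And>x. x \<in> X \<Longrightarrow> e x \<le> d) \<Longrightarrow> box_poly X d (\<lambda>p. c * (\<Prod>x\<in>X. x p ^ e x))"
| add: "box_poly X d f \<Longrightarrow> box_poly X d g \<Longrightarrow> box_poly X d (\<lambda>p. f p + g p)"

lemma box_poly_const: "box_poly X d (\<lambda>p. c)"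
  using box_poly.monom[of X "\<lambda>_. 0" d c] by simp

lemma box_poly_coord:
  assumes "finite X" "x \<in> X"
  shows "box_poly X 1 x"
proof -
  have "(\<Prod>y\<in>X. y p ^ (if y = x then 1 else 0)) = x p" for p
    using assms by (subst prod.remove[of _ x]) auto
  then show ?thesis using box_poly.monom[of X "\<lambda>y. if y = x then 1 else 0" 1 1] by simp
qed

lemma box_poly_mono: "box_poly X d f \<Longrightarrow> d \<le> d' \<Longrightarrow> box_poly X d' f"
  by (induction rule: box_poly.induct) (auto intro!: box_poly.intros intro: order_trans)

lemma box_poly_mult:
  assumes "box_poly X d f" "box_poly X d' g"
  shows "box_poly X (d + d') (\<lambda>p. f p * g p)"
  using assms(1)
proof (induction rule: box_poly.induct)
  case (monom e c)
  show ?case using assms(2)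
  proof (induction rule: box_poly.induct)
    case (monom e' c')
    have "box_poly X (d + d') (\<lambda>p. (c * c') * (\<Prod>x\<in>X. x p ^ (e x + e' x)))"
      by (rule box_poly.monom) (use \<open>\<And>x. x \<in> X \<Longrightarrow> e x \<le> d\<close> monom in \<open>auto intro: add_mono\<close>)
    then show ?case by (simp add: power_add prod.distrib ac_simps)
  qed (simp add: distrib_left box_poly.add)
qed (simp add: distrib_right box_poly.add)

lemma box_poly_power: "box_poly X d f \<Longrightarrow> box_poly X (n * d) (\<lambda>p. f p ^ n)"
proof (induction n)
  case (Suc n)
  from box_poly_mult[OF Suc.prems Suc.IH[OF Suc.prems]] show ?case by simp
qed (simp add: box_poly_const)

lemma box_poly_prod:
  assumes "finite J" "\<And>j. j \<in> J \<Longrightarrow> box_poly X (d j) (f j)"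
  shows "box_poly X (\<Sum>j\<in>J. d j) (\<lambda>p. \<Prod>j\<in>J. f j p)"
  using assms by (induction J rule: finite_induct) (auto intro: box_poly_const box_poly_mult)

text \<open>Conjugation is an involution of \<open>X\<close>, so a conjugated monomial is a monomial
  whose exponents are permuted by it.\<close>

lemma box_poly_cnj:
  assumes "box_poly X d f" "finite X" "(\<lambda>x p. cnj (x p)) ` X \<subseteq> X"
  shows "box_poly X d (\<lambda>p. cnj (f p))"
  using assms(1)
proof (induction rule: box_poly.induct)
  case (monom e c)
  define r :: "('a \<Rightarrow> complex) \<Rightarrow> 'a \<Rightarrow> complex" where "r = (\<lambda>x p. cnj (x p))"
  have rr: "r (r x) = x" for x by (simp add: r_def)
  have rX: "r x \<in> X" if "x \<in> X" for x using assms(3) that by (auto simp: r_def)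
  have "(\<Prod>x\<in>X. cnj (x p ^ e x)) = (\<Prod>x\<in>X. x p ^ e (r x))" for p
    by (rule prod.reindex_bij_witness[of _ r r]) (auto simp: rr rX, simp add: r_def)
  moreover have "box_poly X d (\<lambda>p. cnj c * (\<Prod>x\<in>X. x p ^ e (r x)))"
    by (rule box_poly.monom) (use monom rX in auto)
  ultimately show ?case by simp
qed (simp add: box_poly.add)

lemma box_poly_coefficients:
  assumes "box_poly X d f" "finite X"
  shows "\<exists>c. \<forall>p. f p = (\<Sum>e\<in>X \<rightarrow>\<^sub>E {..d}. c e * (\<Prod>x\<in>X. x p ^ e x))"
  using assms(1)
proof (induction rule: box_poly.induct)
  case (monom e c)
  \<comment> \<open>Only the values on \<open>X\<close> matter; cutting off the rest selects the
    representative in the finite index set.\<close>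
  define e' where "e' = restrict e X"
  have e': "e' \<in> X \<rightarrow>\<^sub>E {..d}" using monom by (auto simp: e'_def)
  have fin: "finite (X \<rightarrow>\<^sub>E {..d})" using assms(2) by (intro finite_PiE) auto
  have "(\<Prod>x\<in>X. x p ^ e x) = (\<Prod>x\<in>X. x p ^ e' x)" for p
    by (rule prod.cong) (auto simp: e'_def)
  then have "c * (\<Prod>x\<in>X. x p ^ e x) = (\<Sum>a\<in>X \<rightarrow>\<^sub>E {..d}. (if a = e' then c else 0) * (\<Prod>x\<in>X. x p ^ a x))" for p
    using fin e' by (simp add: if_distrib[of "\<lambda>z. z * _"] cong: if_cong)
  then show ?case by (intro exI[of _ "\<lambda>a. if a = e' then c else 0"]) auto
next
  case (add f g)
  then obtain c c' where "\<forall>p. f p = (\<Sum>e\<in>X \<rightarrow>\<^sub>E {..d}. c e * (\<Prod>x\<in>X. x p ^ e x))"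
    "\<forall>p. g p = (\<Sum>e\<in>X \<rightarrow>\<^sub>E {..d}. c' e * (\<Prod>x\<in>X. x p ^ e x))" by auto
  then show ?case by (intro exI[of _ "\<lambda>e. c e + c' e"]) (simp add: sum.distrib distrib_right)
qed

section \<open>Rational functions on charts and their algebraic relations\<close>

definition rat_on :: "('p \<Rightarrow> complex) set \<Rightarrow> 'p set \<Rightarrow> ('p \<Rightarrow> complex) \<Rightarrow> bool" where
  "rat_on X U h \<longleftrightarrow> (\<exists>d P Q. box_poly X d P \<and> box_poly X d Q \<and> (\<forall>p\<in>U. Q p \<noteq> 0 \<and> h p = P p / Q p))"

lemma rat_onI:
  assumes "box_poly X d P" "box_poly X d' Q" "\<And>p. p \<in> U \<Longrightarrow> Q p \<noteq> 0" "\<And>p. p \<in> U \<Longrightarrow> h p = P p / Q p"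
  shows "rat_on X U h"
  unfolding rat_on_def
  using box_poly_mono[OF assms(1), of "max d d'"] box_poly_mono[OF assms(2), of "max d d'"] assms(3,4)
  by (intro exI[of _ "max d d'"] exI[of _ P] exI[of _ Q]) auto

lemma rat_on_const: "rat_on X U (\<lambda>p. c)"
  by (rule rat_onI[of _ 0 "\<lambda>p. c" 0 "\<lambda>p. 1"]) (auto intro: box_poly_const)

lemma rat_on_coord: "finite X \<Longrightarrow> x \<in> X \<Longrightarrow> rat_on X U x"
  by (rule rat_onI[of _ 1 x 0 "\<lambda>p. 1"]) (use box_poly_const box_poly_coord in auto)

lemma rat_on_cong: "rat_on X U f \<Longrightarrow> (\<And>p. p \<in> U \<Longrightarrow> f p = g p) \<Longrightarrow> rat_on X U g"
  unfolding rat_on_def by force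

lemma rat_on_mult:
  assumes "rat_on X U f" "rat_on X U g"
  shows "rat_on X U (\<lambda>p. f p * g p)"
proof -
  from assms obtain d P Q d' P' Q' where h: "box_poly X d P" "box_poly X d Q"
    "box_poly X d' P'" "box_poly X d' Q'"
    "\<forall>p\<in>U. Q p \<noteq> 0 \<and> f p = P p / Q p" "\<forall>p\<in>U. Q' p \<noteq> 0 \<and> g p = P' p / Q' p"
    unfolding rat_on_def by blast
  show ?thesis
    by (rule rat_onI[OF box_poly_mult[OF h(1,3)] box_poly_mult[OF h(2,4)]]) (use h(5,6) in auto)
qed

lemma rat_on_add:
  assumes "rat_on X U f" "rat_on X U g"
  shows "rat_on X U (\<lambda>p. f p + g p)"
proof -
  from assms obtain d P Q d' P' Q' where h: "box_poly X d P" "box_poly X d Q"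
    "box_poly X d' P'" "box_poly X d' Q'"
    "\<forall>p\<in>U. Q p \<noteq> 0 \<and> f p = P p / Q p" "\<forall>p\<in>U. Q' p \<noteq> 0 \<and> g p = P' p / Q' p"
    unfolding rat_on_def by blast
  have "box_poly X (d + d') (\<lambda>p. P p * Q' p + Q p * P' p)"
    by (intro box_poly.add box_poly_mult h)
  then show ?thesis
    by (rule rat_onI[OF _ box_poly_mult[OF h(2,4)]]) (use h(5,6) in \<open>auto simp: field_simps\<close>)
qed

lemma rat_on_inverse:
  assumes "rat_on X U f" "\<And>p. p \<in> U \<Longrightarrow> f p \<noteq> 0"
  shows "rat_on X U (\<lambda>p. inverse (f p))"
proof -
  from assms obtain d P Q where "box_poly X d P" "box_poly X d Q"
    "\<forall>p\<in>U. Q p \<noteq> 0 \<and> f p = P p / Q p" unfolding rat_on_def by blast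
  then show ?thesis using assms(2) by (intro rat_onI[of X d Q d P]) auto
qed

lemma rat_on_cnj:
  assumes "rat_on X U f" "finite X" "(\<lambda>x p. cnj (x p)) ` X \<subseteq> X"
  shows "rat_on X U (\<lambda>p. cnj (f p))"
proof -
  from assms obtain d P Q where "box_poly X d P" "box_poly X d Q"
    "\<forall>p\<in>U. Q p \<noteq> 0 \<and> f p = P p / Q p" unfolding rat_on_def by blast
  then show ?thesis using box_poly_cnj[of X d _ , OF _ assms(2,3)]
    by (intro rat_onI[of X d "\<lambda>p. cnj (P p)" d "\<lambda>p. cnj (Q p)"]) auto
qed

lemma rat_on_diff:
  assumes "rat_on X U f" "rat_on X U g"
  shows "rat_on X U (\<lambda>p. f p - g p)"
  using rat_on_add[OF assms(1) rat_on_mult[OF rat_on_const assms(2), of "-1"]] by simp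

lemma rat_on_divide:
  assumes "rat_on X U f" "rat_on X U g" "\<And>p. p \<in> U \<Longrightarrow> g p \<noteq> 0"
  shows "rat_on X U (\<lambda>p. f p / g p)"
  using rat_on_mult[OF assms(1) rat_on_inverse[OF assms(2,3)]] by (simp add: divide_inverse)

lemma rat_on_sum:
  "(\<And>j. j \<in> J \<Longrightarrow> rat_on X U (f j)) \<Longrightarrow> rat_on X U (\<lambda>p. \<Sum>j\<in>J. f j p)"
  by (induction J rule: infinite_finite_induct) (auto intro: rat_on_const rat_on_add)

text \<open>With one denominator for all \<open>f j\<close>, a single power of it clears every
  monomial in them.\<close>

lemma rat_on_common_denominator:
  assumes "finite J" "\<And>j. j \<in> J \<Longrightarrow> rat_on X U (f j)"
  shows "\<exists>d P Q. box_poly X d Q \<and> (\<forall>p\<in>U. Q p \<noteq> 0) \<and>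
    (\<forall>j\<in>J. box_poly X d (P j) \<and> (\<forall>p\<in>U. f j p = P j p / Q p))"
  using assms
proof (induction J rule: finite_induct)
  case empty
  then show ?case by (intro exI[of _ 0] exI[of _ "\<lambda>p. 1"] exI) (auto intro: box_poly_const)
next
  case (insert i J)
  then obtain d P Q where h: "box_poly X d Q" "\<forall>p\<in>U. Q p \<noteq> 0"
    "\<forall>j\<in>J. box_poly X d (P j) \<and> (\<forall>p\<in>U. f j p = P j p / Q p)" by auto
  from insert.prems[of i] obtain d' P' Q' where h': "box_poly X d' P'" "box_poly X d' Q'"
    "\<forall>p\<in>U. Q' p \<noteq> 0 \<and> f i p = P' p / Q' p" unfolding rat_on_def by auto
  show ?case
    by (intro exI[of _ "d + d'"] exI[of _ "\<lambda>p. Q p * Q' p"]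
        exI[of _ "\<lambda>j. if j = i then (\<lambda>p. Q p * P' p) else (\<lambda>p. P j p * Q' p)"] conjI ballI)
      (use h h' insert.hyps in \<open>auto intro!: box_poly_mult\<close>)
qed

text \<open>Multiplication by \<open>Q ^ (k * D)\<close> turns every monomial in the
  \<open>f j\<close> into a polynomial, and it suffices that all coefficients of the resulting sum
  vanish: linear equations for \<open>x\<close>. The bound \<open>d\<close> is chosen before
  \<open>D\<close>, without which the count would be circular, and may be enlarged to
  \<open>d'\<close>, so that one value serves all charts.\<close>

lemma rat_on_relation_system:
  fixes f :: "nat \<Rightarrow> 'p \<Rightarrow> complex"
  assumes "finite X" "\<And>j. j < k \<Longrightarrow> rat_on X U (f j)"
  shows "\<exists>d. \<forall>d'\<ge>d. \<forall>D. \<exists>c. \<forall>x. (\<forall>e\<in>X \<rightarrow>\<^sub>E {..k * D * d'}. (\<Sum>a\<in>{..<k} \<rightarrow>\<^sub>E {..D}. x a * c a e) = 0) \<longrightarrow>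
    (\<forall>p\<in>U. (\<Sum>a\<in>{..<k} \<rightarrow>\<^sub>E {..D}. x a * (\<Prod>j<k. f j p ^ a j)) = 0)"
proof -
  obtain d P Q where h: "box_poly X d Q" "\<And>p. p \<in> U \<Longrightarrow> Q p \<noteq> 0"
    "\<And>j. j < k \<Longrightarrow> box_poly X d (P j)" "\<And>j p. j < k \<Longrightarrow> p \<in> U \<Longrightarrow> f j p = P j p / Q p"
    using rat_on_common_denominator[of "{..<k}" X U f] assms(2) by (auto simp: Ball_def) metis
  have "\<exists>c. \<forall>x. (\<forall>e\<in>X \<rightarrow>\<^sub>E {..k * D * d'}. (\<Sum>a\<in>{..<k} \<rightarrow>\<^sub>E {..D}. x a * c a e) = 0) \<longrightarrow>
    (\<forall>p\<in>U. (\<Sum>a\<in>{..<k} \<rightarrow>\<^sub>E {..D}. x a * (\<Prod>j<k. f j p ^ a j)) = 0)" if "d \<le> d'" for d' D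
  proof -
    \<comment> \<open>The monomial with exponents \<open>a\<close> after clearing denominators: each
      of the \<open>k\<close> factors receives exactly \<open>D\<close> powers of the
      denominator.\<close>
    define G where "G = (\<lambda>a p. \<Prod>j<k. P j p ^ a j * Q p ^ (D - a j))"
    have G: "box_poly X (k * D * d') (G a)" if "a \<in> {..<k} \<rightarrow>\<^sub>E {..D}" for a
    proof -
      have "box_poly X (\<Sum>j<k. a j * d + (D - a j) * d) (G a)" unfolding G_def
        by (intro box_poly_prod box_poly_mult box_poly_power h) auto
      moreover have "(\<Sum>j<k. a j * d + (D - a j) * d) = (\<Sum>j<k. D * d)"
      proof (rule sum.cong)
        fix j assume "j \<in> {..<k}"
        then have "a j \<le> D" using that by auto
        then show "a j * d + (D - a j) * d = D * d"
          by (simp flip: distrib_right)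
      qed simp
      ultimately show ?thesis using \<open>d \<le> d'\<close> by (auto intro: box_poly_mono)
    qed
    have "\<forall>a\<in>{..<k} \<rightarrow>\<^sub>E {..D}. \<exists>c. \<forall>p.
        G a p = (\<Sum>e\<in>X \<rightarrow>\<^sub>E {..k * D * d'}. c e * (\<Prod>x\<in>X. x p ^ e x))"
      using box_poly_coefficients[OF G assms(1)] by (intro ballI)
    from bchoice[OF this] obtain c where c: "\<forall>a\<in>{..<k} \<rightarrow>\<^sub>E {..D}. \<forall>p.
        G a p = (\<Sum>e\<in>X \<rightarrow>\<^sub>E {..k * D * d'}. c a e * (\<Prod>x\<in>X. x p ^ e x))"
      ..
    have "(\<Sum>a\<in>{..<k} \<rightarrow>\<^sub>E {..D}. x a * (\<Prod>j<k. f j p ^ a j)) = 0"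
      if x: "\<forall>e\<in>X \<rightarrow>\<^sub>E {..k * D * d'}. (\<Sum>a\<in>{..<k} \<rightarrow>\<^sub>E {..D}. x a * c a e) = 0" and p: "p \<in> U" for x p
    proof -
      have "(\<Sum>a\<in>{..<k} \<rightarrow>\<^sub>E {..D}. x a * G a p)
          = (\<Sum>a\<in>{..<k} \<rightarrow>\<^sub>E {..D}. \<Sum>e\<in>X \<rightarrow>\<^sub>E {..k * D * d'}. x a * c a e * (\<Prod>x\<in>X. x p ^ e x))"
        by (rule sum.cong) (auto simp: c sum_distrib_left ac_simps)
      also have "\<dots> = (\<Sum>e\<in>X \<rightarrow>\<^sub>E {..k * D * d'}. (\<Sum>a\<in>{..<k} \<rightarrow>\<^sub>E {..D}. x a * c a e) * (\<Prod>x\<in>X. x p ^ e x))"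
        by (subst sum.swap) (simp add: sum_distrib_right)
      also have "\<dots> = 0" using x by simp
      finally have "(\<Sum>a\<in>{..<k} \<rightarrow>\<^sub>E {..D}. x a * G a p) = 0" .
      moreover have "G a p = (\<Prod>j<k. f j p ^ a j) * Q p ^ (k * D)" if "a \<in> {..<k} \<rightarrow>\<^sub>E {..D}" for a
      proof -
        have "G a p = (\<Prod>j<k. f j p ^ a j * Q p ^ D)" unfolding G_def
        proof (rule prod.cong)
          fix j assume j: "j \<in> {..<k}"
          then have "a j \<le> D" using that by auto
          then have "Q p ^ D = Q p ^ a j * Q p ^ (D - a j)" by (simp flip: power_add)
          then show "P j p ^ a j * Q p ^ (D - a j) = f j p ^ a j * Q p ^ D"
            using h(2)[OF p] h(4)[OF _ p, of j] j by (simp add: power_divide)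
        qed simp
        then show ?thesis by (simp add: prod.distrib power_mult mult.commute)
      qed
      ultimately have "(\<Sum>a\<in>{..<k} \<rightarrow>\<^sub>E {..D}. x a * (\<Prod>j<k. f j p ^ a j)) * Q p ^ (k * D) = 0"
        by (simp add: sum_distrib_right mult.assoc)
      then show ?thesis using h(2)[OF p] by simp
    qed
    then show ?thesis by blast
  qed
  then show ?thesis by blast
qed

text \<open>A count of monomials: there are \<open>(D + 1)\<^sup>k\<close> products of powers of the \<open>f\<^sub>j\<close>, and on each chart
  they lie in a space of dimension \<open>O(D\<^sup>m)\<close>.\<close>
lemma rat_on_algebraic_relation:
  fixes f :: "nat \<Rightarrow> 'p \<Rightarrow> complex"
  assumes "finite \<C>"
    and "\<And>U X. (U, X) \<in> \<C> \<Longrightarrow> finite X \<and> card X \<le> m \<and> (\<forall>j<k. rat_on X U (f j))"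
    and "m < k"
  shows "\<exists>D x. (\<exists>a\<in>{..<k} \<rightarrow>\<^sub>E {..D}. x a \<noteq> 0) \<and>
    (\<forall>(U, X)\<in>\<C>. \<forall>p\<in>U. (\<Sum>a\<in>{..<k} \<rightarrow>\<^sub>E {..D}. x a * (\<Prod>j<k. f j p ^ a j)) = 0)"
proof -
  have "\<forall>ch\<in>\<C>. \<exists>d. \<forall>d'\<ge>d. \<forall>D. \<exists>c. \<forall>x. (\<forall>e\<in>snd ch \<rightarrow>\<^sub>E {..k * D * d'}. (\<Sum>a\<in>{..<k} \<rightarrow>\<^sub>E {..D}. x a * c a e) = 0) \<longrightarrow>
    (\<forall>p\<in>fst ch. (\<Sum>a\<in>{..<k} \<rightarrow>\<^sub>E {..D}. x a * (\<Prod>j<k. f j p ^ a j)) = 0)"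
    using assms(2) by (intro ballI rat_on_relation_system) auto
  from bchoice[OF this] obtain df where df: "\<forall>ch\<in>\<C>. \<forall>d'\<ge>df ch. \<forall>D. \<exists>c. \<forall>x.
      (\<forall>e\<in>snd ch \<rightarrow>\<^sub>E {..k * D * d'}. (\<Sum>a\<in>{..<k} \<rightarrow>\<^sub>E {..D}. x a * c a e) = 0) \<longrightarrow>
      (\<forall>p\<in>fst ch. (\<Sum>a\<in>{..<k} \<rightarrow>\<^sub>E {..D}. x a * (\<Prod>j<k. f j p ^ a j)) = 0)"
    ..
  define d where "d = (\<Sum>ch\<in>\<C>. df ch)"
  \<comment> \<open>Chosen so that the number of equations is at most
    \<open>D * (D + 1) ^ m\<close>, which is less than \<open>(D + 1) ^ Suc m\<close> and hence than
    the number of unknowns.\<close>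
  define D where "D = card \<C> * (k * d + 1) ^ m"
  have "df ch \<le> d" if "ch \<in> \<C>" for ch
    unfolding d_def by (rule member_le_sum) (use that assms(1) in auto)
  then have "\<forall>ch\<in>\<C>. \<exists>c. \<forall>x.
      (\<forall>e\<in>snd ch \<rightarrow>\<^sub>E {..k * D * d}. (\<Sum>a\<in>{..<k} \<rightarrow>\<^sub>E {..D}. x a * c a e) = 0) \<longrightarrow>
      (\<forall>p\<in>fst ch. (\<Sum>a\<in>{..<k} \<rightarrow>\<^sub>E {..D}. x a * (\<Prod>j<k. f j p ^ a j)) = 0)"
    using df by blast
  from bchoice[OF this] obtain c where c: "\<forall>ch\<in>\<C>. \<forall>x.
      (\<forall>e\<in>snd ch \<rightarrow>\<^sub>E {..k * D * d}. (\<Sum>a\<in>{..<k} \<rightarrow>\<^sub>E {..D}. x a * c ch a e) = 0) \<longrightarrow>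
      (\<forall>p\<in>fst ch. (\<Sum>a\<in>{..<k} \<rightarrow>\<^sub>E {..D}. x a * (\<Prod>j<k. f j p ^ a j)) = 0)" ..
  \<comment> \<open>All charts are put into one linear system, so that the same relation holds on
    each of them.\<close>
  define J where "J = (SIGMA ch:\<C>. snd ch \<rightarrow>\<^sub>E {..k * D * d})"
  have finJ: "finite J" unfolding J_def
    using assms(1,2) by (intro finite_SigmaI finite_PiE) auto
  have "card J = (\<Sum>ch\<in>\<C>. (k * D * d + 1) ^ card (snd ch))" unfolding J_def
    using assms(1,2) by (subst card_SigmaI) (auto simp: card_PiE intro!: finite_PiE sum.cong)
  also have "\<dots> \<le> (\<Sum>ch\<in>\<C>. (k * D * d + 1) ^ m)"
    using assms(2) by (intro sum_mono power_increasing) auto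
  also have "\<dots> = card \<C> * (k * D * d + 1) ^ m" by simp
  also have "\<dots> \<le> card \<C> * ((k * d + 1) * (D + 1)) ^ m"
    by (intro mult_left_mono power_mono) (simp_all add: distrib_left distrib_right)
  also have "\<dots> = D * (D + 1) ^ m" by (simp only: power_mult_distrib D_def mult.assoc)
  also have "\<dots> < (D + 1) ^ Suc m" by simp
  also have "\<dots> \<le> (D + 1) ^ k" using assms(3) by (intro power_increasing) auto
  also have "\<dots> = card ({..<k} \<rightarrow>\<^sub>E {..D})" by (simp add: card_PiE)
  finally have "card J < card ({..<k} \<rightarrow>\<^sub>E {..D})" .
  then have "\<exists>x. (\<exists>a\<in>{..<k} \<rightarrow>\<^sub>E {..D}. x a \<noteq> 0) \<and>
      (\<forall>j\<in>J. (\<Sum>a\<in>{..<k} \<rightarrow>\<^sub>E {..D}. x a * (\<lambda>a (ch, e). c ch a e) a j) = 0)"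
    by (intro homogeneous_system_nontrivial finJ finite_PiE) auto
  then obtain x where x: "\<exists>a\<in>{..<k} \<rightarrow>\<^sub>E {..D}. x a \<noteq> 0"
    "\<And>ch e. (ch, e) \<in> J \<Longrightarrow> (\<Sum>a\<in>{..<k} \<rightarrow>\<^sub>E {..D}. x a * c ch a e) = 0"
    by fastforce
  have "(\<Sum>a\<in>{..<k} \<rightarrow>\<^sub>E {..D}. x a * (\<Prod>j<k. f j p ^ a j)) = 0" if "(U, X) \<in> \<C>" "p \<in> U" for U X p
    using c[rule_format, OF that(1), of x] x(2) that by (auto simp: J_def)
  then show ?thesis using x(1) by (intro exI[of _ D] exI[of _ x]) auto
qed

subsection \<open>Chains of prime ideals\<close>

text \<open>The preimage of a prime ideal under restriction to \<open>V\<close>: a prime ideal of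
  polynomial functions on the whole space that contains everything vanishing on \<open>V\<close>.
  Working upstairs avoids functions that are undefined outside \<open>V\<close>.\<close>

definition prime_polys :: "'a::euclidean_space set \<Rightarrow> ('a \<Rightarrow> real) set \<Rightarrow> bool" where
  "prime_polys V Q \<longleftrightarrow> (\<forall>f\<in>Q. real_polynomial_function f) \<and>
    (\<forall>f. real_polynomial_function f \<longrightarrow> (\<forall>x\<in>V. f x = 0) \<longrightarrow> f \<in> Q) \<and>
    (\<forall>f\<in>Q. \<forall>g\<in>Q. (\<lambda>x. f x + g x) \<in> Q) \<and>
    (\<forall>f\<in>Q. \<forall>g. real_polynomial_function g \<longrightarrow> (\<lambda>x. f x * g x) \<in> Q) \<and>
    (\<forall>f g. real_polynomial_function f \<longrightarrow> real_polynomial_function g \<longrightarrow> (\<lambda>x. f x * g x) \<in> Q \<longrightarrow> f \<in> Q \<or> g \<in> Q) \<and>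
    (\<lambda>x. 1) \<notin> Q"

lemma prime_polysD:
  assumes "prime_polys V Q"
  shows "f \<in> Q \<Longrightarrow> real_polynomial_function f"
    and "real_polynomial_function f \<Longrightarrow> (\<And>x. x \<in> V \<Longrightarrow> f x = 0) \<Longrightarrow> f \<in> Q"
    and "f \<in> Q \<Longrightarrow> g \<in> Q \<Longrightarrow> (\<lambda>x. f x + g x) \<in> Q"
    and "f \<in> Q \<Longrightarrow> real_polynomial_function g \<Longrightarrow> (\<lambda>x. f x * g x) \<in> Q"
    and "real_polynomial_function f \<Longrightarrow> real_polynomial_function g \<Longrightarrow> (\<lambda>x. f x * g x) \<in> Q \<Longrightarrow> f \<in> Q \<or> g \<in> Q"
    and "(\<lambda>x. 1) \<notin> Q"
proof -
  note d = assms[unfolded prime_polys_def, THEN conjunct1] assms[unfolded prime_polys_def, THEN conjunct2, THEN conjunct1]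
    assms[unfolded prime_polys_def, THEN conjunct2, THEN conjunct2, THEN conjunct1]
    assms[unfolded prime_polys_def, THEN conjunct2, THEN conjunct2, THEN conjunct2, THEN conjunct1]
    assms[unfolded prime_polys_def, THEN conjunct2, THEN conjunct2, THEN conjunct2, THEN conjunct2, THEN conjunct1]
    assms[unfolded prime_polys_def, THEN conjunct2, THEN conjunct2, THEN conjunct2, THEN conjunct2, THEN conjunct2]
  show "f \<in> Q \<Longrightarrow> real_polynomial_function f" by (rule bspec[OF d(1)])
  show "real_polynomial_function f \<Longrightarrow> (\<And>x. x \<in> V \<Longrightarrow> f x = 0) \<Longrightarrow> f \<in> Q" by (rule d(2)[rule_format])
  show "f \<in> Q \<Longrightarrow> g \<in> Q \<Longrightarrow> (\<lambda>x. f x + g x) \<in> Q" by (rule d(3)[rule_format])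
  show "f \<in> Q \<Longrightarrow> real_polynomial_function g \<Longrightarrow> (\<lambda>x. f x * g x) \<in> Q" by (rule d(4)[rule_format])
  show "real_polynomial_function f \<Longrightarrow> real_polynomial_function g \<Longrightarrow> (\<lambda>x. f x * g x) \<in> Q \<Longrightarrow> f \<in> Q \<or> g \<in> Q"
    by (rule d(5)[rule_format])
  show "(\<lambda>x. 1) \<notin> Q" by (rule d(6))
qed

lemma primeideal_imp_prime_polys:
  assumes "primeideal P (polynomial_function_ring V)"
  shows "prime_polys V {f. real_polynomial_function f \<and> restrict f V \<in> P}"
proof -
  let ?R = "polynomial_function_ring V"
  interpret primeideal P ?R by fact
  have carr: "restrict f V \<in> carrier ?R" if "real_polynomial_function f" for f
    using that by (auto simp: polynomial_function_ring_def)
  have mult: "restrict (\<lambda>x. f x * g x) V = restrict f V \<otimes>\<^bsub>?R\<^esub> restrict g V" for f g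
    by (auto simp: polynomial_function_ring_def)
  have add: "restrict (\<lambda>x. f x + g x) V = restrict f V \<oplus>\<^bsub>?R\<^esub> restrict g V" for f g
    by (auto simp: polynomial_function_ring_def)
  have one: "restrict (\<lambda>x. 1) V = \<one>\<^bsub>?R\<^esub>" by (auto simp: polynomial_function_ring_def)
  have zero: "restrict f V = \<zero>\<^bsub>?R\<^esub>" if "\<forall>x\<in>V. f x = 0" for f
    using that by (auto simp: polynomial_function_ring_def)
  show ?thesis unfolding prime_polys_def
  proof (intro conjI allI ballI impI CollectI; (elim CollectE conjE)?)
    show "restrict (\<lambda>x. f x + g x) V \<in> P" if "restrict f V \<in> P" "restrict g V \<in> P" for f g
      unfolding add by (rule additive_subgroup.a_closed[OF is_additive_subgroup that])
    show "restrict (\<lambda>x. f x * g x) V \<in> P" if "restrict f V \<in> P" "real_polynomial_function g" for f g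
      unfolding mult by (rule I_r_closed[OF that(1) carr[OF that(2)]])
    show "f \<in> {f. real_polynomial_function f \<and> restrict f V \<in> P} \<or> g \<in> {f. real_polynomial_function f \<and> restrict f V \<in> P}"
      if "real_polynomial_function f" "real_polynomial_function g" "restrict (\<lambda>x. f x * g x) V \<in> P" for f g
      using I_prime[OF carr carr] that by (auto simp: mult)
    show "(\<lambda>x. 1) \<notin> {f. real_polynomial_function f \<and> restrict f V \<in> P}"
      using I_notcarr one_imp_carrier by (auto simp: one)
    show "restrict f V \<in> P" if "\<forall>x\<in>V. f x = 0" for f
      using zero[OF that] by simp
  qed (auto)
qed

lemma prime_polys_diff:
  assumes "prime_polys V Q" "f \<in> Q" "(\<lambda>x. f x + g x) \<in> Q" "real_polynomial_function g"
  shows "g \<in> Q"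
proof -
  have "(\<lambda>x. f x * (- 1)) \<in> Q" by (intro prime_polysD(4)[OF assms(1,2)]) auto
  then have "(\<lambda>x. (f x + g x) + f x * (-1)) \<in> Q" by (rule prime_polysD(3)[OF assms(1,3)])
  then show ?thesis by simp
qed

lemma prime_polys_power:
  assumes "prime_polys V Q" "real_polynomial_function g" "real_polynomial_function h" "g \<notin> Q"
  shows "(\<lambda>x. g x ^ m * h x) \<in> Q \<Longrightarrow> h \<in> Q"
proof (induction m)
  case (Suc m)
  have "(\<lambda>x. g x * (g x ^ m * h x)) \<in> Q" using Suc.prems by (simp add: mult.assoc)
  moreover have "real_polynomial_function (\<lambda>x. g x ^ m * h x)" using assms by auto
  ultimately have "(\<lambda>x. g x ^ m * h x) \<in> Q" using prime_polysD(5)[OF assms(1)] assms(2,4) by blast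
  then show ?case by (rule Suc.IH)
qed simp

text \<open>If the coefficients below \<open>m\<close> vanish, \<open>g ^ m\<close> can be factored
  out and cancelled modulo the prime \<open>Q\<close>, as \<open>g\<close> is not in
  \<open>Q\<close>. Modulo \<open>Q'\<close> the terms still divisible by \<open>g\<close> disappear
  and \<open>h m\<close> remains. The assumption that a coefficient in \<open>Q'\<close> vanishes
  identically is what the induction on the chain provides.\<close>

lemma prime_polys_lowest_coefficient:
  assumes "prime_polys V Q" "prime_polys V Q'" "Q \<subseteq> Q'" "g \<in> Q'" "g \<notin> Q"
    and "\<And>m. m \<le> D \<Longrightarrow> real_polynomial_function (h m)"
    and "\<And>m. m \<le> D \<Longrightarrow> h m \<in> Q' \<Longrightarrow> (\<forall>x. h m x = 0)"
    and "(\<lambda>x. \<Sum>m\<le>D. g x ^ m * h m x) \<in> Q" and "m \<le> D"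
  shows "\<forall>x. h m x = 0"
  using assms(9)
proof (induction m rule: less_induct)
  case (less m)
  have polyg: "real_polynomial_function g" by (rule prime_polysD(1)[OF assms(2,4)])
  define r where "r = (\<lambda>x. \<Sum>i\<in>{m<..D}. g x ^ (i - Suc m) * h i x)"
  have polyr: "real_polynomial_function r" unfolding r_def
    using polyg assms(6) by (intro real_polynomial_function_sum) auto
  have polyh: "real_polynomial_function (h m)" using assms(6) less.prems by simp
  have "(\<Sum>i\<le>D. g x ^ i * h i x) = g x ^ m * (g x * r x + h m x)" for x
  proof -
    have "{..D} = {..<m} \<union> ({m} \<union> {m<..D})" using less.prems by auto
    then have "(\<Sum>i\<le>D. g x ^ i * h i x) = (\<Sum>i<m. g x ^ i * h i x) + (g x ^ m * h m x + (\<Sum>i\<in>{m<..D}. g x ^ i * h i x))"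
      by (simp only:, subst sum.union_disjoint) (auto simp: sum.union_disjoint)
    also have "(\<Sum>i<m. g x ^ i * h i x) = 0" using less by simp
    also have "(\<Sum>i\<in>{m<..D}. g x ^ i * h i x) = g x ^ m * (g x * r x)"
      unfolding r_def sum_distrib_left
    proof (rule sum.cong)
      fix i assume "i \<in> {m<..D}"
      then have "i = m + (1 + (i - Suc m))" by auto
      then have "g x ^ i = g x ^ m * (g x * g x ^ (i - Suc m))" by (metis power_add power_one_right)
      then show "g x ^ i * h i x = g x ^ m * (g x * (g x ^ (i - Suc m) * h i x))" by simp
    qed simp
    finally show ?thesis by (simp add: algebra_simps)
  qed
  then have "(\<lambda>x. g x ^ m * (g x * r x + h m x)) \<in> Q" using assms(8) by simp
  then have "(\<lambda>x. g x * r x + h m x) \<in> Q"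
    by (rule prime_polys_power[OF assms(1) polyg _ assms(5), rotated]) (use polyg polyr polyh in auto)
  then have 1: "(\<lambda>x. g x * r x + h m x) \<in> Q'" using assms(3) by auto
  have "(\<lambda>x. g x * r x) \<in> Q'" by (rule prime_polysD(4)[OF assms(2,4) polyr])
  from prime_polys_diff[OF assms(2) this 1 polyh] show ?case using assms(7) less.prems by auto
qed

lemma sum_PiE_insert:
  fixes F :: "('b \<Rightarrow> 'c) \<Rightarrow> 'd::comm_monoid_add"
  assumes "i \<notin> S"
  shows "(\<Sum>a\<in>insert i S \<rightarrow>\<^sub>E T. F a) = (\<Sum>m\<in>T. \<Sum>a\<in>S \<rightarrow>\<^sub>E T. F (a(i := m)))"
proof -
  have "(\<Sum>a\<in>insert i S \<rightarrow>\<^sub>E T. F a) = (\<Sum>(m, a)\<in>T \<times> (S \<rightarrow>\<^sub>E T). F (a(i := m)))"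
    unfolding PiE_insert_eq using inj_combinator[OF assms, of "\<lambda>_. T"]
    by (subst sum.reindex) (auto simp: case_prod_unfold)
  then show ?thesis by (simp add: sum.cartesian_product)
qed

text \<open>Downward induction along the chain: the later polynomials are independent modulo
  \<open>Q (Suc i)\<close>, and \<open>g i\<close> lies in that ideal but not in \<open>Q i\<close>,
  so independence modulo \<open>Q i\<close> follows by looking at lowest coefficients in
  \<open>g i\<close>. At the top, a nonzero constant in \<open>Q k\<close> would put 1 into a proper
  ideal.\<close>

lemma prime_chain_algebraically_independent:
  fixes g :: "nat \<Rightarrow> 'a::euclidean_space \<Rightarrow> real"
  assumes "\<And>i. i \<le> k \<Longrightarrow> prime_polys V (Q i)" "\<And>i. i < k \<Longrightarrow> Q i \<subseteq> Q (Suc i)"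
    and "\<And>i. i < k \<Longrightarrow> g i \<in> Q (Suc i) - Q i"
  shows "i \<le> k \<Longrightarrow> (\<lambda>y. \<Sum>a\<in>{i..<k} \<rightarrow>\<^sub>E {..D}. x a * (\<Prod>j\<in>{i..<k}. g j y ^ a j)) \<in> Q i \<Longrightarrow>
    a \<in> {i..<k} \<rightarrow>\<^sub>E {..D} \<Longrightarrow> x a = 0"
proof (induction i arbitrary: x a rule: inc_induct)
  case base
  then have a: "a = (\<lambda>_. undefined)" and const: "(\<lambda>y. x (\<lambda>_. undefined)) \<in> Q k" by auto
  have "x (\<lambda>_. undefined) = 0"
  proof (rule ccontr)
    assume "x (\<lambda>_. undefined) \<noteq> 0"
    moreover have "(\<lambda>y. x (\<lambda>_. undefined) * (1 / x (\<lambda>_. undefined))) \<in> Q k"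
      by (rule prime_polysD(4)[OF assms(1)[of k] const]) auto
    ultimately show False using prime_polysD(6)[OF assms(1)[of k]] by simp
  qed
  then show ?case using a by simp
next
  case (step i)
  have ins: "{i..<k} = insert i {Suc i..<k}" "i \<notin> {Suc i..<k}" using step by auto
  \<comment> \<open>The coefficient of \<open>g i ^ m\<close>, a polynomial in the later
    \<open>g j\<close>.\<close>
  define h where "h = (\<lambda>m y. \<Sum>a\<in>{Suc i..<k} \<rightarrow>\<^sub>E {..D}. x (a(i := m)) * (\<Prod>j\<in>{Suc i..<k}. g j y ^ a j))"
  have polyg: "real_polynomial_function (g j)" if "j < k" for j
    using prime_polysD(1)[OF assms(1)[of "Suc j"]] assms(3) that by auto
  have polyh: "real_polynomial_function (h m)" for m unfolding h_def
    by (intro real_polynomial_function_sum real_polynomial_function.intros(4) real_polynomial_function.intros(2)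
        real_polynomial_function_prod real_polynomial_function_power finite_PiE) (auto intro: polyg)
  have coef: "x (b(i := m)) = 0" if "h m \<in> Q (Suc i)" "b \<in> {Suc i..<k} \<rightarrow>\<^sub>E {..D}" for m b
    by (rule step.IH[of "\<lambda>a. x (a(i := m))"]) (use that in \<open>simp_all add: h_def\<close>)
  have "(\<Sum>a\<in>{i..<k} \<rightarrow>\<^sub>E {..D}. x a * (\<Prod>j\<in>{i..<k}. g j y ^ a j)) = (\<Sum>m\<le>D. g i y ^ m * h m y)" for y
  proof -
    have "(\<Prod>j\<in>{Suc i..<k}. g j y ^ (b(i := m)) j) = (\<Prod>j\<in>{Suc i..<k}. g j y ^ b j)" for b m
      by (rule prod.cong) auto
    then show ?thesis unfolding ins(1) sum_PiE_insert[OF ins(2)] h_def sum_distrib_left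
      by (simp add: ac_simps)
  qed
  then have inQ: "(\<lambda>y. \<Sum>m\<le>D. g i y ^ m * h m y) \<in> Q i" using step.prems by simp
  have vanish: "\<forall>y. h m y = 0" if "h m \<in> Q (Suc i)" for m
  proof
    fix y
    have "(\<Sum>b\<in>{Suc i..<k} \<rightarrow>\<^sub>E {..D}. x (b(i := m)) * (\<Prod>j\<in>{Suc i..<k}. g j y ^ b j)) = 0"
      by (intro sum.neutral ballI) (use coef[OF that] in simp)
    then show "h m y = 0" by (simp add: h_def)
  qed
  have ik: "i \<le> k" "Suc i \<le> k" "i < k" using step.hyps by auto
  have gi: "g i \<in> Q (Suc i)" "g i \<notin> Q i" using assms(3)[OF ik(3)] by auto
  have h0: "\<forall>y. h m y = 0" if "m \<le> D" for m
    by (rule prime_polys_lowest_coefficient[OF assms(1)[OF ik(1)] assms(1)[OF ik(2)] assms(2)[OF ik(3)] gi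
          polyh vanish inQ that])
  have hQ: "h m \<in> Q (Suc i)" if "m \<le> D" for m
    by (rule prime_polysD(2)[OF assms(1)[OF ik(2)] polyh]) (use h0[OF that] in simp)
  obtain m b where "m \<le> D" "b \<in> {Suc i..<k} \<rightarrow>\<^sub>E {..D}" "a = b(i := m)"
    using step.prems(2) unfolding ins(1) PiE_insert_eq by auto
  then show ?case using coef[OF hQ] by (simp only:)
qed

lemma bounded_linear_eq_sum_Basis:
  fixes f :: "'a::euclidean_space \<Rightarrow> real"
  assumes "bounded_linear f"
  shows "f x = (\<Sum>b\<in>Basis. (x \<bullet> b) * f b)"
proof -
  have "f x = f (\<Sum>b\<in>Basis. (x \<bullet> b) *\<^sub>R b)" by (simp add: euclidean_representation)
  also have "\<dots> = (\<Sum>b\<in>Basis. (x \<bullet> b) * f b)"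
    using assms by (simp add: linear_sum bounded_linear.linear linear_scale)
  finally show ?thesis .
qed

text \<open>A chain of length \<open>k > m\<close> would give \<open>k\<close> polynomials
  independent on \<open>V\<close>, whereas counting monomials gives a relation between them. The
  relation must hold on all charts at once, because \<open>V\<close> is not assumed
  irreducible.\<close>

theorem real_algebraic_dim_le:
  fixes G :: "'p \<Rightarrow> 'a::euclidean_space"
  assumes "finite \<C>"
    and "\<And>U X. (U, X) \<in> \<C> \<Longrightarrow> finite X \<and> card X \<le> m \<and>
      (\<forall>b\<in>Basis. rat_on X U (\<lambda>p. complex_of_real (G p \<bullet> b)))"
    and "V \<subseteq> (\<Union>(U, X)\<in>\<C>. G ` U)"
  shows "real_algebraic_dim V \<le> enat m"
  unfolding real_algebraic_dim_def krull_dim_def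
proof (rule Sup_least, clarsimp)
  fix k P
  assume P: "\<forall>i\<le>k. primeideal (P i) (polynomial_function_ring V)" "\<forall>i<k. P i \<subset> P (Suc i)"
  define Q where "Q = (\<lambda>i. {f. real_polynomial_function f \<and> restrict f V \<in> P i})"
  have prime: "prime_polys V (Q i)" if "i \<le> k" for i
    unfolding Q_def using P(1) that by (intro primeideal_imp_prime_polys) auto
  have sub: "Q i \<subseteq> Q (Suc i)" if "i < k" for i using P(2) that by (auto simp: Q_def)
  have "\<exists>f. f \<in> Q (Suc i) - Q i" if "i < k" for i
  proof -
    from P(2) that obtain r where r: "r \<in> P (Suc i)" "r \<notin> P i" by blast
    interpret primeideal "P (Suc i)" "polynomial_function_ring V" using P(1) that by simp
    have "r \<in> carrier (polynomial_function_ring V)" using r a_subset by auto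
    then obtain f where "r = restrict f V" "real_polynomial_function f"
      by (auto simp: polynomial_function_ring_def)
    then show ?thesis using r by (auto simp: Q_def)
  qed
  then have "\<forall>i. \<exists>f. i < k \<longrightarrow> f \<in> Q (Suc i) - Q i" by blast
  from choice[OF this] obtain g where "\<forall>i. i < k \<longrightarrow> g i \<in> Q (Suc i) - Q i" ..
  then have g: "g i \<in> Q (Suc i) - Q i" if "i < k" for i using that by blast
  have polyg: "real_polynomial_function (g j)" if "j < k" for j
    using g[OF that] by (auto simp: Q_def)
  have rat: "rat_on X U (\<lambda>p. complex_of_real (f (G p)))"
    if "(U, X) \<in> \<C>" "real_polynomial_function f" for U X f
    using that(2)
  proof (induction rule: real_polynomial_function.induct)
    case (linear f)
    have "complex_of_real (f (G p)) = (\<Sum>b\<in>Basis. complex_of_real (G p \<bullet> b) * complex_of_real (f b))" for p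
      by (subst bounded_linear_eq_sum_Basis[OF linear]) simp
    then show ?case using assms(2)[OF that(1)] by (simp only:) (intro rat_on_sum rat_on_mult rat_on_const, simp)
  qed (auto intro: rat_on_const rat_on_add rat_on_mult)
  show "k \<le> m"
  proof (rule ccontr)
    assume "\<not> k \<le> m"
    then have "m < k" by simp
    have "\<exists>D x. (\<exists>a\<in>{..<k} \<rightarrow>\<^sub>E {..D}. x a \<noteq> 0) \<and>
        (\<forall>(U, X)\<in>\<C>. \<forall>p\<in>U. (\<Sum>a\<in>{..<k} \<rightarrow>\<^sub>E {..D}. x a * (\<Prod>j<k. complex_of_real (g j (G p)) ^ a j)) = 0)"
      by (rule rat_on_algebraic_relation[OF assms(1) _ \<open>m < k\<close>]) (use assms(2) rat polyg in simp)
    then obtain D x where Dx: "(\<exists>a\<in>{..<k} \<rightarrow>\<^sub>E {..D}. x a \<noteq> 0) \<and>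
        (\<forall>(U, X)\<in>\<C>. \<forall>p\<in>U. (\<Sum>a\<in>{..<k} \<rightarrow>\<^sub>E {..D}. x a * (\<Prod>j<k. complex_of_real (g j (G p)) ^ a j)) = 0)"
      by (elim exE) (rule that)
    then obtain a0 where x: "a0 \<in> {..<k} \<rightarrow>\<^sub>E {..D}" "x a0 \<noteq> 0" by blast
    have rel: "(\<Sum>a\<in>{..<k} \<rightarrow>\<^sub>E {..D}. x a * (\<Prod>j<k. complex_of_real (g j (G p)) ^ a j)) = 0"
      if "(U, X) \<in> \<C>" "p \<in> U" for U X p
      using bspec[OF conjunct2[OF Dx] that(1)] that(2) by simp
    \<comment> \<open>A real combination vanishing on \<open>V\<close> lies in the bottom prime
      \<open>Q 0\<close>, where the independence result applies.\<close>
    have zero: "y a0 = 0" if "\<And>v. v \<in> V \<Longrightarrow> (\<Sum>a\<in>{0..<k} \<rightarrow>\<^sub>E {..D}. y a * (\<Prod>j\<in>{0..<k}. g j v ^ a j)) = 0" for y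
    proof (rule prime_chain_algebraically_independent[where k = k and V = V and Q = Q and g = g and i = 0 and D = D and x = y and a = a0])
      show "(\<lambda>v. \<Sum>a\<in>{0..<k} \<rightarrow>\<^sub>E {..D}. y a * (\<Prod>j\<in>{0..<k}. g j v ^ a j)) \<in> Q 0"
        by (rule prime_polysD(2)[OF prime]) (auto intro!: that real_polynomial_function_sum real_polynomial_function.intros(4)
            real_polynomial_function.intros(2) real_polynomial_function_prod real_polynomial_function_power
            finite_PiE polyg)
    qed (use x prime sub g in \<open>simp_all add: atLeast0LessThan\<close>)
    have cx: "(\<Sum>a\<in>{0..<k} \<rightarrow>\<^sub>E {..D}. x a * complex_of_real (\<Prod>j\<in>{0..<k}. g j v ^ a j)) = 0" if "v \<in> V" for v
    proof -
      from that assms(3) obtain U X p where "(U, X) \<in> \<C>" "p \<in> U" "v = G p" by auto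
      then show ?thesis using rel[of U X p] by (simp add: atLeast0LessThan)
    qed
    \<comment> \<open>The relation has complex coefficients while the \<open>g j\<close> are real,
      so its real and imaginary parts are relations as well.\<close>
    have "(\<Sum>a\<in>{0..<k} \<rightarrow>\<^sub>E {..D}. Re (x a) * (\<Prod>j\<in>{0..<k}. g j v ^ a j)) = 0"
      "(\<Sum>a\<in>{0..<k} \<rightarrow>\<^sub>E {..D}. Im (x a) * (\<Prod>j\<in>{0..<k}. g j v ^ a j)) = 0" if "v \<in> V" for v
      using arg_cong[OF cx[OF that], of Re] arg_cong[OF cx[OF that], of Im] by (simp_all del: of_real_prod)
    from zero[OF this(1)] zero[OF this(2)] x(2) show False by (simp add: complex_eq_iff)
  qed
qed

subsection \<open>Flags of irreducible sets\<close>

text \<open>Equivalently, the vanishing ideal of \<open>S\<close> is prime. As \<open>S\<close> need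
  not be algebraic, images of parameter sets can be used without determining their Zariski
  closures.\<close>

definition poly_irreducible :: "'a::euclidean_space set \<Rightarrow> bool" where
  "poly_irreducible S \<longleftrightarrow> S \<noteq> {} \<and>
    (\<forall>f g. real_polynomial_function f \<longrightarrow> real_polynomial_function g \<longrightarrow> (\<forall>x\<in>S. f x * g x = 0) \<longrightarrow>
      (\<forall>x\<in>S. f x = 0) \<or> (\<forall>x\<in>S. g x = 0))"

lemma primeideal_vanishing:
  assumes "poly_irreducible S" "S \<subseteq> V"
  shows "primeideal {restrict f V | f. real_polynomial_function f \<and> (\<forall>x\<in>S. f x = 0)} (polynomial_function_ring V)"
    (is "primeideal ?I ?R")
proof -
  interpret R: cring ?R by (rule cring_polynomial_function_ring)
  have carr: "r \<in> carrier ?R \<longleftrightarrow> (\<exists>f. real_polynomial_function f \<and> r = restrict f V)" for r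
    by (auto simp: polynomial_function_ring_def)
  have mult: "restrict f V \<otimes>\<^bsub>?R\<^esub> restrict g V = restrict (\<lambda>x. f x * g x) V" for f g
    by (auto simp: polynomial_function_ring_def)
  have add: "restrict f V \<oplus>\<^bsub>?R\<^esub> restrict g V = restrict (\<lambda>x. f x + g x) V" for f g
    by (auto simp: polynomial_function_ring_def)
  have zero: "\<zero>\<^bsub>?R\<^esub> = restrict (\<lambda>x. 0) V"
    by (auto simp: polynomial_function_ring_def)
  have minus: "\<ominus>\<^bsub>?R\<^esub> restrict f V = restrict (\<lambda>x. - f x) V" if "real_polynomial_function f" for f
    by (rule R.minus_equality) (use that carr in \<open>auto simp: add zero\<close>)
  have I: "r \<in> ?I \<longleftrightarrow> (\<exists>f. real_polynomial_function f \<and> (\<forall>x\<in>S. f x = 0) \<and> r = restrict f V)" for r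
    by auto
  \<comment> \<open>A restriction to \<open>V\<close> has several polynomial representatives; they
    agree on \<open>S\<close> because \<open>S\<close> lies in \<open>V\<close>, so membership can
    be tested on any of them.\<close>
  have inI: "restrict f V \<in> ?I \<longleftrightarrow> (\<forall>x\<in>S. f x = 0)" if "real_polynomial_function f" for f
  proof
    assume "restrict f V \<in> ?I"
    then obtain g where g: "\<forall>x\<in>S. g x = 0" "restrict f V = restrict g V" by auto
    show "\<forall>x\<in>S. f x = 0"
    proof
      fix x assume "x \<in> S"
      then show "f x = 0" using fun_cong[OF g(2), of x] g(1) assms(2) by (auto simp: restrict_def split: if_splits)
    qed
  qed (use that in auto)
  have ideal: "ideal ?I ?R"
  proof (rule idealI)
    show "ring ?R" by (rule R.ring_axioms)
    show "subgroup ?I (add_monoid ?R)"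
    proof (rule R.add.subgroupI)
      show "?I \<subseteq> carrier ?R" unfolding subset_iff carr by auto
      have "(\<lambda>x\<in>V. 0) \<in> ?I" by (subst inI) auto
      then show "?I \<noteq> {}" by blast
    next
      fix a assume "a \<in> ?I"
      then obtain f where f: "real_polynomial_function f" "\<forall>x\<in>S. f x = 0" "a = restrict f V" by auto
      then have "restrict (\<lambda>x. - f x) V \<in> ?I" by (subst inI) auto
      then show "\<ominus>\<^bsub>?R\<^esub> a \<in> ?I" using minus[OF f(1)] f(3) by (simp only:)
    next
      fix a b assume "a \<in> ?I" "b \<in> ?I"
      then obtain f g where f: "real_polynomial_function f" "\<forall>x\<in>S. f x = 0" "a = restrict f V"
        "real_polynomial_function g" "\<forall>x\<in>S. g x = 0" "b = restrict g V" by auto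
      then have "restrict (\<lambda>x. f x + g x) V \<in> ?I" by (subst inI) auto
      then show "a \<oplus>\<^bsub>?R\<^esub> b \<in> ?I" using add f(3,6) by (simp only:)
    qed
  next
    fix a r assume "a \<in> ?I" "r \<in> carrier ?R"
    then obtain f g where f: "real_polynomial_function f" "\<forall>x\<in>S. f x = 0" "a = restrict f V"
      "real_polynomial_function g" "r = restrict g V" unfolding carr by auto
    then have "restrict (\<lambda>x. f x * g x) V \<in> ?I" by (subst inI) auto
    then show "a \<otimes>\<^bsub>?R\<^esub> r \<in> ?I" using mult f(3,5) by (simp only:)
    from f have "restrict (\<lambda>x. g x * f x) V \<in> ?I" by (subst inI) auto
    then show "r \<otimes>\<^bsub>?R\<^esub> a \<in> ?I" using mult f(3,5) by (simp only:)
  qed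
  show ?thesis
  proof (rule primeidealI[OF ideal cring_polynomial_function_ring])
    have "restrict (\<lambda>x. 1) V \<notin> ?I" using assms(1) by (subst inI) (auto simp: poly_irreducible_def)
    moreover have "restrict (\<lambda>x. 1) V \<in> carrier ?R" unfolding carr by (intro exI conjI refl) auto
    ultimately show "carrier ?R \<noteq> ?I" by blast
  next
    fix a b assume "a \<in> carrier ?R" "b \<in> carrier ?R" and ab: "a \<otimes>\<^bsub>?R\<^esub> b \<in> ?I"
    then obtain f g where f: "real_polynomial_function f" "a = restrict f V"
      "real_polynomial_function g" "b = restrict g V" unfolding carr by auto
    have "restrict (\<lambda>x. f x * g x) V \<in> ?I" using ab mult f(2,4) by (simp only:)
    then have "\<forall>x\<in>S. f x * g x = 0" by (subst (asm) inI) (use f in auto)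
    then have "(\<forall>x\<in>S. f x = 0) \<or> (\<forall>x\<in>S. g x = 0)"
      using assms(1) f(1,3) unfolding poly_irreducible_def by blast
    then show "a \<in> ?I \<or> b \<in> ?I" using f by auto
  qed
qed

lemma real_algebraic_dim_ge_chain:
  assumes "\<And>i. i \<le> k \<Longrightarrow> poly_irreducible (S i) \<and> S i \<subseteq> V"
    and "\<And>i. i < k \<Longrightarrow> S (Suc i) \<subseteq> S i"
    and "\<And>i. i < k \<Longrightarrow> \<exists>f. real_polynomial_function f \<and> (\<forall>x\<in>S (Suc i). f x = 0) \<and> (\<exists>x\<in>S i. f x \<noteq> 0)"
  shows "enat k \<le> real_algebraic_dim V"
  unfolding real_algebraic_dim_def krull_dim_def
proof (rule Sup_upper, intro CollectI exI[of _ k] conjI refl)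
  let ?P = "\<lambda>i. {restrict f V | f. real_polynomial_function f \<and> (\<forall>x\<in>S i. f x = 0)}"
  have "?P i \<subset> ?P (Suc i)" if i: "i < k" for i
  proof
    show "?P i \<subseteq> ?P (Suc i)" using assms(2)[OF i] by blast
    obtain f x where f: "real_polynomial_function f" "\<forall>x\<in>S (Suc i). f x = 0" "x \<in> S i" "f x \<noteq> 0"
      using assms(3)[OF i] by blast
    have "restrict f V \<notin> ?P i"
    proof
      assume "restrict f V \<in> ?P i"
      then obtain g where g: "\<forall>x\<in>S i. g x = 0" "restrict f V = restrict g V" by auto
      have "x \<in> V" using f(3) assms(1)[of i] i by auto
      then have "f x = g x" using fun_cong[OF g(2), of x] by simp
      then show False using f g by simp
    qed
    moreover have "restrict f V \<in> ?P (Suc i)" using f by blast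
    ultimately show "?P i \<noteq> ?P (Suc i)" by blast
  qed
  then show "\<exists>P. (\<forall>i\<le>k. primeideal (P i) (polynomial_function_ring V)) \<and> (\<forall>i<k. P i \<subset> P (Suc i))"
  proof (intro exI[of _ ?P] conjI allI impI)
    show "primeideal (?P i) (polynomial_function_ring V)" if "i \<le> k" for i
      using assms(1)[OF that] by (intro primeideal_vanishing) simp_all
  qed
qed

section \<open>Sets parametrised rationally along segments\<close>

text \<open>Numerator and denominator are univariate and may change with the segment. This is all
  that irreducibility of an image needs, and it replaces rational functions of many
  variables.\<close>

definition segment_rational :: "'p::real_vector set \<Rightarrow> ('p \<Rightarrow> complex) \<Rightarrow> bool" where
  "segment_rational T h \<longleftrightarrow> (\<forall>p\<in>T. \<forall>q\<in>T. \<exists>P Q. \<forall>t\<in>{0..1}.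
    poly Q (complex_of_real t) \<noteq> 0 \<and> h (p + t *\<^sub>R (q - p)) = poly P (complex_of_real t) / poly Q (complex_of_real t))"

lemma segment_rational_affine:
  assumes "\<And>p q t. p \<in> T \<Longrightarrow> q \<in> T \<Longrightarrow> h (p + t *\<^sub>R (q - p)) = h p + of_real t * (h q - h p)"
  shows "segment_rational T h"
  unfolding segment_rational_def
proof (intro ballI)
  fix p q assume "p \<in> T" "q \<in> T"
  then show "\<exists>P Q. \<forall>t\<in>{0..1}. poly Q (complex_of_real t) \<noteq> 0 \<and>
      h (p + t *\<^sub>R (q - p)) = poly P (complex_of_real t) / poly Q (complex_of_real t)"
    using assms by (intro exI[of _ "[:h p, h q - h p:]"] exI[of _ 1]) simp
qed

lemma segment_rational_const: "segment_rational T (\<lambda>p. c)"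
  by (rule segment_rational_affine) simp

lemma segment_rational_subset: "segment_rational T h \<Longrightarrow> T' \<subseteq> T \<Longrightarrow> segment_rational T' h"
  unfolding segment_rational_def by blast

lemma segment_rational_add:
  assumes "segment_rational T f" "segment_rational T g"
  shows "segment_rational T (\<lambda>p. f p + g p)"
  unfolding segment_rational_def
proof (intro ballI)
  fix p q assume "p \<in> T" "q \<in> T"
  with assms obtain P Q P' Q' where
    "\<forall>t\<in>{0..1}. poly Q (complex_of_real t) \<noteq> 0 \<and> f (p + t *\<^sub>R (q - p)) = poly P (of_real t) / poly Q (of_real t)"
    "\<forall>t\<in>{0..1}. poly Q' (complex_of_real t) \<noteq> 0 \<and> g (p + t *\<^sub>R (q - p)) = poly P' (of_real t) / poly Q' (of_real t)"
    unfolding segment_rational_def by blast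
  then show "\<exists>P Q. \<forall>t\<in>{0..1}. poly Q (complex_of_real t) \<noteq> 0 \<and>
      f (p + t *\<^sub>R (q - p)) + g (p + t *\<^sub>R (q - p)) = poly P (of_real t) / poly Q (of_real t)"
    by (intro exI[of _ "P * Q' + P' * Q"] exI[of _ "Q * Q'"]) (simp add: add_frac_eq)
qed

lemma segment_rational_mult:
  assumes "segment_rational T f" "segment_rational T g"
  shows "segment_rational T (\<lambda>p. f p * g p)"
  unfolding segment_rational_def
proof (intro ballI)
  fix p q assume "p \<in> T" "q \<in> T"
  with assms obtain P Q P' Q' where
    "\<forall>t\<in>{0..1}. poly Q (complex_of_real t) \<noteq> 0 \<and> f (p + t *\<^sub>R (q - p)) = poly P (of_real t) / poly Q (of_real t)"
    "\<forall>t\<in>{0..1}. poly Q' (complex_of_real t) \<noteq> 0 \<and> g (p + t *\<^sub>R (q - p)) = poly P' (of_real t) / poly Q' (of_real t)"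
    unfolding segment_rational_def by blast
  then show "\<exists>P Q. \<forall>t\<in>{0..1}. poly Q (complex_of_real t) \<noteq> 0 \<and>
      f (p + t *\<^sub>R (q - p)) * g (p + t *\<^sub>R (q - p)) = poly P (of_real t) / poly Q (of_real t)"
    by (intro exI[of _ "P * P'"] exI[of _ "Q * Q'"]) simp
qed

lemma segment_in_convex:
  assumes "convex T" "p \<in> T" "q \<in> T" "t \<in> {0..1::real}"
  shows "p + t *\<^sub>R (q - p) \<in> T"
proof -
  have "p + t *\<^sub>R (q - p) = (1 - t) *\<^sub>R p + t *\<^sub>R q" by (simp add: algebra_simps)
  then show ?thesis using convexD_alt[OF assms(1-3), of t] assms(4) by simp
qed

lemma segment_rational_inverse:
  assumes "segment_rational T f" "convex T" "\<And>p. p \<in> T \<Longrightarrow> f p \<noteq> 0"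
  shows "segment_rational T (\<lambda>p. inverse (f p))"
  unfolding segment_rational_def
proof (intro ballI)
  fix p q assume pq: "p \<in> T" "q \<in> T"
  with assms(1) obtain P Q where
    "\<forall>t\<in>{0..1}. poly Q (complex_of_real t) \<noteq> 0 \<and> f (p + t *\<^sub>R (q - p)) = poly P (of_real t) / poly Q (of_real t)"
    unfolding segment_rational_def by blast
  moreover have "f (p + t *\<^sub>R (q - p)) \<noteq> 0" if "t \<in> {0..1}" for t
    by (rule assms(3)[OF segment_in_convex[OF assms(2) pq that]])
  ultimately show "\<exists>P Q. \<forall>t\<in>{0..1}. poly Q (complex_of_real t) \<noteq> 0 \<and>
      inverse (f (p + t *\<^sub>R (q - p))) = poly P (of_real t) / poly Q (of_real t)"
    by (intro exI[of _ Q] exI[of _ P]) auto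
qed

lemma segment_rational_sum:
  "(\<And>j. j \<in> J \<Longrightarrow> segment_rational T (f j)) \<Longrightarrow> segment_rational T (\<lambda>p. \<Sum>j\<in>J. f j p)"
  by (induction J rule: infinite_finite_induct) (auto intro: segment_rational_const segment_rational_add)

lemma segment_rational_real_polynomial_function:
  assumes "\<And>b. b \<in> Basis \<Longrightarrow> segment_rational T (\<lambda>p. complex_of_real (G p \<bullet> b))" "real_polynomial_function f"
  shows "segment_rational T (\<lambda>p. complex_of_real (f (G p)))"
  using assms(2)
proof (induction rule: real_polynomial_function.induct)
  case (linear f)
  have "complex_of_real (f (G p)) = (\<Sum>b\<in>Basis. complex_of_real (G p \<bullet> b) * complex_of_real (f b))" for p
    by (subst bounded_linear_eq_sum_Basis[OF linear]) simp
  then show ?case using assms(1)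
    by (simp only:) (intro segment_rational_sum segment_rational_mult segment_rational_const, simp)
qed (auto intro: segment_rational_const segment_rational_add segment_rational_mult)

text \<open>Along a segment of the convex parameter set everything is rational in one variable, and a
  rational function which is not identically zero has finitely many zeros.\<close>
lemma poly_irreducible_image:
  assumes "convex T" "T \<noteq> {}" "\<And>b. b \<in> Basis \<Longrightarrow> segment_rational T (\<lambda>p. complex_of_real (G p \<bullet> b))"
  shows "poly_irreducible (G ` T)"
  unfolding poly_irreducible_def
proof (intro conjI allI impI)
  fix f g :: "'b \<Rightarrow> real"
  assume fg: "real_polynomial_function f" "real_polynomial_function g" "\<forall>x\<in>G ` T. f x * g x = 0"
  show "(\<forall>x\<in>G ` T. f x = 0) \<or> (\<forall>x\<in>G ` T. g x = 0)"
  proof (rule ccontr)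
    assume "\<not> ?thesis"
    then obtain p q where pq: "p \<in> T" "q \<in> T" "f (G p) \<noteq> 0" "g (G q) \<noteq> 0" by auto
    obtain P Q where PQ: "\<forall>t\<in>{0..1}. poly Q (complex_of_real t) \<noteq> 0 \<and>
        of_real (f (G (p + t *\<^sub>R (q - p)))) = poly P (of_real t) / poly Q (of_real t)"
      using segment_rational_real_polynomial_function[OF assms(3) fg(1)] pq unfolding segment_rational_def by blast
    obtain P' Q' where PQ': "\<forall>t\<in>{0..1}. poly Q' (complex_of_real t) \<noteq> 0 \<and>
        of_real (g (G (p + t *\<^sub>R (q - p)))) = poly P' (of_real t) / poly Q' (of_real t)"
      using segment_rational_real_polynomial_function[OF assms(3) fg(2)] pq unfolding segment_rational_def by blast
    have "poly (P * P') (of_real t) = 0" if t: "t \<in> {0..1}" for t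
    proof -
      have "f (G (p + t *\<^sub>R (q - p))) * g (G (p + t *\<^sub>R (q - p))) = 0"
        using fg(3) segment_in_convex[OF assms(1) pq(1,2) t] by blast
      then have "f (G (p + t *\<^sub>R (q - p))) = 0 \<or> g (G (p + t *\<^sub>R (q - p))) = 0" by simp
      then show ?thesis using PQ[rule_format, OF t] PQ'[rule_format, OF t] by auto
    qed
    then have "complex_of_real ` {0..1} \<subseteq> {z. poly (P * P') z = 0}" by blast
    moreover have "infinite (complex_of_real ` {0..1})"
      by (subst finite_image_iff) (auto simp: inj_on_def)
    ultimately have "P * P' = 0" using poly_roots_finite finite_subset by blast
    then have "P = 0 \<or> P' = 0" by simp
    \<comment> \<open>The segment is at \<open>p\<close> for \<open>t = 0\<close> and at
      \<open>q\<close> for \<open>t = 1\<close>, so neither numerator is the zero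
      polynomial.\<close>
    then show False using PQ[rule_format, of 0] PQ'[rule_format, of 1] pq(3,4) by auto
  qed
qed (use assms(2) in auto)

text \<open>Freezing the coordinates in \<open>K\<close> one after another at their values in
  \<open>c\<close> cuts \<open>T\<close> into a decreasing sequence of convex sets, whose images are
  irreducible. The polynomial \<open>f\<close> belonging to \<open>b\<close> vanishes as soon as
  \<open>b\<close> and everything of smaller rank is frozen, while \<open>q\<close> survives in
  every earlier set because it differs from \<open>c\<close> inside \<open>K\<close> at most in the
  coordinate \<open>b\<close>.\<close>

theorem real_algebraic_dim_ge:
  fixes G :: "'p::euclidean_space \<Rightarrow> 'a::euclidean_space" and rank :: "'p \<Rightarrow> nat"
  assumes "convex T" "c \<in> T" "\<And>b. b \<in> Basis \<Longrightarrow> segment_rational T (\<lambda>p. complex_of_real (G p \<bullet> b))"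
    and "G ` T \<subseteq> V" "K \<subseteq> Basis"
    and step: "\<And>b. b \<in> K \<Longrightarrow> \<exists>f q. real_polynomial_function f \<and>
      (\<forall>p\<in>T. (\<forall>b'\<in>K. rank b' < rank b \<longrightarrow> p \<bullet> b' = c \<bullet> b') \<longrightarrow> p \<bullet> b = c \<bullet> b \<longrightarrow> f (G p) = 0) \<and>
      q \<in> T \<and> (\<forall>b'\<in>K. b' \<noteq> b \<longrightarrow> q \<bullet> b' = c \<bullet> b') \<and> f (G q) \<noteq> 0"
  shows "enat (card K) \<le> real_algebraic_dim V"
proof -
  define S where "S = (\<lambda>J. {p\<in>T. \<forall>b\<in>J. p \<bullet> b = c \<bullet> b})"
  define good where "good = (\<lambda>J. \<forall>b\<in>J. \<forall>b'\<in>K. rank b' < rank b \<longrightarrow> b' \<in> J)"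
  have finK: "finite K" using assms(5) finite_Basis finite_subset by blast
  have irr: "poly_irreducible (G ` S J)" for J
  proof (rule poly_irreducible_image)
    have "S J = T \<inter> (\<Inter>b\<in>J. {p. b \<bullet> p = c \<bullet> b})" by (auto simp: S_def inner_commute)
    then show "convex (S J)" using assms(1) by (auto intro!: convex_Int convex_INT convex_hyperplane)
    show "S J \<noteq> {}" using assms(2) by (auto simp: S_def)
  qed (auto intro: segment_rational_subset[OF assms(3)] simp: S_def)
  define sep where "sep = (\<lambda>J J'. \<exists>f. real_polynomial_function f \<and> (\<forall>x\<in>G ` S J'. f x = 0) \<and> (\<exists>x\<in>G ` S J. f x \<noteq> 0))"
  \<comment> \<open>The order of freezing comes from dependent choice over all naturals, so the
    sequence becomes stationary once all of \<open>K\<close> is frozen.\<close>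
  define A where "A = (\<lambda>n J. J \<subseteq> K \<and> good J \<and> card J = min n (card K))"
  define R where "R = (\<lambda>n J J'. n < card K \<longrightarrow> J \<subseteq> J' \<and> sep J J')"
  have "\<exists>J'. A (Suc n) J' \<and> R n J J'"
    if J': "A n J" for n J
  proof (cases "n < card K")
    case False
    then show ?thesis using J' by (intro exI[of _ J]) (simp add: A_def R_def min_def)
  next
    case True
    have J: "J \<subseteq> K" "good J" "card J = n" using J' True by (auto simp: A_def)
    have "J \<noteq> K" using J True by auto
    then have "\<exists>b. b \<in> K - J" using J by auto
    from ex_has_least_nat[of "\<lambda>b. b \<in> K - J" _ rank, OF someI_ex[OF this]]
    obtain b where b: "b \<in> K" "b \<notin> J" "\<And>b'. b' \<in> K \<Longrightarrow> b' \<notin> J \<Longrightarrow> rank b \<le> rank b'" by blast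
    from step[OF b(1)] obtain f q where f: "real_polynomial_function f"
      "\<forall>p\<in>T. (\<forall>b'\<in>K. rank b' < rank b \<longrightarrow> p \<bullet> b' = c \<bullet> b') \<longrightarrow> p \<bullet> b = c \<bullet> b \<longrightarrow> f (G p) = 0"
      "q \<in> T" "\<forall>b'\<in>K. b' \<noteq> b \<longrightarrow> q \<bullet> b' = c \<bullet> b'" "f (G q) \<noteq> 0" by blast
    have low: "b' \<in> J" if "b' \<in> K" "rank b' < rank b" for b' using b(3)[of b'] that by force
    have "finite J" using J finK finite_subset by blast
    then have "card (insert b J) = min (Suc n) (card K)" using b J True by simp
    moreover have "good (insert b J)" using J(2) low unfolding good_def by blast
    moreover have "\<forall>x\<in>G ` S (insert b J). f x = 0"
    proof
      fix x assume "x \<in> G ` S (insert b J)"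
      then obtain p where p: "x = G p" "p \<in> T" "p \<bullet> b = c \<bullet> b" "\<forall>b'\<in>J. p \<bullet> b' = c \<bullet> b'"
        by (auto simp: S_def)
      then show "f x = 0" using f(2)[rule_format, OF p(2)] low by auto
    qed
    moreover have "q \<in> S J" using f(3,4) b J(1) by (auto simp: S_def)
    ultimately have "A (Suc n) (insert b J)" "sep J (insert b J)"
      using f(1,5) b J(1) by (auto simp: A_def sep_def)
    then show ?thesis unfolding R_def by blast
  qed
  moreover have "A 0 {}" by (simp add: A_def good_def)
  ultimately have "\<exists>J. \<forall>n. A n (J n) \<and> R n (J n) (J (Suc n))"
    using dependent_nat_choice[of A R] by blast
  then obtain J where J: "\<forall>n. A n (J n) \<and> R n (J n) (J (Suc n))" ..
  show ?thesis
  proof (rule real_algebraic_dim_ge_chain[where S = "\<lambda>i. G ` S (J i)"])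
    show "poly_irreducible (G ` S (J i)) \<and> G ` S (J i) \<subseteq> V" for i
    proof
      have "S (J i) \<subseteq> T" by (auto simp: S_def)
      then show "G ` S (J i) \<subseteq> V" using assms(4) by blast
    qed (rule irr)
    show "G ` S (J (Suc i)) \<subseteq> G ` S (J i)" if "i < card K" for i
    proof -
      have "J i \<subseteq> J (Suc i)" using J that by (simp add: R_def)
      then show ?thesis by (intro image_mono) (auto simp: S_def)
    qed
    show "\<exists>f. real_polynomial_function f \<and> (\<forall>x\<in>G ` S (J (Suc i)). f x = 0) \<and> (\<exists>x\<in>G ` S (J i). f x \<noteq> 0)"
      if "i < card K" for i using J that by (simp add: R_def sep_def)
  qed
qed

subsection \<open>The differential and its cokernel\<close>

lemma ctranspose_nth [simp]: "ctranspose A $ i $ j = cnj (A $ j $ i)"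
  by (simp add: ctranspose_def transpose_def)

lemma matrix_mult_nth: "(A ** B) $ i $ j = (\<Sum>k\<in>UNIV. A $ i $ k * B $ k $ j)"
  by (simp add: matrix_matrix_mult_def)

lemma ctranspose_mult: "ctranspose (A ** B) = ctranspose B ** ctranspose (A :: 'n::finite cmat)"
  by (simp add: vec_eq_iff matrix_mult_nth mult.commute)

lemma ctranspose_ctranspose [simp]: "ctranspose (ctranspose A) = A"
  by (simp add: vec_eq_iff)

lemma ctranspose_add: "ctranspose (A + B) = ctranspose A + ctranspose B"
  by (simp add: vec_eq_iff)

lemma ctranspose_diff: "ctranspose (A - B) = ctranspose A - ctranspose B"
  by (simp add: vec_eq_iff)

lemma ctranspose_minus: "ctranspose (- A) = - ctranspose A"
  by (simp add: vec_eq_iff)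

lemma ctranspose_scaleR: "ctranspose (r *\<^sub>R A) = r *\<^sub>R ctranspose A"
  by (simp add: vec_eq_iff)

lemma ctranspose_mat_1 [simp]: "ctranspose (mat 1) = mat 1"
  by (simp add: vec_eq_iff mat_def)

lemma ctranspose_0 [simp]: "ctranspose 0 = 0"
  by (simp add: vec_eq_iff)

lemma bounded_linear_ctranspose: "bounded_linear (ctranspose :: 'n::finite cmat \<Rightarrow> _)"
  by (intro linear_conv_bounded_linear[THEN iffD1] linearI ctranspose_add ctranspose_scaleR)

lemma bounded_bilinear_matrix_mult: "bounded_bilinear ((**) :: 'n::finite cmat \<Rightarrow> 'n cmat \<Rightarrow> 'n cmat)"
proof -
  have "bilinear ((**) :: 'n::finite cmat \<Rightarrow> 'n cmat \<Rightarrow> 'n cmat)"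
    unfolding bilinear_def
    by (auto intro!: linearI simp: vec_eq_iff matrix_mult_nth distrib_left distrib_right sum.distrib scaleR_sum_right)
  then show ?thesis by (simp add: bilinear_conv_bounded_bilinear)
qed

interpretation matrix_mult: bounded_bilinear "(**) :: 'n::finite cmat \<Rightarrow> 'n cmat \<Rightarrow> 'n cmat"
  by (rule bounded_bilinear_matrix_mult)

lemma bounded_linear_map_matrix_mult: "bounded_linear (map_matrix (\<lambda>z. c * z) :: 'n::finite cmat \<Rightarrow> _)"
  by (intro linear_conv_bounded_linear[THEN iffD1] linearI) (auto simp: vec_eq_iff distrib_left)

lemma inner_complex_eq: "(a :: complex) \<bullet> b = Re (a * cnj b)"
  by (simp add: inner_complex_def)

lemma inner_cmat_eq: "(A :: 'n::finite cmat) \<bullet> B = Re (\<Sum>i\<in>UNIV. \<Sum>j\<in>UNIV. A $ i $ j * cnj (B $ i $ j))"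
  by (simp add: inner_vec_def inner_complex_eq)

lemma inner_ctranspose: "ctranspose A \<bullet> ctranspose B = (A :: 'n::finite cmat) \<bullet> B"
proof -
  have "ctranspose A \<bullet> ctranspose B = (\<Sum>i\<in>UNIV. \<Sum>j\<in>UNIV. A $ j $ i \<bullet> B $ j $ i)"
    by (simp add: inner_vec_def inner_complex_def)
  also have "\<dots> = A \<bullet> B" by (subst sum.swap) (simp add: inner_vec_def)
  finally show ?thesis .
qed

lemma inner_mult_left: "(X ** Y) \<bullet> Z = X \<bullet> (Z ** ctranspose Y)" for X Y Z :: "'n::finite cmat"
proof -
  have "(\<Sum>i\<in>UNIV. \<Sum>j\<in>UNIV. \<Sum>k\<in>UNIV. X $ i $ k * Y $ k $ j * cnj (Z $ i $ j))
     = (\<Sum>i\<in>UNIV. \<Sum>k\<in>UNIV. \<Sum>j\<in>UNIV. X $ i $ k * Y $ k $ j * cnj (Z $ i $ j))"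
    by (rule sum.cong[OF refl], rule sum.swap)
  then show ?thesis
    unfolding inner_cmat_eq matrix_mult_nth
    by (simp add: sum_distrib_left sum_distrib_right ac_simps)
qed

lemma inner_mult_right: "(X ** Y) \<bullet> Z = Y \<bullet> (ctranspose X ** Z)" for X Y Z :: "'n::finite cmat"
proof -
  have "(X ** Y) \<bullet> Z = (ctranspose Y ** ctranspose X) \<bullet> ctranspose Z"
    by (metis ctranspose_mult inner_ctranspose)
  also have "\<dots> = ctranspose Y \<bullet> (ctranspose Z ** X)" by (simp add: inner_mult_left)
  also have "\<dots> = ctranspose Y \<bullet> ctranspose (ctranspose X ** Z)" by (simp add: ctranspose_mult)
  finally show ?thesis by (simp add: inner_ctranspose)
qed

definition dphi :: "'n::finite cmat \<times> 'n cmat \<Rightarrow> 'n cmat \<times> 'n cmat \<Rightarrow> 'n cmat \<times> 'n cmat" where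
  "dphi = (\<lambda>(A, B) (X, Y). (map_matrix (\<lambda>z. \<i> / 2 * z)
     (ctranspose A ** X + ctranspose X ** A - (B ** ctranspose Y + Y ** ctranspose B)), B ** X + Y ** A))"

lemma has_derivative_phi: "(phi has_derivative dphi p) (at p)"
proof -
  have phi: "phi = (\<lambda>p. (map_matrix (\<lambda>z. \<i> / 2 * z) (ctranspose (fst p) ** fst p - snd p ** ctranspose (snd p)),
      snd p ** fst p))"
    by (auto simp: phi_def)
  show ?thesis unfolding phi
    by (rule derivative_eq_intros bounded_linear.has_derivative[OF bounded_linear_map_matrix_mult]
        bounded_linear.has_derivative[OF bounded_linear_ctranspose] matrix_mult.FDERIV refl)+
      (auto simp: dphi_def fun_eq_iff split: prod.splits)
qed

lemma frechet_derivative_phi: "frechet_derivative phi (at p) = dphi p"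
  using has_derivative_phi by (rule frechet_derivative_at[symmetric])

lemma linear_dphi: "linear (dphi p)"
  using has_derivative_phi has_derivative_linear by blast

lemma subspace_skew_hermitian: "subspace (skew_hermitian :: 'n::finite cmat set)"
  by (auto simp: subspace_def skew_hermitian_def ctranspose_add ctranspose_scaleR)

lemma range_dphi_subset: "range (dphi p) \<subseteq> skew_hermitian \<times> UNIV"
proof clarify
  fix S E x assume "(S, E) = dphi p x"
  then show "S \<in> skew_hermitian \<and> E \<in> UNIV"
  proof -
    obtain A B X Y where "p = (A, B)" "x = (X, Y)" by fastforce
    with \<open>(S, E) = dphi p x\<close> have S: "S = map_matrix (\<lambda>z. \<i> / 2 * z)
        (ctranspose A ** X + ctranspose X ** A - (B ** ctranspose Y + Y ** ctranspose B))" (is "_ = map_matrix _ ?Z")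
      by (simp add: dphi_def)
    have "ctranspose ?Z = ?Z" by (simp add: ctranspose_add ctranspose_diff ctranspose_mult add.commute)
    then have "cnj (?Z $ j $ i) = ?Z $ i $ j" for i j by (metis ctranspose_nth)
    then show ?thesis unfolding S skew_hermitian_def
      by (simp add: vec_eq_iff del: vector_minus_component vector_add_component)
  qed
qed

definition cokernel_condition :: "'n::finite cmat \<times> 'n cmat \<Rightarrow> 'n cmat \<times> 'n cmat \<Rightarrow> bool" where
  "cokernel_condition = (\<lambda>(A, B) (H, E). ctranspose H = H \<and> A ** H = - (ctranspose B ** E) \<and> H ** B = E ** ctranspose A)"

lemma inner_map_matrix_i: "map_matrix (\<lambda>z. \<i> * z) H \<bullet> map_matrix (\<lambda>z. \<i> / 2 * z) Z = (H \<bullet> Z) / 2"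
  for H :: "'n::finite cmat"
  by (simp add: inner_vec_def inner_complex_def sum_divide_distrib add_divide_distrib add.commute)

text \<open>A Hermitian \<open>H\<close> has the same inner product with a matrix and with its
  adjoint. The two terms of the product rule thus contribute equally, which cancels the factor one
  half, and the remaining factors are moved across as adjoints.\<close>

lemma inner_dphi:
  fixes H E :: "'n::finite cmat"
  assumes "ctranspose H = H"
  shows "(map_matrix (\<lambda>z. \<i> * z) H, E) \<bullet> dphi (A, B) (X, Y) =
    (A ** H + ctranspose B ** E) \<bullet> X + (E ** ctranspose A - H ** B) \<bullet> Y"
proof -
  have self: "H \<bullet> ctranspose Z = H \<bullet> Z" for Z using inner_ctranspose[of H Z] assms by simp
  have "H \<bullet> (ctranspose X ** A) = H \<bullet> (ctranspose A ** X)" "H \<bullet> (B ** ctranspose Y) = H \<bullet> (Y ** ctranspose B)"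
    using self[of "ctranspose A ** X"] self[of "Y ** ctranspose B"] by (simp_all add: ctranspose_mult)
  moreover have "H \<bullet> (ctranspose A ** X) = (A ** H) \<bullet> X" "E \<bullet> (B ** X) = (ctranspose B ** E) \<bullet> X"
    using inner_mult_right[of "ctranspose A" X H] inner_mult_right[of B X E] by (simp_all add: inner_commute)
  moreover have "H \<bullet> (Y ** ctranspose B) = (H ** B) \<bullet> Y" "E \<bullet> (Y ** A) = (E ** ctranspose A) \<bullet> Y"
    using inner_mult_left[of Y "ctranspose B" H] inner_mult_left[of Y A E] by (simp_all add: inner_commute)
  ultimately show ?thesis
    unfolding dphi_def prod.case inner_Pair inner_map_matrix_i
    by (simp add: inner_add_left inner_add_right inner_diff_left inner_diff_right)
qed

theorem critical_points_iff_cokernel: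
  "p \<in> critical_points \<longleftrightarrow> (\<exists>w. w \<noteq> 0 \<and> cokernel_condition p w)"
proof -
  obtain A B where p: "p = (A, B)" by (cases p)
  let ?i = "map_matrix (\<lambda>z. \<i> * z) :: 'a cmat \<Rightarrow> 'a cmat"
  have coker: "cokernel_condition p (H, E) \<longleftrightarrow> ctranspose H = H \<and> (\<forall>x. (?i H, E) \<bullet> dphi p x = 0)" for H E
  proof (cases "ctranspose H = H")
    case True
    have "(\<forall>x. (?i H, E) \<bullet> dphi p x = 0) \<longleftrightarrow>
      (\<forall>X Y. (A ** H + ctranspose B ** E) \<bullet> X + (E ** ctranspose A - H ** B) \<bullet> Y = 0)"
      by (simp add: p inner_dphi[OF True])
    also have "\<dots> \<longleftrightarrow> A ** H + ctranspose B ** E = 0 \<and> E ** ctranspose A - H ** B = 0"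
    proof (intro iffI conjI)
      assume *: "\<forall>X Y. (A ** H + ctranspose B ** E) \<bullet> X + (E ** ctranspose A - H ** B) \<bullet> Y = 0"
      show "A ** H + ctranspose B ** E = 0" using *[rule_format, of "A ** H + ctranspose B ** E" 0] by simp
      show "E ** ctranspose A - H ** B = 0" using *[rule_format, of 0 "E ** ctranspose A - H ** B"] by simp
    qed auto
    finally show ?thesis using True by (auto simp: cokernel_condition_def p add_eq_0_iff eq_diff_eq)
  qed (simp add: cokernel_condition_def p)
  have skew: "?i H \<in> skew_hermitian \<longleftrightarrow> ctranspose H = H" for H
    by (simp add: skew_hermitian_def vec_eq_iff)
  have "p \<in> critical_points \<longleftrightarrow> range (dphi p) \<noteq> skew_hermitian \<times> UNIV"
    by (simp add: critical_points_def frechet_derivative_phi)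
  also have "\<dots> \<longleftrightarrow> (\<exists>S E. (S, E) \<noteq> 0 \<and> S \<in> skew_hermitian \<and> (\<forall>x. (S, E) \<bullet> dphi p x = 0))"
  proof
    \<comment> \<open>The range always lies in the target, so failure of surjectivity means a proper
      subspace and hence a nonzero vector of the target orthogonal to it.\<close>
    assume "range (dphi p) \<noteq> skew_hermitian \<times> UNIV"
    then have "range (dphi p) \<subset> skew_hermitian \<times> UNIV" using range_dphi_subset by blast
    moreover have "span (range (dphi p)) = range (dphi p)"
      using linear_subspace_image[OF linear_dphi subspace_UNIV] by (simp only: span_eq_iff)
    moreover have "span (skew_hermitian \<times> UNIV :: ('a cmat \<times> 'a cmat) set) = skew_hermitian \<times> UNIV"
      using subspace_Times[OF subspace_skew_hermitian subspace_UNIV] by (simp add: span_eq_iff)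
    ultimately obtain x :: "'a cmat \<times> 'a cmat" where "x \<noteq> 0" "x \<in> skew_hermitian \<times> UNIV"
      "\<And>y. y \<in> range (dphi p) \<Longrightarrow> orthogonal x y"
      using orthogonal_to_subspace_exists_gen[of "range (dphi p)" "skew_hermitian \<times> UNIV"] by metis
    then show "\<exists>S E. (S, E) \<noteq> 0 \<and> S \<in> skew_hermitian \<and> (\<forall>x. (S, E) \<bullet> dphi p x = 0)"
      by (intro exI[of _ "fst x"] exI[of _ "snd x"]) (auto simp: orthogonal_def)
  next
    assume "\<exists>S E. (S, E) \<noteq> 0 \<and> S \<in> skew_hermitian \<and> (\<forall>x. (S, E) \<bullet> dphi p x = 0)"
    then obtain S E where S: "(S, E) \<noteq> 0" "S \<in> skew_hermitian" "\<And>x. (S, E) \<bullet> dphi p x = 0" by blast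
    show "range (dphi p) \<noteq> skew_hermitian \<times> UNIV"
    proof
      assume "range (dphi p) = skew_hermitian \<times> UNIV"
      then have "(S, E) \<in> range (dphi p)" using S(2) by simp
      then obtain x where "(S, E) = dphi p x" by blast
      then show False using S(1) S(3)[of x] inner_eq_zero_iff by metis
    qed
  qed
  also have "\<dots> \<longleftrightarrow> (\<exists>w. w \<noteq> 0 \<and> cokernel_condition p w)"
  proof
    assume "\<exists>S E. (S, E) \<noteq> 0 \<and> S \<in> skew_hermitian \<and> (\<forall>x. (S, E) \<bullet> dphi p x = 0)"
    then obtain S E where S: "(S, E) \<noteq> 0" "S \<in> skew_hermitian" "\<And>x. (S, E) \<bullet> dphi p x = 0" by blast
    define H where "H = map_matrix (\<lambda>z. - \<i> * z) S"
    have SH: "S = ?i H" by (simp add: H_def vec_eq_iff)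
    have "?i 0 = 0" by (simp add: vec_eq_iff)
    then have "(H, E) \<noteq> 0" using S(1) SH by (auto simp: zero_prod_def)
    moreover have "cokernel_condition p (H, E)"
      using S(2,3) skew[of H] coker[of H E] unfolding SH by blast
    ultimately show "\<exists>w. w \<noteq> 0 \<and> cokernel_condition p w" by blast
  next
    assume "\<exists>w. w \<noteq> 0 \<and> cokernel_condition p w"
    then obtain H E where w: "(H, E) \<noteq> 0" "cokernel_condition p (H, E)" by (metis surj_pair)
    show "\<exists>S E. (S, E) \<noteq> 0 \<and> S \<in> skew_hermitian \<and> (\<forall>x. (S, E) \<bullet> dphi p x = 0)"
    proof (rule exI[of _ "?i H"], rule exI[of _ E], intro conjI)
      show "(?i H, E) \<noteq> 0" using w(1) by (auto simp: vec_eq_iff zero_prod_def)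
      show "?i H \<in> skew_hermitian" "\<forall>x. (?i H, E) \<bullet> dphi p x = 0" using skew[of H] coker[of H E] w(2) by blast+
    qed
  qed
  finally show ?thesis .
qed

lemma cokernel_condition_scaleR:
  "cokernel_condition p w \<Longrightarrow> cokernel_condition p (r *\<^sub>R w)"
  by (auto simp: cokernel_condition_def ctranspose_scaleR matrix_mult.scaleR_left matrix_mult.scaleR_right
      split: prod.splits)

theorem closed_critical_points: "closed (critical_points :: ('n::finite cmat \<times> 'n cmat) set)"
proof -
  define T where "T = {(w, p :: 'n cmat \<times> 'n cmat). cokernel_condition p w}"
  have "critical_points = {p :: 'n cmat \<times> 'n cmat. \<exists>w. w \<in> sphere 0 1 \<and> (w, p) \<in> T}"
  proof (intro Set.set_eqI iffI)
    fix p :: "'n cmat \<times> 'n cmat" assume "p \<in> critical_points"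
    then obtain w where "w \<noteq> 0" "cokernel_condition p w" unfolding critical_points_iff_cokernel by blast
    then show "p \<in> {p. \<exists>w. w \<in> sphere 0 1 \<and> (w, p) \<in> T}"
      by (intro CollectI exI[of _ "(1 / norm w) *\<^sub>R w"]) (auto simp: T_def intro: cokernel_condition_scaleR)
  qed (force simp: critical_points_iff_cokernel T_def)
  moreover have "closed T"
  proof -
    have "T = {z. ctranspose (fst (fst z)) = fst (fst z)} \<inter>
        {z. fst (snd z) ** fst (fst z) = - (ctranspose (snd (snd z)) ** snd (fst z))} \<inter>
        {z. fst (fst z) ** snd (snd z) = snd (fst z) ** ctranspose (fst (snd z))}"
      by (auto simp: T_def cokernel_condition_def)
    moreover have "closed \<dots>"
      by (intro closed_Int closed_Collect_eq continuous_intros matrix_mult.continuous_on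
          bounded_linear.continuous_on[OF bounded_linear_ctranspose])
    ultimately show ?thesis by simp
  qed
  then have "closed {p. \<exists>w. w \<in> sphere 0 1 \<and> (w, p) \<in> T}"
    by (rule closed_compact_projection[OF compact_sphere])
  ultimately show ?thesis by (simp only:)
qed

subsection \<open>Eigenvalues\<close>

lemma mat_mult_vector: "mat c *v v = c *s (v :: complex^'n::finite)"
  by (simp add: vec_eq_iff matrix_vector_mult_def mat_def if_distrib[of "\<lambda>z. z * _"] cong: if_cong)

lemma has_eigenvalue_iff_not_invertible: "has_eigenvalue M c \<longleftrightarrow> \<not> invertible (M - mat c)"
proof -
  have "(M - mat c) *v v = M *v v - c *s v" for v
    by (simp add: matrix_vector_mult_diff_rdistrib mat_mult_vector)
  then show ?thesis
    unfolding has_eigenvalue_def invertible_left_inverse matrix_left_invertible_ker by auto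
qed

lemma invertible_ctranspose: "invertible A \<Longrightarrow> invertible (ctranspose A)"
  unfolding invertible_def by (metis ctranspose_mat_1 ctranspose_mult)

lemma has_eigenvalue_ctranspose: "has_eigenvalue (ctranspose M) c \<longleftrightarrow> has_eigenvalue M (cnj c)"
proof -
  have "ctranspose (M - mat (cnj c)) = ctranspose M - mat c"
    by (simp add: vec_eq_iff mat_def)
  then have "invertible (ctranspose M - mat c) \<longleftrightarrow> invertible (M - mat (cnj c))"
    by (metis ctranspose_ctranspose invertible_ctranspose)
  then show ?thesis by (simp add: has_eigenvalue_iff_not_invertible)
qed

section \<open>Polynomials of a matrix applied to a vector\<close>

text \<open>The vector \<open>p(M) r\<close>, evaluated by Horner's scheme so that no matrix powers
  are needed.\<close>

definition poly_apply :: "'n::finite cmat \<Rightarrow> complex poly \<Rightarrow> complex^'n \<Rightarrow> complex^'n" where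
  "poly_apply M p r = fold_coeffs (\<lambda>a y. a *s r + M *v y) p 0"

lemma poly_apply_0 [simp]: "poly_apply M 0 r = 0"
  by (simp add: poly_apply_def)

lemma poly_apply_pCons [simp]: "poly_apply M (pCons a p) r = a *s r + M *v poly_apply M p r"
proof (cases "pCons a p = 0")
  case False
  then show ?thesis by (auto simp: poly_apply_def fold_coeffs_pCons_not_0_0_eq fold_coeffs_pCons_coeff_not_0_eq)
qed simp

lemma matrix_vector_mult_smult: "M *v (c *s x) = c *s (M *v x)" for M :: "'n::finite cmat"
  by (simp add: vec_eq_iff matrix_vector_mult_def sum_distrib_left ac_simps)

lemma poly_apply_add: "poly_apply M (p + q) r = poly_apply M p r + poly_apply M q r"
  by (induction p q rule: poly_induct2) (simp_all add: vec.scale_left_distrib matrix_vector_right_distrib ac_simps)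

lemma poly_apply_smult: "poly_apply M (smult c p) r = c *s poly_apply M p r"
  by (induction p) (simp_all add: vec.scale_right_distrib matrix_vector_mult_smult vec.scale_scale)

lemma poly_apply_linear_factor: "poly_apply M ([:- c, 1:] * q) r = M *v poly_apply M q r - c *s poly_apply M q r"
proof -
  have "[:- c, 1:] * q = pCons 0 q + smult (- c) q" by simp
  then show ?thesis by (simp only: poly_apply_add poly_apply_smult poly_apply_pCons) simp
qed

lemma poly_apply_intertwine:
  fixes M H N :: "'n::finite cmat"
  assumes "M ** H = H ** N"
  shows "poly_apply M p (H *v v) = H *v poly_apply N p v"
  by (induction p) (simp_all add: matrix_vector_right_distrib matrix_vector_mult_smult matrix_vector_mul_assoc assms)

text \<open>The \<open>n + 1\<close> vectors obtained from \<open>r\<close> by applying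
  \<open>M\<close> up to \<open>n\<close> times are linearly dependent.\<close>

lemma poly_apply_annihilator: "\<exists>p. p \<noteq> 0 \<and> poly_apply M p r = 0" for M :: "'n::finite cmat"
proof -
  define x where "x = (\<lambda>k. (\<lambda>v. M *v v) ^^ k)"
  have "\<exists>c. (\<exists>k\<in>{..CARD('n)}. c k \<noteq> 0) \<and> (\<forall>j\<in>UNIV. (\<Sum>k\<le>CARD('n). c k * x k r $ j) = 0)"
    by (rule homogeneous_system_nontrivial) auto
  then obtain c k0 where c: "k0 \<le> CARD('n)" "c k0 \<noteq> 0" "\<And>j. (\<Sum>k\<le>CARD('n). c k * x k r $ j) = 0" by auto
  define p where "p = (\<Sum>k\<le>CARD('n). monom (c k) k)"
  have monom: "poly_apply M (monom a k) r = a *s x k r" for a k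
    by (induction k) (simp_all add: monom_0 monom_Suc x_def matrix_vector_mult_smult)
  have "poly_apply M (\<Sum>k\<in>K. monom (c k) k) r = (\<Sum>k\<in>K. c k *s x k r)" for K
    by (induction K rule: infinite_finite_induct) (simp_all add: poly_apply_add monom)
  then have "poly_apply M p r = 0" using c(3) by (simp add: p_def vec_eq_iff)
  moreover have "coeff p k0 = c k0" using c(1) by (simp add: p_def coeff_sum)
  ultimately show ?thesis using c(2) by (intro exI[of _ p]) auto
qed

text \<open>Split off a linear factor of the annihilating polynomial: either the quotient still
  annihilates \<open>r\<close> and has smaller degree, or it sends \<open>r\<close> to an
  eigenvector. The form \<open>q(M) r\<close> is kept because, for \<open>r\<close> in the range of
  an intertwiner, the eigenvector then lies in that range too.\<close>

lemma poly_apply_eigenvector: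
  assumes "p \<noteq> 0" "poly_apply M p r = 0" "r \<noteq> 0"
  shows "\<exists>q c. poly_apply M q r \<noteq> 0 \<and> M *v poly_apply M q r = c *s poly_apply M q r"
  using assms(1,2)
proof (induction "degree p" arbitrary: p rule: less_induct)
  case less
  have "degree p \<noteq> 0"
  proof
    assume "degree p = 0"
    then obtain a where "p = [:a:]" by (rule degree_eq_zeroE)
    then show False using less.prems assms(3) by (simp add: vec.scale_eq_0_iff)
  qed
  then have "\<not> constant (poly p)" by (simp add: constant_degree)
  then obtain c where "poly p c = 0" using fundamental_theorem_of_algebra by blast
  then obtain q where q: "p = [:- c, 1:] * q" by (auto simp: poly_eq_0_iff_dvd dvd_def)
  then have "q \<noteq> 0" using less.prems by auto
  then have "degree q < degree p" unfolding q by (subst degree_mult_eq) auto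
  show ?case
  proof (cases "poly_apply M q r = 0")
    case True
    then show ?thesis using less.hyps \<open>degree q < degree p\<close> \<open>q \<noteq> 0\<close> by blast
  next
    case False
    then show ?thesis using less.prems(2) unfolding q poly_apply_linear_factor by auto
  qed
qed

text \<open>An eigenvector \<open>H w\<close> of \<open>M\<close> is taken in the range of \<open>H\<close>. If its eigenvalue \<open>c\<close> were not one of
  \<open>N\<close>, then \<open>N - c\<close> would map the kernel of \<open>H\<close> onto itself, and \<open>w\<close> would lie in that kernel.\<close>
lemma intertwined_common_eigenvalue:
  fixes M H N :: "'n::finite cmat"
  assumes "M ** H = H ** N" "H \<noteq> 0"
  shows "\<exists>c. has_eigenvalue M c \<and> has_eigenvalue N c"
proof -
  obtain v where v: "H *v v \<noteq> 0"
    using assms(2) matrix_eq[of H 0] by auto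
  obtain p where "p \<noteq> 0" "poly_apply M p (H *v v) = 0" using poly_apply_annihilator by blast
  from poly_apply_eigenvector[OF this v] obtain q c where
    q: "poly_apply M q (H *v v) \<noteq> 0" "M *v poly_apply M q (H *v v) = c *s poly_apply M q (H *v v)" by blast
  define w where "w = poly_apply N q v"
  have w: "H *v w \<noteq> 0" "M *v (H *v w) = c *s (H *v w)"
    using q by (simp_all add: w_def poly_apply_intertwine[OF assms(1)])
  have "has_eigenvalue M c" using w unfolding has_eigenvalue_def by blast
  moreover have "has_eigenvalue N c"
  proof (rule ccontr)
    assume neg: "\<not> has_eigenvalue N c"
    define f where "f = (\<lambda>x. (N - mat c) *v x)"
    have f: "f x = N *v x - c *s x" for x
      by (simp add: f_def matrix_vector_mult_diff_rdistrib mat_mult_vector)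
    have lin: "linear f" unfolding f_def by simp
    have inj: "inj f"
      using neg unfolding linear_injective_0[OF lin] has_eigenvalue_def f by auto
    define K where "K = {x. H *v x = 0}"
    have HN: "H *v (N *v x) = M *v (H *v x)" for x
      by (simp add: matrix_vector_mul_assoc assms(1))
    have subK: "subspace K" unfolding K_def
      using linear_subspace_kernel[of "\<lambda>x. H *v x"] by simp
    have fK: "f ` K \<subseteq> K"
      by (auto simp: K_def f matrix_vector_mult_diff_distrib matrix_vector_mult_smult HN)
    have "f ` K = K"
    proof (rule subspace_dim_equal[OF linear_subspace_image[OF lin subK] subK fK])
      show "dim (f ` K) \<ge> dim K"
        using dim_image_eq[OF lin, of K] inj inj_on_subset by fastforce
    qed
    moreover have "f w \<in> K"
      using w by (simp add: K_def f matrix_vector_mult_diff_distrib matrix_vector_mult_smult HN)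
    ultimately obtain k where "k \<in> K" "f w = f k" by blast
    then have "w \<in> K" using inj by (auto simp: inj_def)
    then show False using w(1) by (simp add: K_def)
  qed
  ultimately show ?thesis by blast
qed

section \<open>Eigenvalue pairs and the cokernel\<close>

text \<open>The rank-one matrix formed by the column \<open>u\<close> and the adjoint of
  \<open>v\<close>.\<close>

definition outer :: "complex^'n::finite \<Rightarrow> complex^'n \<Rightarrow> 'n cmat" where
  "outer u v = (\<chi> i j. u $ i * cnj (v $ j))"

lemma mult_outer_ctranspose: "M ** outer u v ** ctranspose N = outer (M *v u) (N *v v)"
  for M N :: "'n::finite cmat"
proof -
  have "(\<Sum>k\<in>UNIV. (\<Sum>l\<in>UNIV. M $ i $ l * (u $ l * cnj (v $ k))) * cnj (N $ j $ k)) =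
      (\<Sum>l\<in>UNIV. M $ i $ l * u $ l) * cnj (\<Sum>k\<in>UNIV. N $ j $ k * v $ k)" for i j
    by (simp add: sum_distrib_left sum_distrib_right ac_simps)
  then show ?thesis
    by (simp add: vec_eq_iff matrix_mult_nth outer_def matrix_vector_mult_def)
qed

text \<open>On the rank-one matrix of two eigenvectors, multiplication by \<open>M\<close> from the
  left and by its adjoint from the right acts as the scalar
  \<open>a * cnj (- 1 / cnj a) = - 1\<close>. A Hermitian solution is then extracted from its
  Hermitian or skew-Hermitian part. Stated for arbitrary \<open>B\<close>, since the parametrised
  family below lets \<open>B\<close> range over all matrices.\<close>

lemma critical_if_eigenvectors:
  fixes A B M :: "'n::finite cmat"
  assumes A: "A = ctranspose B ** M" and u: "u \<noteq> 0" "M *v u = a *s u"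
    and v: "v \<noteq> 0" "M *v v = (- 1 / cnj a) *s v" and a: "a \<noteq> 0"
  shows "(A, B) \<in> critical_points"
proof -
  define G where "G = outer u v"
  have G: "M ** G ** ctranspose M = - G"
    using a unfolding G_def mult_outer_ctranspose u v by (simp add: outer_def vec_eq_iff)
  then have G': "M ** ctranspose G ** ctranspose M = - ctranspose G"
    by (metis ctranspose_ctranspose ctranspose_minus ctranspose_mult matrix_mul_assoc)
  have crit: "(A, B) \<in> critical_points" if H: "H \<noteq> 0" "ctranspose H = H" "M ** H ** ctranspose M = - H" for H
  proof -
    \<comment> \<open>\<open>E = - (M ** H)\<close> solves the first cokernel equation, and the
      second becomes the equation for \<open>H\<close> multiplied by \<open>B\<close>.\<close>
    have "- (M ** H) ** ctranspose A = - (M ** H ** ctranspose M) ** B"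
      by (simp add: A ctranspose_mult matrix_mul_assoc matrix_mult.minus_left)
    then have "cokernel_condition (A, B) (H, - (M ** H))"
      using H by (simp add: cokernel_condition_def A matrix_mul_assoc matrix_mult.minus_right)
    then show ?thesis using H(1) unfolding critical_points_iff_cokernel
      by (intro exI[of _ "(H, - (M ** H))"]) (simp add: zero_prod_def)
  qed
  obtain i where i: "u $ i \<noteq> 0" using u(1) by (auto simp: vec_eq_iff)
  obtain j where j: "v $ j \<noteq> 0" using v(1) by (auto simp: vec_eq_iff)
  have ij: "G $ i $ j \<noteq> 0" using i j by (simp add: G_def outer_def)
  show ?thesis
  proof (cases "G + ctranspose G = 0")
    case False
    show ?thesis
      by (rule crit[OF False])
        (simp_all add: ctranspose_add add.commute matrix_mult.add_left matrix_mult.add_right G G')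
  next
    case True
    \<comment> \<open>In this case \<open>2 *\<^sub>R G\<close> is \<open>G - ctranspose G\<close>,
      so \<open>H\<close> is \<open>\<i>\<close> times that difference.\<close>
    define H where "H = map_matrix (\<lambda>z. \<i> * z) (2 *\<^sub>R G)"
    have cG: "ctranspose G = - G" using True by (simp add: add_eq_0_iff)
    then have "cnj (G $ l $ k) = - G $ k $ l" for k l by (metis ctranspose_nth vector_uminus_component)
    then have "ctranspose H = H" by (simp add: H_def vec_eq_iff)
    moreover have "H $ i $ j \<noteq> 0" using ij by (simp add: H_def)
    then have "H \<noteq> 0" by auto
    moreover have "M ** H ** ctranspose M = map_matrix (\<lambda>z. \<i> * z) (2 *\<^sub>R (M ** G ** ctranspose M))"
      by (simp add: H_def vec_eq_iff matrix_mult_nth sum_distrib_left sum_distrib_right ac_simps scaleR_sum_right)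
    then have "M ** H ** ctranspose M = - H" by (simp add: G H_def vec_eq_iff)
    ultimately show ?thesis using crit by blast
  qed
qed

text \<open>Eliminating \<open>E\<close> shows that \<open>H\<close> intertwines \<open>M\<close>
  with minus the inverse of its adjoint, and \<open>H\<close> cannot be zero since then
  \<open>E\<close> would vanish as well. A common eigenvalue \<open>c\<close> makes
  \<open>- 1 / c\<close> an eigenvalue of the adjoint, hence \<open>- 1 / cnj c\<close> one of
  \<open>M\<close>.\<close>

lemma eigenvectors_if_critical:
  fixes A B M :: "'n::finite cmat"
  assumes "(A, B) \<in> critical_points" "invertible B" "invertible M" and A: "A = ctranspose B ** M"
  shows "\<exists>a. a \<noteq> 0 \<and> has_eigenvalue M a \<and> has_eigenvalue M (- 1 / cnj a)"
proof -
  obtain H E where w: "(H, E) \<noteq> 0" and H: "ctranspose H = H"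
    and 1: "A ** H = - (ctranspose B ** E)" and 2: "H ** B = E ** ctranspose A"
    using assms(1) unfolding critical_points_iff_cokernel cokernel_condition_def by auto
  obtain B' where B': "B ** B' = mat 1" "B' ** B = mat 1" using assms(2) unfolding invertible_def by blast
  obtain M' where M': "M ** M' = mat 1" "M' ** M = mat 1" using assms(3) unfolding invertible_def by blast
  have cB: "ctranspose B' ** ctranspose B = mat 1" using B'(1) by (metis ctranspose_mat_1 ctranspose_mult)
  have cM: "ctranspose M ** ctranspose M' = mat 1" "ctranspose M' ** ctranspose M = mat 1"
    using M' by (metis ctranspose_mat_1 ctranspose_mult)+
  have "ctranspose B' ** (ctranspose B ** (M ** H)) = ctranspose B' ** (ctranspose B ** (- E))"
    using 1 by (simp add: A matrix_mul_assoc matrix_mult.minus_right)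
  then have E: "M ** H = - E" by (simp add: matrix_mul_assoc cB)
  have "H ** B ** B' = E ** ctranspose M ** B ** B'"
    using 2 by (simp add: A ctranspose_mult matrix_mul_assoc)
  then have 3: "H = E ** ctranspose M" by (simp add: B' flip: matrix_mul_assoc)
  have H0: "H \<noteq> 0"
  proof
    assume "H = 0"
    then have "E = 0" using E by simp
    then show False using w \<open>H = 0\<close> by (simp add: zero_prod_def)
  qed
  have "H ** ctranspose M' = E" by (subst 3) (simp add: cM flip: matrix_mul_assoc)
  then have "M ** H = H ** (- ctranspose M')" by (simp add: E matrix_mult.minus_right)
  from intertwined_common_eigenvalue[OF this H0] obtain c where
    c: "has_eigenvalue M c" "has_eigenvalue (- ctranspose M') c" by blast
  from c(2) obtain x where x: "x \<noteq> 0" "(- ctranspose M') *v x = c *s x" unfolding has_eigenvalue_def by blast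
  have "ctranspose M *v ((- ctranspose M') *v x) = - x"
    by (simp add: matrix_vector_mul_assoc matrix_mult.minus_right cM)
      (simp add: vec_eq_iff matrix_vector_mult_def mat_def sum_negf if_distrib[of "\<lambda>z. z * _"] cong: if_cong)
  then have mx: "c *s (ctranspose M *v x) = - x" by (simp add: x(2) matrix_vector_mult_smult)
  then have c0: "c \<noteq> 0" using x(1) by auto
  have "ctranspose M *v x = (- 1 / c) *s x"
    using arg_cong[OF mx, of "\<lambda>y. (1 / c) *s y"] c0 by (simp add: vec_eq_iff)
  then have "has_eigenvalue (ctranspose M) (- 1 / c)" using x(1) unfolding has_eigenvalue_def by blast
  then show ?thesis using c(1) c0 by (intro exI[of _ c]) (simp add: has_eigenvalue_ctranspose)
qed

theorem critical_iff_eigenvalues: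
  fixes A B :: "'n::finite cmat"
  assumes "invertible A" "invertible B"
  shows "(A, B) \<in> critical_points \<longleftrightarrow> (\<exists>l. l \<noteq> 0 \<and> has_eigenvalue (matrix_inv B ** ctranspose A) l \<and>
    has_eigenvalue (matrix_inv B ** ctranspose A) (- 1 / cnj l))"
proof -
  obtain B' where B': "B ** B' = mat 1" "B' ** B = mat 1" using assms(2) unfolding invertible_def by blast
  have "B ** matrix_inv B = mat 1"
    using someI[of "\<lambda>X. B ** X = mat 1 \<and> X ** B = mat 1" B'] B' by (simp add: matrix_inv_def)
  then have inv: "matrix_inv B = B'" by (metis B'(2) matrix_mul_assoc matrix_mul_lid matrix_mul_rid)
  have cB: "ctranspose B' ** ctranspose B = mat 1" "ctranspose B ** ctranspose B' = mat 1"
    using B' by (metis ctranspose_mat_1 ctranspose_mult)+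
  define M where "M = ctranspose B' ** A"
  have A: "A = ctranspose B ** M" by (simp add: M_def matrix_mul_assoc cB)
  have "invertible (ctranspose B')" using cB unfolding invertible_def by blast
  then have invM: "invertible M" unfolding M_def using assms(1) by (rule invertible_mult)
  \<comment> \<open>The adjoint of \<open>M\<close> is \<open>ctranspose A ** B'\<close>, which is
    conjugate to \<open>B' ** ctranspose A\<close> by \<open>B\<close>.\<close>
  have L: "has_eigenvalue (B' ** ctranspose A) l \<longleftrightarrow> has_eigenvalue M (cnj l)" for l
  proof -
    have "has_eigenvalue (B' ** ctranspose A) l \<longleftrightarrow> has_eigenvalue (ctranspose M) l"
    proof
      assume "has_eigenvalue (B' ** ctranspose A) l"
      then obtain x where x: "x \<noteq> 0" "B' ** ctranspose A *v x = l *s x" unfolding has_eigenvalue_def by blast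
      have "ctranspose M *v (B *v x) = B *v (B' ** ctranspose A *v x)"
        by (simp add: M_def ctranspose_mult matrix_vector_mul_assoc matrix_mul_assoc B')
          (simp add: B' flip: matrix_mul_assoc)
      also have "\<dots> = l *s (B *v x)" by (simp add: x matrix_vector_mult_smult)
      finally have "ctranspose M *v (B *v x) = l *s (B *v x)" .
      moreover have "B' *v (B *v x) = x" by (simp add: matrix_vector_mul_assoc B')
      then have "B *v x \<noteq> 0" using x(1) by auto
      ultimately show "has_eigenvalue (ctranspose M) l" unfolding has_eigenvalue_def by blast
    next
      assume "has_eigenvalue (ctranspose M) l"
      then obtain x where x: "x \<noteq> 0" "ctranspose M *v x = l *s x" unfolding has_eigenvalue_def by blast
      have "(B' ** ctranspose A) *v (B' *v x) = B' *v (ctranspose M *v x)"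
        by (simp add: M_def ctranspose_mult matrix_vector_mul_assoc matrix_mul_assoc)
      also have "\<dots> = l *s (B' *v x)" by (simp add: x matrix_vector_mult_smult)
      finally have "(B' ** ctranspose A) *v (B' *v x) = l *s (B' *v x)" .
      moreover have "B *v (B' *v x) = x" by (simp add: matrix_vector_mul_assoc B')
      then have "B' *v x \<noteq> 0" using x(1) by auto
      ultimately show "has_eigenvalue (B' ** ctranspose A) l" unfolding has_eigenvalue_def by blast
    qed
    then show ?thesis by (simp add: has_eigenvalue_ctranspose)
  qed
  have "(A, B) \<in> critical_points \<longleftrightarrow> (\<exists>a. a \<noteq> 0 \<and> has_eigenvalue M a \<and> has_eigenvalue M (- 1 / cnj a))"
  proof
    assume "\<exists>a. a \<noteq> 0 \<and> has_eigenvalue M a \<and> has_eigenvalue M (- 1 / cnj a)"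
    then show "(A, B) \<in> critical_points" using critical_if_eigenvectors[OF A] unfolding has_eigenvalue_def by blast
  qed (rule eigenvectors_if_critical[OF _ assms(2) invM A])
  \<comment> \<open>Substituting \<open>l = cnj a\<close> conjugates both members of the
    pair.\<close>
  also have "\<dots> \<longleftrightarrow> (\<exists>l. l \<noteq> 0 \<and> has_eigenvalue M (cnj l) \<and> has_eigenvalue M (cnj (- 1 / cnj l)))"
  proof
    assume "\<exists>a. a \<noteq> 0 \<and> has_eigenvalue M a \<and> has_eigenvalue M (- 1 / cnj a)"
    then obtain a where "a \<noteq> 0 \<and> has_eigenvalue M a \<and> has_eigenvalue M (- 1 / cnj a)" ..
    then show "\<exists>l. l \<noteq> 0 \<and> has_eigenvalue M (cnj l) \<and> has_eigenvalue M (cnj (- 1 / cnj l))"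
      by (intro exI[of _ "cnj a"]) simp
  next
    assume "\<exists>l. l \<noteq> 0 \<and> has_eigenvalue M (cnj l) \<and> has_eigenvalue M (cnj (- 1 / cnj l))"
    then obtain l where "l \<noteq> 0 \<and> has_eigenvalue M (cnj l) \<and> has_eigenvalue M (cnj (- 1 / cnj l))" ..
    then show "\<exists>a. a \<noteq> 0 \<and> has_eigenvalue M a \<and> has_eigenvalue M (- 1 / cnj a)"
      by (intro exI[of _ "cnj l"]) simp
  qed
  finally show ?thesis unfolding inv L .
qed

subsection \<open>Charts of the critical set\<close>

text \<open>The doubling that turns a count of complex parameters into a count of real ones.\<close>

definition conj_closure :: "('p \<Rightarrow> complex) set \<Rightarrow> ('p \<Rightarrow> complex) set" where
  "conj_closure X = X \<union> (\<lambda>x p. cnj (x p)) ` X"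

lemma finite_conj_closure: "finite X \<Longrightarrow> finite (conj_closure X)"
  by (simp add: conj_closure_def)

lemma card_conj_closure: "finite X \<Longrightarrow> card (conj_closure X) \<le> 2 * card X"
  unfolding conj_closure_def
  using card_Un_le[of X "(\<lambda>x p. cnj (x p)) ` X"] card_image_le[of X "\<lambda>x p. cnj (x p)"] by linarith

lemma rat_on_conj_closure_cnj:
  "rat_on (conj_closure X) U f \<Longrightarrow> finite X \<Longrightarrow> rat_on (conj_closure X) U (\<lambda>p. cnj (f p))"
  by (rule rat_on_cnj[OF _ finite_conj_closure]) (auto simp: conj_closure_def image_image)

lemma rat_on_conj_closure_coord:
  "x \<in> X \<Longrightarrow> finite X \<Longrightarrow> rat_on (conj_closure X) U x"
  by (rule rat_on_coord[OF finite_conj_closure]) (auto simp: conj_closure_def)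

lemma Basis_cmat: "b \<in> Basis \<longleftrightarrow> (\<exists>i j. b = axis i (axis j 1) \<or> b = axis i (axis j \<i>))"
  for b :: "'n::finite cmat"
  by (auto simp: Basis_vec_def Basis_complex_def)

text \<open>Points of an incidence variety: a pair \<open>(A, B)\<close> with vectors and a scalar
  as witnesses. For fixed witnesses, singularity and the eigenvalue conditions become linear
  equations on columns, so no determinants or characteristic polynomials are needed.\<close>

type_synonym 'n pencil = "('n cmat \<times> 'n cmat) \<times> ((complex^'n) \<times> (complex^'n) \<times> complex)"

definition coordA :: "'n \<Rightarrow> 'n \<Rightarrow> 'n::finite pencil \<Rightarrow> complex" where "coordA i j p = fst (fst p) $ i $ j"
definition coordB :: "'n \<Rightarrow> 'n \<Rightarrow> 'n::finite pencil \<Rightarrow> complex" where "coordB i j p = snd (fst p) $ i $ j"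
definition coordu :: "'n \<Rightarrow> 'n::finite pencil \<Rightarrow> complex" where "coordu i p = fst (snd p) $ i"
definition coordv :: "'n \<Rightarrow> 'n::finite pencil \<Rightarrow> complex" where "coordv i p = fst (snd (snd p)) $ i"
definition scalar :: "'n::finite pencil \<Rightarrow> complex" where "scalar p = snd (snd (snd p))"

text \<open>Real and imaginary parts are combinations of a coordinate and its conjugate; here
  closure under conjugation is used.\<close>

lemma rat_on_Basis:
  fixes U :: "'n::finite pencil set"
  assumes "finite X" "\<And>i j. rat_on (conj_closure X) U (coordA i j)" "\<And>i j. rat_on (conj_closure X) U (coordB i j)"
    and "b \<in> Basis"
  shows "rat_on (conj_closure X) U (\<lambda>p. complex_of_real (fst p \<bullet> b))"
proof -
  have Re: "rat_on (conj_closure X) U (\<lambda>p. complex_of_real (f p \<bullet> 1))"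
    and Im: "rat_on (conj_closure X) U (\<lambda>p. complex_of_real (f p \<bullet> \<i>))"
    if "rat_on (conj_closure X) U f" for f
  proof -
    note c = rat_on_conj_closure_cnj[OF that assms(1)]
    have eq: "complex_of_real (f p \<bullet> 1) = (1 / 2) * (f p + cnj (f p))"
      "complex_of_real (f p \<bullet> \<i>) = (- \<i> / 2) * (f p - cnj (f p))" for p
      by (simp_all add: inner_complex_def complex_eq_iff)
    show "rat_on (conj_closure X) U (\<lambda>p. complex_of_real (f p \<bullet> 1))" unfolding eq
      by (intro rat_on_mult rat_on_const rat_on_add that c)
    show "rat_on (conj_closure X) U (\<lambda>p. complex_of_real (f p \<bullet> \<i>))" unfolding eq
      by (intro rat_on_mult rat_on_const rat_on_diff that c)
  qed
  from assms(4) consider i j where "b = (axis i (axis j 1), 0)" | i j where "b = (axis i (axis j \<i>), 0)"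
    | i j where "b = (0, axis i (axis j 1))" | i j where "b = (0, axis i (axis j \<i>))"
    by (auto simp: Basis_prod_def Basis_cmat)
  then show ?thesis
  proof cases
    case (1 i j) then show ?thesis using Re[OF assms(2)[of i j]]
      by (simp add: inner_prod_def inner_axis coordA_def)
  next
    case (2 i j) then show ?thesis using Im[OF assms(2)[of i j]]
      by (simp add: inner_prod_def inner_axis coordA_def)
  next
    case (3 i j) then show ?thesis using Re[OF assms(3)[of i j]]
      by (simp add: inner_prod_def inner_axis coordB_def)
  next
    case (4 i j) then show ?thesis using Im[OF assms(3)[of i j]]
      by (simp add: inner_prod_def inner_axis coordB_def)
  qed
qed

text \<open>The conditions on \<open>u\<close> and \<open>v\<close> are solved for the column \<open>k\<close> of \<open>A\<close> or \<open>B\<close>, respectively for the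
  columns \<open>k\<close> and \<open>l\<close> of \<open>A\<close>: these are rational in the other coordinates.\<close>
definition chartA :: "'n::finite \<Rightarrow> 'n pencil set" where
  "chartA k = {((A, B), (u, v, a)). A *v u = 0 \<and> u $ k = 1}"
definition chartB :: "'n::finite \<Rightarrow> 'n pencil set" where
  "chartB k = {((A, B), (u, v, a)). B *v u = 0 \<and> u $ k = 1}"
definition chartE :: "'n::finite \<Rightarrow> 'n \<Rightarrow> 'n pencil set" where
  "chartE k l = {((A, B), (u, v, a)). A *v u = a *s (ctranspose B *v u) \<and>
     A *v v = (- 1 / cnj a) *s (ctranspose B *v v) \<and> a \<noteq> 0 \<and> u $ k = 1 \<and> v $ l = 1 \<and> 1 - u $ l * v $ k \<noteq> 0}"

definition coordsA :: "'n::finite \<Rightarrow> ('n pencil \<Rightarrow> complex) set" where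
  "coordsA k = (\<lambda>(i, j). coordB i j) ` UNIV \<union> (\<lambda>(i, j). coordA i j) ` (UNIV \<times> - {k}) \<union> coordu ` (- {k})"
definition coordsB :: "'n::finite \<Rightarrow> ('n pencil \<Rightarrow> complex) set" where
  "coordsB k = (\<lambda>(i, j). coordA i j) ` UNIV \<union> (\<lambda>(i, j). coordB i j) ` (UNIV \<times> - {k}) \<union> coordu ` (- {k})"
definition coordsE :: "'n::finite \<Rightarrow> 'n \<Rightarrow> ('n pencil \<Rightarrow> complex) set" where
  "coordsE k l = (\<lambda>(i, j). coordB i j) ` UNIV \<union> (\<lambda>(i, j). coordA i j) ` (UNIV \<times> - {k, l}) \<union>
     coordu ` (- {k}) \<union> coordv ` (- {l}) \<union> {scalar}"

lemma finite_coords: "finite (coordsA k)" "finite (coordsB k)" "finite (coordsE k l)"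
  by (auto simp: coordsA_def coordsB_def coordsE_def)

text \<open>Solving for one column removes \<open>n\<close> coordinates, and the kernel vector
  normalised at \<open>k\<close> brings back \<open>n - 1\<close>.\<close>

lemma card_coordsA:
  "card (coordsA (k :: 'n::finite)) \<le> 2 * CARD('n) * CARD('n) - 1"
  "card (coordsB (k :: 'n::finite)) \<le> 2 * CARD('n) * CARD('n) - 1"
proof -
  let ?n = "CARD('n)"
  have c: "card (- {k}) = ?n - 1" by (simp add: Compl_eq_Diff_UNIV card_Diff_subset)
  have pos: "?n > 0" by (simp add: card_gt_0_iff)
  have "card (f ` (UNIV :: ('n \<times> 'n) set) \<union> g ` ((UNIV :: 'n set) \<times> - {k}) \<union> h ` (- {k})) \<le> ?n * ?n + ?n * (?n - 1) + (?n - 1)"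
    for f g :: "'n \<times> 'n \<Rightarrow> 'n pencil \<Rightarrow> complex" and h
  proof -
    have "card (f ` (UNIV :: ('n \<times> 'n) set)) \<le> ?n * ?n"
      using card_image_le[of "UNIV :: ('n \<times> 'n) set" f] by simp
    moreover have "card (g ` ((UNIV :: 'n set) \<times> - {k})) \<le> ?n * (?n - 1)"
      using card_image_le[of "(UNIV :: 'n set) \<times> - {k}" g] by (simp add: c)
    moreover have "card (h ` (- {k})) \<le> ?n - 1" using card_image_le[of "- {k}" h] by (simp add: c)
    ultimately show ?thesis
      using card_Un_le[of "f ` (UNIV :: ('n \<times> 'n) set) \<union> g ` ((UNIV :: 'n set) \<times> - {k})" "h ` (- {k})"]
        card_Un_le[of "f ` (UNIV :: ('n \<times> 'n) set)" "g ` ((UNIV :: 'n set) \<times> - {k})"] by linarith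
  qed
  moreover have "?n * ?n + ?n * (?n - 1) + (?n - 1) = 2 * ?n * ?n - 1"
    using pos by (cases "?n") (auto simp: algebra_simps)
  ultimately show "card (coordsA k) \<le> 2 * ?n * ?n - 1" "card (coordsB k) \<le> 2 * ?n * ?n - 1"
    unfolding coordsA_def coordsB_def by metis+
qed

text \<open>Two solved columns remove \<open>2 n\<close> coordinates, the two normalised
  eigenvectors bring back \<open>2 (n - 1)\<close> and the eigenvalue one more: a net loss of one,
  as for singular matrices.\<close>

lemma card_coordsE:
  assumes "k \<noteq> l"
  shows "card (coordsE (k :: 'n::finite) l) \<le> 2 * CARD('n) * CARD('n) - 1"
proof -
  let ?n = "CARD('n)"
  have c: "card (- {k}) = ?n - 1" "card (- {l}) = ?n - 1" "card (- {k, l}) = ?n - 2"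
    using assms by (simp_all add: Compl_eq_Diff_UNIV card_Diff_subset)
  have "card {k, l} \<le> ?n" by (intro card_mono) auto
  then have n2: "?n \<ge> 2" using assms by simp
  let ?S1 = "(\<lambda>(i, j). coordB i j) ` (UNIV :: ('n \<times> 'n) set)"
  let ?S2 = "(\<lambda>(i, j). coordA i j) ` ((UNIV :: 'n set) \<times> - {k, l})"
  have "card ?S1 \<le> ?n * ?n"
    using card_image_le[of "UNIV :: ('n \<times> 'n) set" "\<lambda>(i, j). coordB i j"] by simp
  moreover have "card ?S2 \<le> ?n * (?n - 2)"
    using card_image_le[of "(UNIV :: 'n set) \<times> - {k, l}" "\<lambda>(i, j). coordA i j"] by (simp add: c)
  moreover have "card (coordu ` (- {k})) \<le> ?n - 1" using card_image_le[of "- {k}" coordu] by (simp add: c)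
  moreover have "card (coordv ` (- {l})) \<le> ?n - 1" using card_image_le[of "- {l}" coordv] by (simp add: c)
  moreover have "card (coordsE k l) \<le> card ?S1 + card ?S2 + card (coordu ` (- {k})) + card (coordv ` (- {l})) + 1"
    unfolding coordsE_def
    using card_Un_le[of "?S1 \<union> ?S2 \<union> coordu ` (- {k}) \<union> coordv ` (- {l})" "{scalar}"]
      card_Un_le[of "?S1 \<union> ?S2 \<union> coordu ` (- {k})" "coordv ` (- {l})"]
      card_Un_le[of "?S1 \<union> ?S2" "coordu ` (- {k})"] card_Un_le[of ?S1 ?S2] by simp
  moreover have "?n * ?n + ?n * (?n - 2) + (?n - 1) + (?n - 1) + 1 = 2 * ?n * ?n - 1"
  proof -
    obtain m where "?n = m + 2" using n2 by (metis le_add_diff_inverse2)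
    then show ?thesis by (simp add: algebra_simps)
  qed
  ultimately show ?thesis by linarith
qed

lemma matrix_vector_nth_remove:
  "(A *v u) $ i = A $ i $ k * u $ k + (\<Sum>j\<in>- {k}. A $ i $ j * u $ j)" for A :: "'n::finite cmat"
  by (simp add: matrix_vector_mult_def sum.remove[of UNIV k] Compl_eq_Diff_UNIV)

lemma rat_on_chartA:
  "rat_on (conj_closure (coordsA k)) (chartA k) (coordA i j)" "rat_on (conj_closure (coordsA k)) (chartA k) (coordB i j)"
proof -
  note coord = rat_on_conj_closure_coord[OF _ finite_coords(1)[of k]]
  show "rat_on (conj_closure (coordsA k)) (chartA k) (coordB i j)"
    by (rule coord) (auto simp: coordsA_def)
  have A: "rat_on (conj_closure (coordsA k)) (chartA k) (coordA i j)" if "j \<noteq> k" for j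
    by (rule coord) (use that in \<open>auto simp: coordsA_def\<close>)
  have u: "rat_on (conj_closure (coordsA k)) (chartA k) (coordu j)" if "j \<noteq> k" for j
    by (rule coord) (use that in \<open>auto simp: coordsA_def\<close>)
  have "rat_on (conj_closure (coordsA k)) (chartA k) (\<lambda>p. 0 - (\<Sum>j\<in>- {k}. coordA i j p * coordu j p))"
    by (intro rat_on_diff rat_on_const rat_on_sum rat_on_mult A u) auto
  then have "rat_on (conj_closure (coordsA k)) (chartA k) (coordA i k)"
  proof (rule rat_on_cong)
    fix p assume "p \<in> chartA k"
    then obtain A B u v a where p: "p = ((A, B), (u, v, a))" "A *v u = 0" "u $ k = 1"
      by (auto simp: chartA_def)
    show "0 - (\<Sum>j\<in>- {k}. coordA i j p * coordu j p) = coordA i k p"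
      using arg_cong[OF p(2), of "\<lambda>x. x $ i"] unfolding matrix_vector_nth_remove[of A u i k]
      by (simp add: p(1,3) coordA_def coordu_def add_eq_0_iff)
  qed
  then show "rat_on (conj_closure (coordsA k)) (chartA k) (coordA i j)" using A by (cases "j = k") auto
qed

lemma rat_on_chartB:
  "rat_on (conj_closure (coordsB k)) (chartB k) (coordA i j)" "rat_on (conj_closure (coordsB k)) (chartB k) (coordB i j)"
proof -
  note coord = rat_on_conj_closure_coord[OF _ finite_coords(2)[of k]]
  show "rat_on (conj_closure (coordsB k)) (chartB k) (coordA i j)"
    by (rule coord) (auto simp: coordsB_def)
  have B: "rat_on (conj_closure (coordsB k)) (chartB k) (coordB i j)" if "j \<noteq> k" for j
    by (rule coord) (use that in \<open>auto simp: coordsB_def\<close>)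
  have u: "rat_on (conj_closure (coordsB k)) (chartB k) (coordu j)" if "j \<noteq> k" for j
    by (rule coord) (use that in \<open>auto simp: coordsB_def\<close>)
  have "rat_on (conj_closure (coordsB k)) (chartB k) (\<lambda>p. 0 - (\<Sum>j\<in>- {k}. coordB i j p * coordu j p))"
    by (intro rat_on_diff rat_on_const rat_on_sum rat_on_mult B u) auto
  then have "rat_on (conj_closure (coordsB k)) (chartB k) (coordB i k)"
  proof (rule rat_on_cong)
    fix p assume "p \<in> chartB k"
    then obtain A B u v a where p: "p = ((A, B), (u, v, a))" "B *v u = 0" "u $ k = 1"
      by (auto simp: chartB_def)
    show "0 - (\<Sum>j\<in>- {k}. coordB i j p * coordu j p) = coordB i k p"
      using arg_cong[OF p(2), of "\<lambda>x. x $ i"] unfolding matrix_vector_nth_remove[of B u i k]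
      by (simp add: p(1,3) coordB_def coordu_def add_eq_0_iff)
  qed
  then show "rat_on (conj_closure (coordsB k)) (chartB k) (coordB i j)" using B by (cases "j = k") auto
qed

lemma rat_on_chartE:
  assumes "k \<noteq> l"
  shows "rat_on (conj_closure (coordsE k l)) (chartE k l) (coordA i j)"
    "rat_on (conj_closure (coordsE k l)) (chartE k l) (coordB i j)"
proof -
  let ?R = "rat_on (conj_closure (coordsE k l)) (chartE k l)"
  note coord = rat_on_conj_closure_coord[OF _ finite_coords(3)[of k l]]
  note cnj = rat_on_conj_closure_cnj[OF _ finite_coords(3)[of k l]]
  have B: "?R (coordB i j)" for i j by (rule coord) (auto simp: coordsE_def)
  then show "?R (coordB i j)" .
  have A: "?R (coordA i j)" if "j \<noteq> k" "j \<noteq> l" for j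
    by (rule coord) (use that in \<open>auto simp: coordsE_def\<close>)
  have u: "?R (coordu j)" for j
  proof (cases "j = k")
    case True
    show ?thesis by (rule rat_on_cong[OF rat_on_const[of _ _ 1]]) (auto simp: chartE_def coordu_def True)
  next
    case False
    then show ?thesis by (intro coord) (auto simp: coordsE_def)
  qed
  have v: "?R (coordv j)" for j
  proof (cases "j = l")
    case True
    show ?thesis by (rule rat_on_cong[OF rat_on_const[of _ _ 1]]) (auto simp: chartE_def coordv_def True)
  next
    case False
    then show ?thesis by (intro coord) (auto simp: coordsE_def)
  qed
  have s: "?R scalar" by (rule coord) (auto simp: coordsE_def)
  \<comment> \<open>Row \<open>i\<close> of the two vector equations is a linear system for the
    entries of \<open>A\<close> at \<open>(i, k)\<close> and \<open>(i, l)\<close>, with matrix rows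
    \<open>(1, u $ l)\<close> and \<open>(v $ k, 1)\<close>, right-hand sides \<open>w1\<close> and
    \<open>w2\<close> and determinant \<open>D\<close>. Cramer's rule solves it.\<close>
  define w1 where "w1 = (\<lambda>p. scalar p * (\<Sum>j\<in>UNIV. cnj (coordB j i p) * coordu j p) - (\<Sum>j\<in>- {k, l}. coordA i j p * coordu j p))"
  define w2 where "w2 = (\<lambda>p. (- 1 / cnj (scalar p)) * (\<Sum>j\<in>UNIV. cnj (coordB j i p) * coordv j p) - (\<Sum>j\<in>- {k, l}. coordA i j p * coordv j p))"
  define D where "D = (\<lambda>p. 1 - coordu l p * coordv k p)"
  have w1: "?R w1" unfolding w1_def by (intro rat_on_diff rat_on_mult rat_on_sum s u cnj[OF B] A) auto
  have "cnj (scalar p) \<noteq> 0" if "p \<in> chartE k l" for p using that by (auto simp: chartE_def scalar_def)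
  then have w2: "?R w2" unfolding w2_def
    by (intro rat_on_diff rat_on_mult rat_on_sum rat_on_divide rat_on_const cnj[OF s] v cnj[OF B] A) auto
  have D: "?R D" unfolding D_def by (intro rat_on_diff rat_on_const rat_on_mult u v)
  have D0: "D p \<noteq> 0" if "p \<in> chartE k l" for p using that by (auto simp: chartE_def D_def coordu_def coordv_def)
  have eqs: "coordA i k p = (w1 p - coordu l p * w2 p) / D p \<and> coordA i l p = (w2 p - coordv k p * w1 p) / D p"
    if "p \<in> chartE k l" for p
  proof -
    from that obtain A B u v a where p: "p = ((A, B), (u, v, a))" "A *v u = a *s (ctranspose B *v u)"
      "A *v v = (- 1 / cnj a) *s (ctranspose B *v v)" "u $ k = 1" "v $ l = 1"
      by (auto simp: chartE_def)
    have split: "(A *v x) $ i = A $ i $ k * x $ k + A $ i $ l * x $ l + (\<Sum>j\<in>- {k, l}. A $ i $ j * x $ j)" for x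
    proof -
      have "- {k} = insert l (- {k, l})" using assms by auto
      then show ?thesis unfolding matrix_vector_nth_remove[of A x i k] by simp
    qed
    have 1: "A $ i $ k + A $ i $ l * u $ l = w1 p"
      using arg_cong[OF p(2), of "\<lambda>x. x $ i"] unfolding split
      by (simp add: w1_def p(1,4) coordA_def coordB_def coordu_def scalar_def matrix_vector_mult_def algebra_simps)
    have 2: "A $ i $ k * v $ k + A $ i $ l = w2 p"
      using arg_cong[OF p(3), of "\<lambda>x. x $ i"] unfolding split
      by (simp add: w2_def p(1,5) coordA_def coordB_def coordv_def scalar_def matrix_vector_mult_def algebra_simps)
    have "A $ i $ k * (1 - u $ l * v $ k) = w1 p - u $ l * w2 p"
      "A $ i $ l * (1 - u $ l * v $ k) = w2 p - v $ k * w1 p"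
      unfolding 1[symmetric] 2[symmetric] by (simp_all add: algebra_simps)
    then show ?thesis using D0[OF that]
      by (simp add: p(1) D_def coordA_def coordu_def coordv_def eq_divide_eq)
  qed
  have "?R (coordA i k)"
    by (rule rat_on_cong[of _ _ "\<lambda>p. (w1 p - coordu l p * w2 p) / D p"])
      (use eqs D0 in \<open>auto intro!: rat_on_divide rat_on_diff rat_on_mult w1 w2 D u\<close>)
  moreover have "?R (coordA i l)"
    by (rule rat_on_cong[of _ _ "\<lambda>p. (w2 p - coordv k p * w1 p) / D p"])
      (use eqs D0 in \<open>auto intro!: rat_on_divide rat_on_diff rat_on_mult w1 w2 D v\<close>)
  ultimately show "?R (coordA i j)" using A by (cases "j = k \<or> j = l") auto
qed

lemma kernel_normalised:
  fixes A :: "'n::finite cmat"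
  assumes "\<not> invertible A"
  shows "\<exists>u k. A *v u = 0 \<and> u $ k = 1"
proof -
  obtain x where x: "x \<noteq> 0" "A *v x = 0"
    using assms unfolding invertible_left_inverse matrix_left_invertible_ker by auto
  then obtain k where "x $ k \<noteq> 0" by (auto simp: vec_eq_iff)
  then show ?thesis using x
    by (intro exI[of _ "(1 / x $ k) *s x"] exI[of _ k]) (simp add: matrix_vector_mult_smult)
qed

text \<open>Eigenvectors for distinct eigenvalues are independent, so some 2 by 2 minor of the pair
  is nonzero. After scaling, the last condition is this minor divided by
  \<open>u $ k * v $ l\<close>.\<close>

lemma eigenvectors_normalised:
  fixes M :: "'n::finite cmat"
  assumes "has_eigenvalue M a" "has_eigenvalue M b" "a \<noteq> b"
  shows "\<exists>u v k l. k \<noteq> l \<and> ((M *v u = a *s u \<and> M *v v = b *s v) \<and> u $ k = 1 \<and> v $ l = 1 \<and> 1 - u $ l * v $ k \<noteq> 0)"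
proof -
  obtain u v where u: "u \<noteq> 0" "M *v u = a *s u" and v: "v \<noteq> 0" "M *v v = b *s v"
    using assms unfolding has_eigenvalue_def by blast
  have "\<exists>k l. u $ k * v $ l - u $ l * v $ k \<noteq> 0"
  proof (rule ccontr)
    assume "\<not> ?thesis"
    then have par: "u $ k * v $ l = u $ l * v $ k" for k l by simp
    obtain k where k: "u $ k \<noteq> 0" using u(1) by (auto simp: vec_eq_iff)
    have "u $ k *s v = v $ k *s u" using par[of k] by (simp add: vec_eq_iff mult.commute)
    then have "M *v (u $ k *s v) = M *v (v $ k *s u)" by simp
    then have "b *s (u $ k *s v) = a *s (v $ k *s u)"
      by (simp add: matrix_vector_mult_smult u v vec.scale_scale mult.commute)
    then have "b *s (u $ k *s v) = a *s (u $ k *s v)" using \<open>u $ k *s v = v $ k *s u\<close> by simp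
    then show False using assms(3) k v(1) by (simp add: vec.scale_scale vec.scale_cancel_right)
  qed
  then obtain k l where kl: "u $ k * v $ l - u $ l * v $ k \<noteq> 0" by blast
  \<comment> \<open>One of the two products in the minor is nonzero; exchanging \<open>k\<close> and
    \<open>l\<close> makes it the first.\<close>
  then have "\<exists>k l. u $ k * v $ l - u $ l * v $ k \<noteq> 0 \<and> u $ k \<noteq> 0 \<and> v $ l \<noteq> 0"
    by (cases "u $ k * v $ l = 0") (rule exI[of _ l], rule exI[of _ k], force, rule exI[of _ k], rule exI[of _ l], force)
  then obtain k l where kl: "u $ k * v $ l - u $ l * v $ k \<noteq> 0" "u $ k \<noteq> 0" "v $ l \<noteq> 0" by blast
  have "k \<noteq> l" using kl(1) by (auto simp: mult.commute)
  then show ?thesis using kl u v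
    by (intro exI[of _ "(1 / u $ k) *s u"] exI[of _ "(1 / v $ l) *s v"] exI[of _ k] exI[of _ l])
      (auto simp: matrix_vector_mult_smult vec.scale_scale mult.commute field_simps)
qed

lemma critical_points_covered:
  "(critical_points :: ('n::finite cmat \<times> 'n cmat) set) \<subseteq>
    (\<Union>k. fst ` chartA k) \<union> (\<Union>k. fst ` chartB k) \<union> (\<Union>k. \<Union>l\<in>- {k}. fst ` chartE k l)"
proof
  fix p :: "'n cmat \<times> 'n cmat"
  assume p: "p \<in> critical_points"
  obtain A B where AB: "p = (A, B)" by (cases p)
  show "p \<in> (\<Union>k. fst ` chartA k) \<union> (\<Union>k. fst ` chartB k) \<union> (\<Union>k. \<Union>l\<in>- {k}. fst ` chartE k l)"
  proof (cases "invertible A \<and> invertible B")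
    case False
    then consider "\<not> invertible A" | "\<not> invertible B" by blast
    then show ?thesis
    proof cases
      case 1
      then obtain u k where "A *v u = 0" "u $ k = 1" using kernel_normalised by blast
      then have "((A, B), (u, 0, 0)) \<in> chartA k" by (simp add: chartA_def)
      then have "p \<in> fst ` chartA k" unfolding AB by (rule image_eqI[rotated]) simp
      then show ?thesis by blast
    next
      case 2
      then obtain u k where "B *v u = 0" "u $ k = 1" using kernel_normalised by blast
      then have "((A, B), (u, 0, 0)) \<in> chartB k" by (simp add: chartB_def)
      then have "p \<in> fst ` chartB k" unfolding AB by (rule image_eqI[rotated]) simp
      then show ?thesis by blast
    qed
  next
    case True
    obtain C where C: "ctranspose B ** C = mat 1" "C ** ctranspose B = mat 1"
      using invertible_ctranspose True unfolding invertible_def by blast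
    define M where "M = C ** A"
    have A: "A = ctranspose B ** M" by (simp add: M_def matrix_mul_assoc C)
    have "invertible C" using C unfolding invertible_def by blast
    then have "invertible M" unfolding M_def using True by (simp add: invertible_mult)
    then obtain a where a: "a \<noteq> 0" "has_eigenvalue M a" "has_eigenvalue M (- 1 / cnj a)"
      using eigenvectors_if_critical[of A B M] p True A by (auto simp: AB)
    \<comment> \<open>Equality would give \<open>a * cnj a = - 1\<close>; hence the two eigenvalues
      are always distinct.\<close>
    have "a \<noteq> - 1 / cnj a"
    proof
      assume "a = - 1 / cnj a"
      then have "a * cnj a = - 1" using a(1) by (simp add: field_simps)
      then have "Re a * Re a + Im a * Im a = - 1" by (simp add: complex_eq_iff)
      then show False using zero_le_square[of "Re a"] zero_le_square[of "Im a"] by linarith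
    qed
    from eigenvectors_normalised[OF a(2,3) this] obtain u v k l where
      kl: "k \<noteq> l" and uv: "M *v u = a *s u" "M *v v = (- 1 / cnj a) *s v" "u $ k = 1" "v $ l = 1" "1 - u $ l * v $ k \<noteq> 0"
      by (elim exE conjE) (rule that)
    have "A *v x = ctranspose B *v (M *v x)" for x by (simp add: A matrix_vector_mul_assoc)
    then have "((A, B), (u, v, a)) \<in> chartE k l" using uv a(1)
      by (simp add: chartE_def matrix_vector_mult_smult del: divide_minus_left)
    then have "p \<in> fst ` chartE k l" unfolding AB by (rule image_eqI[rotated]) simp
    moreover have "l \<in> - {k}" using kl by simp
    ultimately show ?thesis by (intro UnI2 UN_I[of k] UN_I[of l]) auto
  qed
qed

theorem real_algebraic_dim_critical_points_le:
  "real_algebraic_dim (critical_points :: ('n::finite cmat \<times> 'n cmat) set) \<le> enat (4 * CARD('n) * CARD('n) - 2)"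
proof -
  define \<C> where "\<C> = (\<lambda>k. (chartA k, conj_closure (coordsA k))) ` (UNIV :: 'n set) \<union>
    (\<lambda>k. (chartB k, conj_closure (coordsB k))) ` UNIV \<union>
    (\<lambda>(k, l). (chartE k l, conj_closure (coordsE k l))) ` {(k, l). k \<noteq> l}"
  have fin: "finite \<C>" by (simp add: \<C>_def)
  have card: "card (conj_closure X) \<le> 4 * CARD('n) * CARD('n) - 2"
    if "card X \<le> 2 * CARD('n) * CARD('n) - 1" "finite X" for X :: "('n pencil \<Rightarrow> complex) set"
    using card_conj_closure[OF that(2)] that(1) by linarith
  show ?thesis
  proof (rule real_algebraic_dim_le[OF fin, where G = fst])
    fix U :: "'n pencil set" and X assume "(U, X) \<in> \<C>"
    then consider k where "U = chartA k" "X = conj_closure (coordsA k)"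
      | k where "U = chartB k" "X = conj_closure (coordsB k)"
      | k l where "k \<noteq> l" "U = chartE k l" "X = conj_closure (coordsE k l)"
      by (auto simp: \<C>_def)
    then show "finite X \<and> card X \<le> 4 * CARD('n) * CARD('n) - 2 \<and> (\<forall>b\<in>Basis. rat_on X U (\<lambda>p. complex_of_real (fst p \<bullet> b)))"
    proof cases
      case (1 k)
      show ?thesis unfolding 1
        by (intro conjI ballI finite_conj_closure finite_coords card card_coordsA
            rat_on_Basis[OF finite_coords(1) rat_on_chartA])
    next
      case (2 k)
      show ?thesis unfolding 2
        by (intro conjI ballI finite_conj_closure finite_coords card card_coordsA
            rat_on_Basis[OF finite_coords(2) rat_on_chartB])
    next
      case (3 k l)
      show ?thesis unfolding 3
        by (intro conjI ballI finite_conj_closure finite_coords card card_coordsE[OF 3(1)]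
            rat_on_Basis[OF finite_coords(3) rat_on_chartE[OF 3(1)]])
    qed
  next
    have sub: "fst ` U \<subseteq> (\<Union>(U, X)\<in>\<C>. fst ` U)" if "(U, X) \<in> \<C>" for U X
      using UN_upper[OF that, of "\<lambda>(U, X). fst ` U"] by simp
    have "fst ` chartA k \<subseteq> (\<Union>(U, X)\<in>\<C>. fst ` U)" for k
      by (rule sub[of _ "conj_closure (coordsA k)"]) (simp add: \<C>_def)
    moreover have "fst ` chartB k \<subseteq> (\<Union>(U, X)\<in>\<C>. fst ` U)" for k
      by (rule sub[of _ "conj_closure (coordsB k)"]) (simp add: \<C>_def)
    moreover have "fst ` chartE k l \<subseteq> (\<Union>(U, X)\<in>\<C>. fst ` U)" if "k \<noteq> l" for k l
      by (rule sub[of _ "conj_closure (coordsE k l)"]) (use that in \<open>auto simp: \<C>_def\<close>)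
    ultimately show "critical_points \<subseteq> (\<Union>(U, X)\<in>\<C>. fst ` U)"
      by (intro subset_trans[OF critical_points_covered] Un_least UN_least) auto
  qed
qed

subsection \<open>A flag in the eigenvalue locus\<close>

text \<open>The segment parameter is real, so conjugating the coefficients is enough.\<close>

lemma segment_rational_cnj:
  assumes "segment_rational T f"
  shows "segment_rational T (\<lambda>p. cnj (f p))"
  unfolding segment_rational_def
proof (intro ballI)
  fix p q assume "p \<in> T" "q \<in> T"
  with assms obtain P Q where PQ:
    "\<And>t. t \<in> {0..1} \<Longrightarrow> poly Q (complex_of_real t) \<noteq> 0 \<and> f (p + t *\<^sub>R (q - p)) = poly P (of_real t) / poly Q (of_real t)"
    unfolding segment_rational_def by blast
  have cnj: "poly (map_poly cnj R) (complex_of_real t) = cnj (poly R (of_real t))" for R t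
    using poly_cnj[of R "complex_of_real t"] by simp
  show "\<exists>P Q. \<forall>t\<in>{0..1}. poly Q (complex_of_real t) \<noteq> 0 \<and>
      cnj (f (p + t *\<^sub>R (q - p))) = poly P (of_real t) / poly Q (of_real t)"
    by (intro exI[of _ "map_poly cnj P"] exI[of _ "map_poly cnj Q"]) (simp add: cnj PQ)
qed

lemma segment_rational_diff:
  "segment_rational T f \<Longrightarrow> segment_rational T g \<Longrightarrow> segment_rational T (\<lambda>p. f p - g p)"
  using segment_rational_add[OF _ segment_rational_mult[OF segment_rational_const[of T "-1"]], of f g] by simp

lemma segment_rational_inner_complex:
  assumes "segment_rational T f" "b \<in> {1, \<i>}"
  shows "segment_rational T (\<lambda>p. complex_of_real (f p \<bullet> b))"
proof -
  have eq: "complex_of_real (f p \<bullet> 1) = (1 / 2) * (f p + cnj (f p))"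
    "complex_of_real (f p \<bullet> \<i>) = (- \<i> / 2) * (f p - cnj (f p))" for p
    by (simp_all add: inner_complex_def complex_eq_iff)
  have "segment_rational T (\<lambda>p. complex_of_real (f p \<bullet> 1))"
    "segment_rational T (\<lambda>p. complex_of_real (f p \<bullet> \<i>))" unfolding eq
    by (intro segment_rational_mult segment_rational_const segment_rational_add segment_rational_diff
        segment_rational_cnj assms)+
  then show ?thesis using assms(2) by auto
qed

definition unit_entry :: "'n::finite \<Rightarrow> 'n \<Rightarrow> complex \<Rightarrow> 'n cmat" where
  "unit_entry i j x = axis i (axis j x)"

lemma unit_entry_nth: "unit_entry i j x $ i' $ j' = (if i' = i \<and> j' = j then x else 0)"
  by (auto simp: unit_entry_def axis_def)

lemma inner_unit_entry: "(C :: 'n::finite cmat) \<bullet> unit_entry i j x = C $ i $ j \<bullet> x"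
  by (simp add: unit_entry_def inner_axis)

lemma Basis_cmat_prod:
  fixes b :: "'n::finite cmat \<times> 'n cmat"
  shows "b \<in> Basis \<longleftrightarrow> (\<exists>i j. \<exists>x\<in>{1, \<i>}. b = (unit_entry i j x, 0) \<or> b = (0, unit_entry i j x))"
  unfolding Basis_prod_def Un_iff image_iff Bex_def Basis_cmat unit_entry_def by auto

text \<open>The two indices mark the coordinate plane over which the plane of the prescribed
  eigenvectors is a graph.\<close>

locale eigenvector_flag =
  fixes k l :: "'n::finite"
  assumes kl: "k \<noteq> l"
begin

text \<open>A parameter matrix \<open>C\<close> encodes a matrix with the eigenvalues \<open>C\<^sub>k\<^sub>k\<close> and \<open>- 1 / cnj C\<^sub>k\<^sub>k\<close> whose
  eigenvectors span the plane with basis \<open>plane1 C\<close>, \<open>plane2 C\<close>. On this plane it acts by the conjugate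
  of the triangular matrix with diagonal entries the eigenvalues and corner \<open>C\<^sub>k\<^sub>l\<close>, under the unipotent
  matrix with corner \<open>C\<^sub>l\<^sub>k\<close>. The columns with other indices are those of \<open>C\<close>, and \<open>C\<^sub>l\<^sub>l\<close> is not used.\<close>
definition beta :: "'n cmat \<Rightarrow> complex" where "beta C = - inverse (cnj (C $ k $ k))"
definition plane1 :: "'n cmat \<Rightarrow> complex^'n" where
  "plane1 C = (\<chi> i. if i = k then 1 else if i = l then 0 else C $ i $ k)"
definition plane2 :: "'n cmat \<Rightarrow> complex^'n" where
  "plane2 C = (\<chi> i. if i = k then 0 else if i = l then 1 else C $ i $ l)"
definition col1 :: "'n cmat \<Rightarrow> complex^'n" where
  "col1 C = (C $ k $ k - C $ k $ l * C $ l $ k) *s plane1 C +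
    (C $ l $ k * C $ k $ k - C $ l $ k * C $ l $ k * C $ k $ l - C $ l $ k * beta C) *s plane2 C"
definition col2 :: "'n cmat \<Rightarrow> complex^'n" where
  "col2 C = C $ k $ l *s plane1 C + (C $ k $ l * C $ l $ k + beta C) *s plane2 C"
definition eigen_matrix :: "'n cmat \<Rightarrow> 'n cmat" where
  "eigen_matrix C = (\<chi> i j. if j = k then col1 C $ i - (\<Sum>j\<in>- {k, l}. C $ i $ j * plane1 C $ j)
     else if j = l then col2 C $ i - (\<Sum>j\<in>- {k, l}. C $ i $ j * plane2 C $ j) else C $ i $ j)"

lemma eigen_matrix_split:
  "(eigen_matrix C *v x) $ i = eigen_matrix C $ i $ k * x $ k + eigen_matrix C $ i $ l * x $ l + (\<Sum>j\<in>- {k, l}. C $ i $ j * x $ j)"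
proof -
  have 1: "- {k} = insert l (- {k, l})" using kl by auto
  have "(\<Sum>j\<in>- {k, l}. eigen_matrix C $ i $ j * x $ j) = (\<Sum>j\<in>- {k, l}. C $ i $ j * x $ j)"
    by (rule sum.cong) (auto simp: eigen_matrix_def)
  then show ?thesis unfolding matrix_vector_nth_remove[of _ x i k] 1 by simp
qed

text \<open>The columns \<open>k\<close> and \<open>l\<close> were obtained by solving these
  equations, which is possible because \<open>plane1 C\<close> and \<open>plane2 C\<close> have
  entries \<open>(1, 0)\<close> and \<open>(0, 1)\<close> at \<open>(k, l)\<close>.\<close>

lemma eigen_matrix_plane: "eigen_matrix C *v plane1 C = col1 C" "eigen_matrix C *v plane2 C = col2 C"
proof -
  have p: "plane1 C $ k = 1" "plane1 C $ l = 0" "plane2 C $ k = 0" "plane2 C $ l = 1"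
    using kl by (auto simp: plane1_def plane2_def)
  have e: "eigen_matrix C $ i $ k = col1 C $ i - (\<Sum>j\<in>- {k, l}. C $ i $ j * plane1 C $ j)"
    "eigen_matrix C $ i $ l = col2 C $ i - (\<Sum>j\<in>- {k, l}. C $ i $ j * plane2 C $ j)" for i
    using kl by (auto simp: eigen_matrix_def)
  show "eigen_matrix C *v plane1 C = col1 C" "eigen_matrix C *v plane2 C = col2 C"
    by (simp_all add: vec_eq_iff eigen_matrix_split p e)
qed

text \<open>The witnesses are the images, under the unipotent matrix, of the eigenvectors
  \<open>(1, 0)\<close> and \<open>(C $ k $ l, beta C - C $ k $ k)\<close> of the triangular one.
  The second is nonzero because a nonzero number never equals minus the inverse of its
  conjugate.\<close>

lemma eigen_matrix_eigenvectors:
  assumes "C $ k $ k \<noteq> 0"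
  shows "\<exists>u v. u \<noteq> 0 \<and> v \<noteq> 0 \<and> eigen_matrix C *v u = C $ k $ k *s u \<and> eigen_matrix C *v v = beta C *s v"
proof (intro exI conjI)
  let ?u = "plane1 C + C $ l $ k *s plane2 C"
  let ?v = "C $ k $ l *s plane1 C + (C $ k $ l * C $ l $ k + beta C - C $ k $ k) *s plane2 C"
  have p: "plane1 C $ k = 1" "plane1 C $ l = 0" "plane2 C $ k = 0" "plane2 C $ l = 1"
    using kl by (auto simp: plane1_def plane2_def)
  have "?u $ k = 1" by (simp add: p)
  then show "?u \<noteq> 0" by (metis zero_index zero_neq_one)
  show "?v \<noteq> 0"
  proof
    assume 0: "?v = 0"
    have "?v $ k = 0" "?v $ l = 0" unfolding 0 by simp_all
    then have "beta C = C $ k $ k" by (simp add: p)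
    then have "C $ k $ k * cnj (C $ k $ k) = - 1" using assms by (simp add: beta_def field_simps)
    then have "Re (C $ k $ k) * Re (C $ k $ k) + Im (C $ k $ k) * Im (C $ k $ k) = - 1" by (simp add: complex_eq_iff)
    then show False using zero_le_square[of "Re (C $ k $ k)"] zero_le_square[of "Im (C $ k $ k)"] by linarith
  qed
  show "eigen_matrix C *v ?u = C $ k $ k *s ?u"
    by (simp add: matrix_vector_right_distrib matrix_vector_mult_smult eigen_matrix_plane col1_def col2_def vec_eq_iff algebra_simps)
  show "eigen_matrix C *v ?v = beta C *s ?v"
    by (simp add: matrix_vector_right_distrib matrix_vector_mult_smult eigen_matrix_plane col1_def col2_def vec_eq_iff algebra_simps)
qed

section \<open>The parametrised family and the order of freezing\<close>

text \<open>A half-space is convex and keeps \<open>C $ k $ k\<close> away from zero, so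
  \<open>beta\<close> has no pole on any segment.\<close>

definition params :: "('n cmat \<times> 'n cmat) set" where "params = {(C, B). Re (C $ k $ k) > 0}"
definition flag_map :: "'n cmat \<times> 'n cmat \<Rightarrow> 'n cmat \<times> 'n cmat" where
  "flag_map = (\<lambda>(C, B). (ctranspose B ** eigen_matrix C, B))"
text \<open>The eigenvalues here are 1 and -1; their difference and both values are nonzero, which
  makes the coordinates frozen after the eigenvalue detectable.\<close>

definition base :: "'n cmat \<times> 'n cmat" where "base = (unit_entry k k 1, mat 1)"
text \<open>Without the real and imaginary directions of \<open>C $ l $ l\<close>, on which the
  image does not depend, \<open>4 n\<^sup>2 - 2\<close> directions remain.\<close>

definition free_basis :: "('n cmat \<times> 'n cmat) set" where
  "free_basis = Basis - {(unit_entry l l 1, 0), (unit_entry l l \<i>, 0)}"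
text \<open>Coordinates are frozen to their values at \<open>base\<close> by increasing rank. The ranks are chosen such that
  each coordinate is detected by a linear functional of \<open>flag_map\<close> once those of lower rank are frozen.\<close>
definition rank :: "'n cmat \<times> 'n cmat \<Rightarrow> nat" where
  "rank = (\<lambda>(C, B). if C = 0 then 0 else if C $ k $ k = \<i> then 2 else if C $ k $ k = 1 then 3
     else if C $ k $ l \<noteq> 0 then 4 else if C $ l $ k \<noteq> 0 then 5
     else if \<exists>i. C $ i $ k \<noteq> 0 \<or> C $ i $ l \<noteq> 0 then 6 else 1)"

lemma flag_map_critical: "flag_map ` params \<subseteq> critical_points"
proof clarify
  fix A B' C B assume CB: "(C, B) \<in> params" "(A, B') = flag_map (C, B)"
  then have C: "C $ k $ k \<noteq> 0" by (auto simp: params_def)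
  then obtain u v where uv: "u \<noteq> 0" "v \<noteq> 0" "eigen_matrix C *v u = C $ k $ k *s u" "eigen_matrix C *v v = beta C *s v"
    using eigen_matrix_eigenvectors by blast
  have "beta C = - 1 / cnj (C $ k $ k)" by (simp add: beta_def field_simps)
  then show "(A, B') \<in> critical_points"
    using CB(2) critical_if_eigenvectors[of A B "eigen_matrix C" u "C $ k $ k" v] uv C by (simp add: flag_map_def)
qed

lemma convex_params: "convex params"
proof -
  have "params = {p. (unit_entry k k 1, 0) \<bullet> p > 0}"
    by (auto simp: params_def inner_prod_def inner_commute[of "unit_entry k k 1"] inner_unit_entry inner_complex_def)
  then show ?thesis by (simp only: convex_halfspace_gt)
qed

lemma segment_rational_flag_map:
  assumes "b \<in> Basis"
  shows "segment_rational params (\<lambda>p. complex_of_real (flag_map p \<bullet> b))"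
proof -
  let ?R = "segment_rational params"
  have C: "?R (\<lambda>p. fst p $ i $ j)" and B: "?R (\<lambda>p. snd p $ i $ j)" for i j
    by (rule segment_rational_affine, simp add: scaleR_conv_of_real[where 'a = complex])+
  have beta: "?R (\<lambda>p. beta (fst p))"
  proof -
    have eq: "(\<lambda>p. beta (fst p)) = (\<lambda>p :: 'n cmat \<times> 'n cmat. 0 - inverse (cnj (fst p $ k $ k)))"
      by (rule ext) (simp only: beta_def diff_0)
    show ?thesis unfolding eq
      by (intro segment_rational_diff segment_rational_const segment_rational_inverse
          segment_rational_cnj C convex_params) (auto simp: params_def)
  qed
  have p1: "?R (\<lambda>p. plane1 (fst p) $ i)" and p2: "?R (\<lambda>p. plane2 (fst p) $ i)" for i
  proof -
    have eq: "(\<lambda>p. plane1 (fst p) $ i) = (if i = k then (\<lambda>p :: 'n cmat \<times> 'n cmat. 1) else if i = l then (\<lambda>p. 0) else (\<lambda>p. fst p $ i $ k))"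
      "(\<lambda>p. plane2 (fst p) $ i) = (if i = k then (\<lambda>p :: 'n cmat \<times> 'n cmat. 0) else if i = l then (\<lambda>p. 1) else (\<lambda>p. fst p $ i $ l))"
      by (simp_all add: fun_eq_iff plane1_def plane2_def)
    show "?R (\<lambda>p. plane1 (fst p) $ i)" "?R (\<lambda>p. plane2 (fst p) $ i)"
      unfolding eq using C[of i k] C[of i l] segment_rational_const by (simp_all only: split: if_split) blast+
  qed
  note intros = segment_rational_add segment_rational_diff segment_rational_mult segment_rational_sum C B beta p1 p2
  have c1: "?R (\<lambda>p. col1 (fst p) $ i)" for i
    by (simp only: col1_def vector_add_component vector_smult_component) (intro intros)
  have c2: "?R (\<lambda>p. col2 (fst p) $ i)" for i
    by (simp only: col2_def vector_add_component vector_smult_component) (intro intros)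
  have M: "?R (\<lambda>p. eigen_matrix (fst p) $ i $ j)" for i j
  proof -
    have "?R (\<lambda>p. col1 (fst p) $ i - (\<Sum>j\<in>- {k, l}. fst p $ i $ j * plane1 (fst p) $ j))"
      "?R (\<lambda>p. col2 (fst p) $ i - (\<Sum>j\<in>- {k, l}. fst p $ i $ j * plane2 (fst p) $ j))"
      by (intro segment_rational_diff segment_rational_mult segment_rational_sum C p1 p2 c1 c2)+
    then show ?thesis using C[of i j] kl by (cases "j = k"; cases "j = l"; simp add: eigen_matrix_def)
  qed
  have A: "?R (\<lambda>p. fst (flag_map p) $ i $ j)" for i j
    unfolding flag_map_def case_prod_unfold fst_conv matrix_mult_nth ctranspose_nth
    by (intro segment_rational_sum segment_rational_mult segment_rational_cnj B M)
  have B': "?R (\<lambda>p. snd (flag_map p) $ i $ j)" for i j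
    unfolding flag_map_def case_prod_unfold snd_conv by (rule B)
  from assms obtain i j x where x: "x \<in> {1, \<i>}" and b: "b = (unit_entry i j x, 0) \<or> b = (0, unit_entry i j x)"
    unfolding Basis_cmat_prod by (elim exE bexE) (rule that)
  from b show ?thesis
  proof
    assume "b = (unit_entry i j x, 0)"
    then have "flag_map p \<bullet> b = fst (flag_map p) $ i $ j \<bullet> x" for p
      by (simp add: inner_prod_def inner_unit_entry)
    then show ?thesis using segment_rational_inner_complex[OF A x] by (simp only:)
  next
    assume "b = (0, unit_entry i j x)"
    then have "flag_map p \<bullet> b = snd (flag_map p) $ i $ j \<bullet> x" for p
      by (simp add: inner_prod_def inner_unit_entry)
    then show ?thesis using segment_rational_inner_complex[OF B' x] by (simp only:)
  qed
qed

end

context eigenvector_flag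
begin

lemma rank_unit_entry:
  assumes "x \<in> {1, \<i>}"
  shows "rank (unit_entry i j x, B) = (if j \<noteq> k \<and> j \<noteq> l then 1 else if i = k \<and> j = k then (if x = \<i> then 2 else 3)
    else if i = k \<and> j = l then 4 else if i = l \<and> j = k then 5 else 6)"
proof -
  have x: "x \<noteq> 0" using assms by auto
  have "unit_entry i j x $ i $ j \<noteq> 0" using x by (simp add: unit_entry_nth)
  then have nz: "unit_entry i j x \<noteq> 0" by (metis zero_index)
  have ex: "(\<exists>i'. unit_entry i j x $ i' $ k \<noteq> 0 \<or> unit_entry i j x $ i' $ l \<noteq> 0) \<longleftrightarrow> j = k \<or> j = l"
    using x by (auto simp: unit_entry_nth)
  have "x = 1 \<or> x = \<i>" using assms by simp
  then show ?thesis unfolding rank_def prod.case ex using nz kl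
    by (elim disjE) (simp_all add: unit_entry_nth)
qed

definition agrees :: "nat \<Rightarrow> 'n cmat \<times> 'n cmat \<Rightarrow> bool" where
  "agrees r p \<longleftrightarrow> (\<forall>b\<in>free_basis. rank b < r \<longrightarrow> p \<bullet> b = base \<bullet> b)"

lemma agrees_snd:
  assumes "agrees r p" "r \<ge> 1"
  shows "snd p = mat 1"
proof -
  have "snd p $ i $ j \<bullet> x = mat 1 $ i $ j \<bullet> x" if "x \<in> {1, \<i>}" for i j x
  proof -
    have "unit_entry l l y \<noteq> 0" if "y \<noteq> 0" for y using that by (metis unit_entry_nth zero_index)
    then have "(0, unit_entry i j x) \<in> free_basis" using that by (auto simp: free_basis_def Basis_cmat_prod)
    moreover have "rank (0, unit_entry i j x) = 0" by (simp add: rank_def)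
    ultimately have "p \<bullet> (0, unit_entry i j x) = base \<bullet> (0, unit_entry i j x)" using assms unfolding agrees_def by force
    then show ?thesis by (simp add: inner_prod_def base_def inner_unit_entry)
  qed
  from this[of 1] this[of \<i>]
  have "Re (snd p $ i $ j) = Re (mat 1 $ i $ j)" "Im (snd p $ i $ j) = Im (mat 1 $ i $ j)" for i j
    by (simp_all add: inner_complex_def)
  then show ?thesis by (simp add: vec_eq_iff complex_eq_iff)
qed

lemma agrees_entry:
  assumes "agrees r p" "x \<in> {1, \<i>}" "(i, j) \<noteq> (l, l)" "rank (unit_entry i j x, 0) < r"
  shows "fst p $ i $ j \<bullet> x = unit_entry k k 1 $ i $ j \<bullet> x"
proof -
  have "unit_entry i j x \<noteq> unit_entry l l y" if "y \<noteq> 0" for y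
  proof
    assume "unit_entry i j x = unit_entry l l y"
    then have "unit_entry i j x $ l $ l = y" by (simp add: unit_entry_nth)
    then show False using that assms(3) by (auto simp: unit_entry_nth split: if_splits)
  qed
  then have "(unit_entry i j x, 0) \<in> free_basis" using assms(2) by (auto simp: free_basis_def Basis_cmat_prod)
  then have "p \<bullet> (unit_entry i j x, 0) = base \<bullet> (unit_entry i j x, 0)" using assms unfolding agrees_def by blast
  then show ?thesis by (simp add: inner_prod_def base_def inner_unit_entry)
qed

lemma agrees_entry_complex:
  assumes "agrees r p" "(i, j) \<noteq> (l, l)" "rank (unit_entry i j 1, 0) < r" "rank (unit_entry i j \<i>, 0) < r"
  shows "fst p $ i $ j = (if i = k \<and> j = k then 1 else 0)"
  using agrees_entry[OF assms(1) _ assms(2,3)] agrees_entry[OF assms(1) _ assms(2,4)]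
  by (auto simp: complex_eq_iff inner_complex_def unit_entry_nth split: if_splits)

lemma flag_map_agrees:
  assumes "agrees r p" "r \<ge> 1"
  shows "fst (flag_map p) = eigen_matrix (fst p)"
  using agrees_snd[OF assms] by (simp add: flag_map_def case_prod_unfold)

text \<open>The columns outside \<open>k\<close> and \<open>l\<close> are frozen to zero, so the
  correction sums drop out.\<close>

lemma eigen_matrix_agrees:
  assumes "agrees r p" "r \<ge> 2"
  shows "eigen_matrix (fst p) $ i $ k = col1 (fst p) $ i" "eigen_matrix (fst p) $ i $ l = col2 (fst p) $ i"
proof -
  have "fst p $ i $ j = 0" if "j \<notin> {k, l}" for j
    using agrees_entry_complex[OF assms(1), of i j] that assms(2) by (simp add: rank_unit_entry)
  then have 0: "(\<Sum>j\<in>- {k, l}. fst p $ i $ j * x $ j) = 0" for x :: "complex^'n"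
    by (intro sum.neutral) auto
  show "eigen_matrix (fst p) $ i $ k = col1 (fst p) $ i" "eigen_matrix (fst p) $ i $ l = col2 (fst p) $ i"
    using kl by (auto simp: eigen_matrix_def 0)
qed

text \<open>The block at \<open>k\<close>, \<open>l\<close> is conjugate to a triangular one, so its
  trace sees only the eigenvalues, whatever the corners that are not yet frozen.\<close>

lemma trace_agrees:
  assumes "agrees r p" "r \<ge> 2"
  shows "fst (flag_map p) $ k $ k + fst (flag_map p) $ l $ l = fst p $ k $ k + beta (fst p)"
  using assms kl
  by (simp add: flag_map_agrees[OF assms(1)] eigen_matrix_agrees[OF assms] col1_def col2_def plane1_def plane2_def)

end

context eigenvector_flag
begin

text \<open>The increment 1 is the one attained at \<open>base + b\<close>, the test point used for
  each basis vector \<open>b\<close>.\<close>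

lemma flag_step:
  assumes "b \<in> free_basis"
  shows "\<exists>e c. \<forall>p\<in>params. agrees (rank b) p \<longrightarrow>
    (p \<bullet> b = base \<bullet> b \<longrightarrow> flag_map p \<bullet> e = c) \<and> (p \<bullet> b = base \<bullet> b + 1 \<longrightarrow> flag_map p \<bullet> e \<noteq> c)"
proof -
  from assms have "b \<in> Basis" and ne: "b \<noteq> (unit_entry l l 1, 0)" "b \<noteq> (unit_entry l l \<i>, 0)"
    by (simp_all add: free_basis_def)
  then obtain i j x where x: "x \<in> {1, \<i>}" and b: "b = (unit_entry i j x, 0) \<or> b = (0, unit_entry i j x)"
    unfolding Basis_cmat_prod by (elim exE bexE) (rule that)
  have ij: "(i, j) \<noteq> (l, l)" if "b = (unit_entry i j x, 0)"
    using x ne that by auto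
  have xx: "x \<bullet> x = 1" using x by (auto simp: inner_complex_def)
  show ?thesis
  proof (cases "b = (0, unit_entry i j x)")
    case True
    have "flag_map p \<bullet> b = p \<bullet> b" for p by (simp add: True flag_map_def inner_prod_def case_prod_unfold)
    then show ?thesis by (intro exI[of _ b] exI[of _ "base \<bullet> b"]) simp
  next
    case False
    then have b: "b = (unit_entry i j x, 0)" using b by blast
    have ij: "(i, j) \<noteq> (l, l)" using ij[OF b] .
    have pb: "p \<bullet> b = fst p $ i $ j \<bullet> x" for p by (simp add: b inner_prod_def inner_unit_entry)
    have rk: "rank b \<ge> 1" by (simp add: b rank_unit_entry[OF x])
    note fm = flag_map_agrees[OF _ rk]
    consider "j \<noteq> k" "j \<noteq> l" | "i = k" "j = k" "x = \<i>" | "i = k" "j = k" "x = 1" | "i = k" "j = l"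
      | "i = l" "j = k" | "i \<noteq> k" "i \<noteq> l" "j = k" | "i \<noteq> k" "i \<noteq> l" "j = l"
      using x ij by auto
    then show ?thesis
    proof cases
      case 1
      have "flag_map p \<bullet> b = p \<bullet> b" if "agrees (rank b) p" for p
        using 1 by (simp add: b inner_prod_def inner_unit_entry fm[OF that] eigen_matrix_def)
      then show ?thesis by (intro exI[of _ b] exI[of _ "base \<bullet> b"]) simp
    next
      case 2
      have r: "rank b = 2" using rank_unit_entry[OF x] 2 by (simp add: b)
      \<comment> \<open>The imaginary part of the trace \<open>z - 1 / cnj z\<close>, that is of
        \<open>z * (1 - 1 / (cmod z)\<^sup>2)\<close>. It vanishes for real \<open>z\<close>, but
        not for \<open>Im z = 1\<close> with \<open>Re z > 0\<close>, where the modulus exceeds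
        1.\<close>
      define e where "e = (unit_entry k k \<i> + unit_entry l l \<i>, 0 :: 'n cmat)"
      have e: "flag_map p \<bullet> e = Im (fst p $ k $ k) * (1 - 1 / ((Re (fst p $ k $ k))\<^sup>2 + (Im (fst p $ k $ k))\<^sup>2))"
        if "agrees (rank b) p" for p
      proof -
        have "flag_map p \<bullet> e = Im (fst (flag_map p) $ k $ k + fst (flag_map p) $ l $ l)"
          by (simp add: e_def inner_prod_def inner_add_right inner_unit_entry inner_complex_def)
        also have "\<dots> = Im (fst p $ k $ k + beta (fst p))" using trace_agrees[OF that] r by simp
        finally show ?thesis by (simp add: beta_def algebra_simps)
      qed
      have "flag_map p \<bullet> e \<noteq> 0" if p: "p \<in> params" "agrees (rank b) p" "p \<bullet> b = base \<bullet> b + 1" for p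
      proof -
        have im: "Im (fst p $ k $ k) = 1" using p(3) by (simp add: pb 2 base_def unit_entry_nth inner_complex_def)
        have "Re (fst p $ k $ k) > 0" using p(1) by (auto simp: params_def)
        then have "(Re (fst p $ k $ k))\<^sup>2 > 0" by simp
        then show ?thesis unfolding e[OF p(2)] im by (simp add: field_simps)
      qed
      moreover have "flag_map p \<bullet> e = 0" if p: "agrees (rank b) p" "p \<bullet> b = base \<bullet> b" for p
      proof -
        have "Im (fst p $ k $ k) = 0" using p(2) by (simp add: pb 2 base_def unit_entry_nth inner_complex_def)
        then show ?thesis unfolding e[OF p(1)] by simp
      qed
      ultimately show ?thesis by blast
    next
      case 3
      have r: "rank b = 3" using rank_unit_entry[OF x] 3 by (simp add: b)
      \<comment> \<open>With the imaginary part frozen, the trace is \<open>x - 1 / x\<close> for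
        the real part \<open>x\<close>: zero at 1, nonzero at 2.\<close>
      define e where "e = (unit_entry k k 1 + unit_entry l l 1, 0 :: 'n cmat)"
      have e: "flag_map p \<bullet> e = Re (fst p $ k $ k) - 1 / Re (fst p $ k $ k)" if p: "agrees (rank b) p" "p \<in> params" for p
      proof -
        have "fst p $ k $ k \<bullet> \<i> = 0"
          using agrees_entry[OF p(1), of \<i> k k] kl r by (simp add: rank_unit_entry unit_entry_nth inner_complex_def)
        then have "fst p $ k $ k = of_real (Re (fst p $ k $ k))" by (simp add: complex_eq_iff inner_complex_def)
        then have "beta (fst p) = - of_real (1 / Re (fst p $ k $ k))"
          unfolding beta_def by (metis complex_cnj_complex_of_real inverse_eq_divide of_real_inverse)
        moreover have "flag_map p \<bullet> e = Re (fst (flag_map p) $ k $ k + fst (flag_map p) $ l $ l)"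
          by (simp add: e_def inner_prod_def inner_add_right inner_unit_entry inner_complex_def)
        moreover have "\<dots> = Re (fst p $ k $ k + beta (fst p))" using trace_agrees[OF p(1)] r by simp
        ultimately show ?thesis by simp
      qed
      have "flag_map p \<bullet> e \<noteq> 0" if p: "p \<in> params" "agrees (rank b) p" "p \<bullet> b = base \<bullet> b + 1" for p
      proof -
        have "Re (fst p $ k $ k) = 2" using p(3) by (simp add: pb 3 base_def unit_entry_nth inner_complex_def)
        then show ?thesis unfolding e[OF p(2,1)] by simp
      qed
      moreover have "flag_map p \<bullet> e = 0" if p: "p \<in> params" "agrees (rank b) p" "p \<bullet> b = base \<bullet> b" for p
      proof -
        have "Re (fst p $ k $ k) = 1" using p(3) by (simp add: pb 3 base_def unit_entry_nth inner_complex_def)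
        then show ?thesis unfolding e[OF p(2,1)] by simp
      qed
      ultimately show ?thesis by blast
    next
      case 4
      have r: "rank b = 4" using rank_unit_entry[OF x] 4 kl by (simp add: b)
      have "flag_map p \<bullet> b = p \<bullet> b" if "agrees (rank b) p" for p
        using 4 kl r by (simp add: b inner_prod_def inner_unit_entry fm[OF that] eigen_matrix_agrees[OF that]
            col2_def plane1_def plane2_def)
      then show ?thesis by (intro exI[of _ b] exI[of _ "base \<bullet> b"]) simp
    next
      case 5
      have r: "rank b = 5" using rank_unit_entry[OF x] 5 kl by (simp add: b)
      \<comment> \<open>The lower left entry of the block is now \<open>C $ l $ k\<close> times the
        difference of the eigenvalues 1 and -1.\<close>
      have "flag_map p \<bullet> b = 2 * (p \<bullet> b)" if that: "agrees (rank b) p" for p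
      proof -
        have "fst p $ k $ k = 1" "fst p $ k $ l = 0"
          using agrees_entry_complex[OF that, of k k] agrees_entry_complex[OF that, of k l] r kl
          by (simp_all add: rank_unit_entry)
        moreover have "(2 * z) \<bullet> x = 2 * (z \<bullet> x)" for z by (simp add: inner_complex_def)
        ultimately show ?thesis
          using 5 kl r by (simp add: b inner_prod_def inner_unit_entry fm[OF that] eigen_matrix_agrees[OF that]
            col1_def plane1_def plane2_def beta_def inner_add_left)
      qed
      then show ?thesis by (intro exI[of _ b] exI[of _ "2 * (base \<bullet> b)"]) simp
    next
      case 6
      have r: "rank b = 6" using rank_unit_entry[OF x] 6 kl by (simp add: b)
      have "flag_map p \<bullet> b = p \<bullet> b" if that: "agrees (rank b) p" for p
      proof -
        have "fst p $ k $ k = 1" "fst p $ k $ l = 0" "fst p $ l $ k = 0"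
          using agrees_entry_complex[OF that, of k k] agrees_entry_complex[OF that, of k l]
            agrees_entry_complex[OF that, of l k] r kl by (simp_all add: rank_unit_entry)
        then show ?thesis
          using 6 kl r by (simp add: b inner_prod_def inner_unit_entry fm[OF that] eigen_matrix_agrees[OF that]
            col1_def plane1_def plane2_def beta_def)
      qed
      then show ?thesis by (intro exI[of _ b] exI[of _ "base \<bullet> b"]) simp
    next
      case 7
      have r: "rank b = 6" using rank_unit_entry[OF x] 7 kl by (simp add: b)
      \<comment> \<open>With both corners frozen to zero, \<open>col2\<close> is the eigenvalue -1
        times \<open>plane2\<close>.\<close>
      have "flag_map p \<bullet> b = - (p \<bullet> b)" if that: "agrees (rank b) p" for p
      proof -
        have "fst p $ k $ k = 1" "fst p $ k $ l = 0" "fst p $ l $ k = 0"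
          using agrees_entry_complex[OF that, of k k] agrees_entry_complex[OF that, of k l]
            agrees_entry_complex[OF that, of l k] r kl by (simp_all add: rank_unit_entry)
        then show ?thesis
          using 7 kl r by (simp add: b inner_prod_def inner_unit_entry fm[OF that] eigen_matrix_agrees[OF that]
            col2_def plane1_def plane2_def beta_def)
      qed
      then show ?thesis by (intro exI[of _ b] exI[of _ "- (base \<bullet> b)"]) simp
    qed
  qed
qed

lemma real_algebraic_dim_critical_points_ge:
  "enat (4 * CARD('n) * CARD('n) - 2) \<le> real_algebraic_dim (critical_points :: ('n cmat \<times> 'n cmat) set)"
proof -
  have "enat (card free_basis) \<le> real_algebraic_dim (critical_points :: ('n cmat \<times> 'n cmat) set)"
  proof (rule real_algebraic_dim_ge[OF convex_params _ segment_rational_flag_map flag_map_critical, of base free_basis rank])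
    show "base \<in> params" by (simp add: base_def params_def unit_entry_nth)
    show "free_basis \<subseteq> Basis" by (auto simp: free_basis_def)
    fix b assume b: "b \<in> free_basis"
    then have bB: "b \<in> Basis" by (auto simp: free_basis_def)
    obtain e c where ec: "\<And>p. p \<in> params \<Longrightarrow> agrees (rank b) p \<Longrightarrow>
        (p \<bullet> b = base \<bullet> b \<longrightarrow> flag_map p \<bullet> e = c) \<and> (p \<bullet> b = base \<bullet> b + 1 \<longrightarrow> flag_map p \<bullet> e \<noteq> c)"
      using flag_step[OF b] by blast
    have q: "(base + b) \<bullet> b' = base \<bullet> b'" if "b' \<in> free_basis" "b' \<noteq> b" for b'
      using inner_not_same_Basis[OF bB, of b'] that by (auto simp: inner_add_left free_basis_def)
    have qb: "(base + b) \<bullet> b = base \<bullet> b + 1" using inner_same_Basis[OF bB] by (simp add: inner_add_left)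
    have "base + b \<in> params"
    proof -
      from bB obtain i j x where "x \<in> {1, \<i>}" "b = (unit_entry i j x, 0) \<or> b = (0, unit_entry i j x)"
        unfolding Basis_cmat_prod by blast
      then show ?thesis by (auto simp: base_def params_def unit_entry_nth)
    qed
    moreover have "agrees (rank b) (base + b)" using q by (auto simp: agrees_def)
    ultimately have "flag_map (base + b) \<bullet> e - c \<noteq> 0" using ec qb by simp
    moreover have "real_polynomial_function (\<lambda>y. y \<bullet> e - c)"
      by (intro real_polynomial_function_diff real_polynomial_function.intros(1,2) bounded_linear_inner_left)
    ultimately show "\<exists>f q. real_polynomial_function f \<and>
        (\<forall>p\<in>params. (\<forall>b'\<in>free_basis. rank b' < rank b \<longrightarrow> p \<bullet> b' = base \<bullet> b') \<longrightarrow> p \<bullet> b = base \<bullet> b \<longrightarrow> f (flag_map p) = 0) \<and>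
        q \<in> params \<and> (\<forall>b'\<in>free_basis. b' \<noteq> b \<longrightarrow> q \<bullet> b' = base \<bullet> b') \<and> f (flag_map q) \<noteq> 0"
      using ec q \<open>base + b \<in> params\<close>
      by (intro exI[of _ "\<lambda>y. y \<bullet> e - c"] exI[of _ "base + b"]) (simp add: agrees_def)
  qed
  moreover have "card free_basis = 4 * CARD('n) * CARD('n) - 2"
  proof -
    have "unit_entry l l 1 $ l $ l \<noteq> unit_entry l l \<i> $ l $ l" by (simp add: unit_entry_nth)
    then have "unit_entry l l 1 \<noteq> unit_entry l l \<i>" by metis
    moreover have "{(unit_entry l l 1, 0), (unit_entry l l \<i>, 0)} \<subseteq> (Basis :: ('n cmat \<times> 'n cmat) set)"
      by (auto simp: Basis_cmat_prod)
    ultimately have "card free_basis = DIM('n cmat \<times> 'n cmat) - 2"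
      unfolding free_basis_def by (subst card_Diff_subset) auto
    then show ?thesis by simp
  qed
  ultimately show ?thesis by simp
qed

end

lemma interior_critical_points: "interior (critical_points :: ('n::finite cmat \<times> 'n cmat) set) = {}"
proof (rule ccontr)
  assume "interior (critical_points :: ('n cmat \<times> 'n cmat) set) \<noteq> {}"
  then obtain x e where e: "e > 0" "ball x e \<subseteq> (critical_points :: ('n cmat \<times> 'n cmat) set)"
    by (auto simp: mem_interior)
  have "enat (card (Basis :: ('n cmat \<times> 'n cmat) set)) \<le> real_algebraic_dim (critical_points :: ('n cmat \<times> 'n cmat) set)"
  \<comment> \<open>The ball is parametrised by the identity and each coordinate detects itself, so
    a constant rank suffices.\<close>
  proof (rule real_algebraic_dim_ge[of "ball x e" x "\<lambda>p. p" _ _ "\<lambda>_. 0"])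
    show "segment_rational (ball x e) (\<lambda>p. complex_of_real (p \<bullet> b))" for b
      by (rule segment_rational_affine) (simp add: inner_add_left inner_diff_left)
    fix b :: "'n cmat \<times> 'n cmat" assume b: "b \<in> Basis"
    show "\<exists>f q. real_polynomial_function f \<and>
        (\<forall>p\<in>ball x e. (\<forall>b'\<in>Basis. (0::nat) < 0 \<longrightarrow> p \<bullet> b' = x \<bullet> b') \<longrightarrow> p \<bullet> b = x \<bullet> b \<longrightarrow> f p = 0) \<and>
        q \<in> ball x e \<and> (\<forall>b'\<in>Basis. b' \<noteq> b \<longrightarrow> q \<bullet> b' = x \<bullet> b') \<and> f q \<noteq> 0"
    proof (intro exI conjI)
      show "real_polynomial_function (\<lambda>y. y \<bullet> b - x \<bullet> b)"
        by (intro real_polynomial_function_diff real_polynomial_function.intros(1,2) bounded_linear_inner_left)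
      show "x + (e / 2) *\<^sub>R b \<in> ball x e" using e(1) b by (simp add: dist_norm)
      show "\<forall>b'\<in>Basis. b' \<noteq> b \<longrightarrow> (x + (e / 2) *\<^sub>R b) \<bullet> b' = x \<bullet> b'"
        using b by (auto simp: inner_add_left inner_not_same_Basis)
      show "(x + (e / 2) *\<^sub>R b) \<bullet> b - x \<bullet> b \<noteq> 0" using e(1) b by (simp add: inner_add_left)
    qed simp
  qed (use e in auto)
  also have "\<dots> \<le> enat (4 * CARD('n) * CARD('n) - 2)" by (rule real_algebraic_dim_critical_points_le)
  finally have "DIM('n cmat \<times> 'n cmat) \<le> 4 * CARD('n) * CARD('n) - 2" by (simp only: enat_ord_simps)
  moreover have "DIM('n cmat \<times> 'n cmat) = 4 * CARD('n) * CARD('n)" by simp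
  \<comment> \<open>Subtraction of naturals is truncated, so positivity is needed for the
    contradiction.\<close>
  moreover have "4 * CARD('n) * CARD('n) > 0" by (simp add: card_gt_0_iff)
  ultimately show False by linarith
qed

theorem theorem4p3:
  assumes "CARD('n::finite) > 1"
  shows "(\<forall>A B :: 'n cmat. invertible A \<longrightarrow> invertible B \<longrightarrow>
           ((A, B) \<in> critical_points \<longleftrightarrow>
             (\<exists>l :: complex. l \<noteq> 0 \<and>
               has_eigenvalue (matrix_inv B ** ctranspose A) l \<and>
               has_eigenvalue (matrix_inv B ** ctranspose A) (- 1 / cnj l)))) \<and>
         real_algebraic_dim (critical_points :: ('n cmat \<times> 'n cmat) set) + 2
           = enat DIM('n cmat \<times> 'n cmat) \<and>
         open (regular_points :: ('n cmat \<times> 'n cmat) set) \<and>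
         closure (regular_points :: ('n cmat \<times> 'n cmat) set) = UNIV"
proof (intro conjI)
  show "\<forall>A B :: 'n cmat. invertible A \<longrightarrow> invertible B \<longrightarrow>
           ((A, B) \<in> critical_points \<longleftrightarrow>
             (\<exists>l :: complex. l \<noteq> 0 \<and>
               has_eigenvalue (matrix_inv B ** ctranspose A) l \<and>
               has_eigenvalue (matrix_inv B ** ctranspose A) (- 1 / cnj l)))"
    using critical_iff_eigenvalues by blast
  \<comment> \<open>This is where \<open>n > 1\<close> enters: a pair of distinct eigenvalues needs
    a plane.\<close>
  obtain k l :: 'n where "k \<noteq> l"
    using assms card_le_Suc0_iff_eq[of "UNIV :: 'n set"] by auto
  then interpret eigenvector_flag k l by unfold_locales
  have "real_algebraic_dim (critical_points :: ('n cmat \<times> 'n cmat) set) = enat (4 * CARD('n) * CARD('n) - 2)"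
    by (rule antisym[OF real_algebraic_dim_critical_points_le real_algebraic_dim_critical_points_ge])
  moreover obtain m where "CARD('n) = Suc m" using assms less_imp_Suc_add by blast
  then have "4 * CARD('n) * CARD('n) - 2 + 2 = 4 * CARD('n) * CARD('n)" by simp
  moreover have "DIM('n cmat \<times> 'n cmat) = 4 * CARD('n) * CARD('n)" by simp
  moreover have "enat (4 * CARD('n) * CARD('n) - 2) + 2 = enat (4 * CARD('n) * CARD('n) - 2 + 2)"
    by (simp only: numeral_eq_enat plus_enat_simps)
  ultimately show "real_algebraic_dim (critical_points :: ('n cmat \<times> 'n cmat) set) + 2 = enat DIM('n cmat \<times> 'n cmat)"
    by (simp only:)
  show "open (regular_points :: ('n cmat \<times> 'n cmat) set)"
    by (simp add: regular_points_def closed_critical_points open_Compl)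
  show "closure (regular_points :: ('n cmat \<times> 'n cmat) set) = UNIV"
    by (simp add: regular_points_def closure_complement interior_critical_points)
qed

end
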